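(* Let $K$ be a $p$-adic field, let $1\le r\le n-1$, and let $f(x)=\dfrac{\widehat f(x)}{\prod_{i=1}^r x_i^{d_i}}$ be a non-constant Laurent polynomial over $K$ (with numerator $\widehat f$ a polynomial over $K$) whose Newton polytope at infinity $\Gamma_\infty$ has dimension $n$ and which is weakly non-degenerate with respect to $\Gamma_\infty$. Let $\mathcal F$ be a non-trivial simple fan subordinated to $\Gamma_\infty$ with support $\mathbb R_+^n$, and let $\beta=\beta(\mathcal F)$. Assume that $\{x\in T^n(K):\nabla f(x)=0\}=\emptyset$ and that for every $n$-dimensional cone of $\mathcal F$, spanned by $a_1,\ldots,a_n$, one has $d(a_j)\neq0$ for all $j$. Set $$S_m(f)=q^{-mn}\sum_{x\in(R_K^\times/P_K^m)^r\times(R_K/P_K^m)^{n-r}}\Psi(zf(x)),$$ where $z=u\mathfrak p^{-m}$ with $u\in R_K^\times$ and $m\ge1$. Then there is a positive constant $C$ such that, for $m$ big enough, $$|S_m(f)|\le C\,m^{n-1}q^{m\beta}.$$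
   Context: $K$ is a finite extension of $\mathbb Q_p$, with valuation ring $R_K$, maximal ideal $P_K$, fixed uniformizer $\mathfrak p$, residue field of cardinality $q$. $\mathbb R_+=\{x\in\mathbb R: x\ge 0\}$ and $T^n(K)=\{x\in K^n: x_1\cdots x_n\ne 0\}$. $\Psi(z)=\exp(2\pi\sqrt{-1}\{Tr_{K/\mathbb Q_p}(z)\}_p)$ for $z\in K$, where $\{\cdot\}_p$ is the $p$-adic fractional part. In the sum, $R_K^\times/P_K^m$ means the set of classes of units modulo $P_K^m$. Newton polytope: for $f(x)=\sum_{m\in\mathbb Z^n}c_mx^m$, $\Gamma_\infty$ is the convex hull in $\mathbb R^n$ of $supp(f)=\{m: c_m\neq0\}$. For $a\in\mathbb R^n$, $d(a)=\inf\{\langle a,x\rangle: x\in\Gamma_\infty\}$ and $F(a)=\{x\in\Gamma_\infty:\langle a,x\rangle=d(a)\}$ (a face of $\Gamma_\infty$; $F(0)=\Gamma_\infty$). The face function of $f$ with respect to $a\in\mathbb R_+^n$ is $f_a(x)=\sum_{m\in F(a)}c_mx^m$. $f$ is weakly non-degenerate with respect to $\Gamma_\infty$ if for every $a\in\mathbb R_+^n$ the system $f_a(x)=0,\ \nabla f_a(x)=0$ has no solution in $T^n(K)$. Fans: a fan is a finite collection of rational strongly convex (closed) polyhedral cones, closed under taking faces, in which the intersection of two cones is a face of each; its support is the union of its cones. It is simple if each of its cones is generated by a subset of a basis of the $\mathbb Z$-module $\mathbb Z^n$ (these generators are the vectors said to span the cone). It is subordinated to $\Gamma_\infty$ if the relative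 interior of each of its cones is contained in one equivalence class of the relation $a\sim a'\iff F(a)=F(a')$. The trivial fan consists of $\mathbb R_+^n$ and its faces. $edges(\mathcal F)$ is the set of all (primitive integral) generators of the cones of $\mathcal F$. For $a\in\mathbb Z^n\setminus\{0\}$ put $\|a\|=a_1+\cdots+a_n$. $B(\mathcal F)=\{\|a\|/(-d(a)): a\in edges(\mathcal F),\ d(a)>0\}$ and $\beta(\mathcal F)=\max(B(\mathcal F)\cup\{-1\})$. *)

theory Defs
  imports
    "HOL-Analysis.Analysis"
    "HOL-Library.Poly_Mapping"
    "HOL-Computational_Algebra.Primes"
begin

section \<open>Finite extensions of the $p$-adic numbers\<close>

text \<open>Fields of characteristic 0 with a non-archimedean absolute value, together with its metric.
  (The library class of normed fields is of no use here: it requires an algebra over the reals.)\<close>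

class nonarch_field = field_char_0 + metric_space +
  fixes absval :: "'a \<Rightarrow> real"
  assumes dist_absval: "dist x y = absval (x - y)"
    and absval_mult: "absval (x * y) = absval x * absval y"
    and absval_add: "absval (x + y) \<le> max (absval x) (absval y)"
begin

lemma absval_eq_0: "absval x = 0 \<longleftrightarrow> x = 0"
  using dist_absval[of x 0] dist_eq_0_iff[of x 0] by simp

lemma absval_nonneg: "0 \<le> absval x"
  using dist_absval[of x 0] zero_le_dist[of x 0] by simp

end

text \<open>The type \<open>'q\<close> is the field of $p$-adic numbers, i.e. the completion of the rational
  numbers for the $p$-adic absolute value. By multiplicativity it suffices to prescribe the
  absolute value on the integers.\<close>

locale padic_numbers =
  fixes p :: nat and T :: "'q::nonarch_field itself"
  assumes prime_p: "prime p"
    and absval_of_int: "\<And>a::int. a \<noteq> 0 \<Longrightarrow>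
      absval (of_int a :: 'q) = real p powi (- int (multiplicity (int p) a))"
    and complete_Qp: "complete (UNIV :: 'q set)"
    and dense_Rats: "closure (\<rat> :: 'q set) = UNIV"

definition ext_scale :: "('q::field \<Rightarrow> 'k::field) \<Rightarrow> 'q \<Rightarrow> 'k \<Rightarrow> 'k" where
  "ext_scale \<iota> c x = \<iota> c * x"

text \<open>The type \<open>'k\<close> is a finite extension of the field of $p$-adic numbers by means of \<open>\<iota>\<close>. Its
  \<^const>\<open>absval\<close> is the unique absolute value that extends the $p$-adic one.\<close>

locale padic_field = padic_numbers p "TYPE('q::nonarch_field)"
  for p :: nat and \<iota> :: "'q::nonarch_field \<Rightarrow> 'k::nonarch_field" +
  assumes emb_1: "\<iota> 1 = 1"
    and emb_add: "\<And>x y. \<iota> (x + y) = \<iota> x + \<iota> y"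
    and emb_mult: "\<And>x y. \<iota> (x * y) = \<iota> x * \<iota> y"
    and absval_emb: "\<And>x. absval (\<iota> x) = absval x"
    and finite_ext: "\<exists>B. finite B \<and> module.span (ext_scale \<iota>) B = UNIV"

definition valuation_ring :: "'k::nonarch_field set" where
  "valuation_ring = {x. absval x \<le> 1}"

definition unit_group :: "'k::nonarch_field set" where
  "unit_group = {x. absval x = 1}"

definition max_ideal :: "'k::nonarch_field set" where
  "max_ideal = {x. absval x < 1}"

definition uniformizer :: "'k::nonarch_field \<Rightarrow> bool" where
  "uniformizer \<pi> \<longleftrightarrow> max_ideal = (\<lambda>y. \<pi> * y) ` valuation_ring"

definition max_ideal_pow :: "'k::nonarch_field \<Rightarrow> nat \<Rightarrow> 'k set" where
  "max_ideal_pow \<pi> m = (\<lambda>y. \<pi> ^ m * y) ` valuation_ring"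

definition residue_card :: "'k::nonarch_field itself \<Rightarrow> nat" where
  "residue_card _ = card ((valuation_ring :: 'k set) // {(x, y). x - y \<in> max_ideal})"

text \<open>The trace of multiplication by \<open>z\<close>, as a linear map over the $p$-adic numbers.\<close>

definition field_trace :: "('q::field \<Rightarrow> 'k::field) \<Rightarrow> 'k \<Rightarrow> 'q" where
  "field_trace \<iota> z =
    (let s = ext_scale \<iota>; B = (SOME B. \<not> module.dependent s B \<and> module.span s B = UNIV)
     in \<Sum>b\<in>B. module.representation s B (z * b) b)"

text \<open>If $x = \sum_{j \ge -k} x_j p^j$ with digits $0 \le x_j < p$, the fractional part is
  $\sum_{j<0} x_j p^j$. It is the only $a / p^k$ with $0 \le a < p^k$ that is congruent to \<open>x\<close>
  modulo the $p$-adic integers.\<close>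

definition padic_frac :: "nat \<Rightarrow> 'q::nonarch_field \<Rightarrow> rat" where
  "padic_frac p x =
    (THE t. (\<exists>a k. a < p ^ k \<and> t = of_nat a / of_nat p ^ k) \<and> absval (x - of_rat t) \<le> 1)"

definition add_char :: "nat \<Rightarrow> ('q::nonarch_field \<Rightarrow> 'k::nonarch_field) \<Rightarrow> 'k \<Rightarrow> complex" where
  "add_char p \<iota> z =
    exp (2 * of_real pi * \<i> * of_rat (padic_frac p (field_trace \<iota> z)))"


section \<open>Laurent polynomials and Newton polytopes\<close>

text \<open>A Laurent polynomial is the finitely supported map from exponent vectors to coefficients;
  \<^const>\<open>Poly_Mapping.keys\<close> is its support.\<close>

type_synonym ('k, 'n) laurent = "int ^ 'n \<Rightarrow>\<^sub>0 'k"

text \<open>Evaluation is meaningful where no coordinate with a negative exponent vanishes; there,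
  \<open>0 powi 0 = 1\<close> is the right convention.\<close>

definition laurent_eval :: "('k::field, 'n::finite) laurent \<Rightarrow> 'k ^ 'n \<Rightarrow> 'k" where
  "laurent_eval f x =
    (\<Sum>m\<in>Poly_Mapping.keys f. Poly_Mapping.lookup f m * (\<Prod>i\<in>UNIV. (x $ i) powi (m $ i)))"

definition laurent_pderiv :: "'n::finite \<Rightarrow> ('k::field, 'n) laurent \<Rightarrow> ('k, 'n) laurent" where
  "laurent_pderiv i f =
    (\<Sum>m\<in>Poly_Mapping.keys f.
      Poly_Mapping.single (m - axis i 1) (of_int (m $ i) * Poly_Mapping.lookup f m))"

text \<open>The Laurent polynomial $g(x) / \prod_{i \in I} x_i^{d_i}$ for a polynomial \<open>g\<close>.\<close>

definition laurent_frac ::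
    "(nat ^ 'n::finite \<Rightarrow>\<^sub>0 'k::field) \<Rightarrow> 'n set \<Rightarrow> ('n \<Rightarrow> nat) \<Rightarrow> ('k, 'n) laurent" where
  "laurent_frac g I d = (\<Sum>m\<in>Poly_Mapping.keys g.
    Poly_Mapping.single (\<chi> i. int (m $ i) - (if i \<in> I then int (d i) else 0))
      (Poly_Mapping.lookup g m))"

definition torus :: "('k::field ^ 'n::finite) set" where
  "torus = {x. (\<Prod>i\<in>UNIV. x $ i) \<noteq> 0}"

definition real_vec :: "int ^ 'n::finite \<Rightarrow> real ^ 'n" where
  "real_vec m = (\<chi> i. real_of_int (m $ i))"

definition newton_polytope :: "('k::field, 'n::finite) laurent \<Rightarrow> (real ^ 'n) set" where
  "newton_polytope f = convex hull (real_vec ` Poly_Mapping.keys f)"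

definition support_fun :: "(real ^ 'n::finite) set \<Rightarrow> real ^ 'n \<Rightarrow> real" where
  "support_fun G a = (INF x\<in>G. a \<bullet> x)"

definition first_meet :: "(real ^ 'n::finite) set \<Rightarrow> real ^ 'n \<Rightarrow> (real ^ 'n) set" where
  "first_meet G a = {x \<in> G. a \<bullet> x = support_fun G a}"

definition orthant :: "(real ^ 'n::finite) set" where
  "orthant = {x. \<forall>i. 0 \<le> x $ i}"

definition face_function ::
    "('k::field, 'n::finite) laurent \<Rightarrow> real ^ 'n \<Rightarrow> ('k, 'n) laurent" where
  "face_function f a =
    (\<Sum>m | m \<in> Poly_Mapping.keys f \<and> real_vec m \<in> first_meet (newton_polytope f) a.
      Poly_Mapping.single m (Poly_Mapping.lookup f m))"

definition weakly_nondegenerate :: "('k::field, 'n::finite) laurent \<Rightarrow> bool" where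
  "weakly_nondegenerate f \<longleftrightarrow> (\<forall>a\<in>orthant. \<not> (\<exists>x\<in>torus.
    laurent_eval (face_function f a) x = 0 \<and>
    (\<forall>i. laurent_eval (laurent_pderiv i (face_function f a)) x = 0)))"


section \<open>Fans\<close>

definition rational_cone :: "(real ^ 'n::finite) set \<Rightarrow> bool" where
  "rational_cone \<sigma> \<longleftrightarrow> (\<exists>V. finite V \<and> \<sigma> = convex_cone hull (real_vec ` V))"

definition strongly_convex :: "(real ^ 'n::finite) set \<Rightarrow> bool" where
  "strongly_convex \<sigma> \<longleftrightarrow> (\<forall>x. x \<in> \<sigma> \<and> - x \<in> \<sigma> \<longrightarrow> x = 0)"

text \<open>The library relation \<^const>\<open>face_of\<close> also counts the empty set as a face; the faces
  of a cone are the non-empty ones.\<close>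

definition cone_faces :: "(real ^ 'n::finite) set \<Rightarrow> (real ^ 'n) set set" where
  "cone_faces \<sigma> = {\<tau>. \<tau> face_of \<sigma> \<and> \<tau> \<noteq> {}}"

definition fan :: "(real ^ 'n::finite) set set \<Rightarrow> bool" where
  "fan F \<longleftrightarrow> finite F \<and> (\<forall>\<sigma>\<in>F. rational_cone \<sigma> \<and> strongly_convex \<sigma>) \<and>
    (\<forall>\<sigma>\<in>F. cone_faces \<sigma> \<subseteq> F) \<and>
    (\<forall>\<sigma>\<in>F. \<forall>\<tau>\<in>F. \<sigma> \<inter> \<tau> \<in> cone_faces \<sigma> \<and> \<sigma> \<inter> \<tau> \<in> cone_faces \<tau>)"

definition lattice_basis :: "(int ^ 'n::finite) set \<Rightarrow> bool" where
  "lattice_basis B \<longleftrightarrow> \<not> module.dependent (*s) B \<and> module.span (*s) B = UNIV"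

definition spans_cone :: "(int ^ 'n::finite) set \<Rightarrow> (real ^ 'n) set \<Rightarrow> bool" where
  "spans_cone S \<sigma> \<longleftrightarrow>
    (\<exists>B. lattice_basis B \<and> S \<subseteq> B) \<and> \<sigma> = convex_cone hull (real_vec ` S)"

definition simple_fan :: "(real ^ 'n::finite) set set \<Rightarrow> bool" where
  "simple_fan F \<longleftrightarrow> fan F \<and> (\<forall>\<sigma>\<in>F. \<exists>S. spans_cone S \<sigma>)"

definition subordinated :: "(real ^ 'n::finite) set set \<Rightarrow> (real ^ 'n) set \<Rightarrow> bool" where
  "subordinated F G \<longleftrightarrow>
    (\<forall>\<sigma>\<in>F. \<forall>a\<in>rel_interior \<sigma>. \<forall>a'\<in>rel_interior \<sigma>. first_meet G a = first_meet G a')"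

definition trivial_fan :: "(real ^ 'n::finite) set set" where
  "trivial_fan = cone_faces orthant"

definition fan_edges :: "(real ^ 'n::finite) set set \<Rightarrow> (int ^ 'n) set" where
  "fan_edges F = \<Union> {S. \<exists>\<sigma>\<in>F. spans_cone S \<sigma>}"

definition weight :: "int ^ 'n::finite \<Rightarrow> int" where
  "weight a = (\<Sum>i\<in>UNIV. a $ i)"

definition fan_ratios :: "(real ^ 'n::finite) set set \<Rightarrow> (real ^ 'n) set \<Rightarrow> real set" where
  "fan_ratios F G = {of_int (weight a) / (- support_fun G (real_vec a)) | a.
    a \<in> fan_edges F \<and> support_fun G (real_vec a) > 0}"

definition fan_beta :: "(real ^ 'n::finite) set set \<Rightarrow> (real ^ 'n) set \<Rightarrow> real" where
  "fan_beta F G = Max (fan_ratios F G \<union> {-1})"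


section \<open>Exponential sums modulo powers of the maximal ideal\<close>

definition cong_rel :: "'k::nonarch_field \<Rightarrow> nat \<Rightarrow> (('k ^ 'n::finite) \<times> ('k ^ 'n)) set" where
  "cong_rel \<pi> m = {(x, y). \<forall>i. x $ i - y $ i \<in> max_ideal_pow \<pi> m}"

text \<open>Points with unit coordinates at the indices in \<open>I\<close> and integral coordinates elsewhere; for
  $m \ge 1$ this set is a union of classes modulo \<open>cong_rel \<pi> m\<close>.\<close>

definition sum_domain :: "'n::finite set \<Rightarrow> ('k::nonarch_field ^ 'n) set" where
  "sum_domain I = {x. (\<forall>i\<in>I. x $ i \<in> unit_group) \<and> (\<forall>i. i \<notin> I \<longrightarrow> x $ i \<in> valuation_ring)}"

text \<open>The value of a locally constant function \<open>h\<close> at a residue class \<open>X\<close>. If \<open>h\<close> is constant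
  on \<open>X\<close>, this is that constant (see the lemma). The function to be summed is constant on the
  classes when the Laurent polynomial has coefficients in the valuation ring; if it has
  denominators it need not be, and the value at a class is then the mean over the class,
  computed on any sufficiently fine subdivision.\<close>

definition class_value ::
    "'k::nonarch_field \<Rightarrow> ('k ^ 'n::finite \<Rightarrow> complex) \<Rightarrow> ('k ^ 'n) set \<Rightarrow> complex" where
  "class_value \<pi> h X =
    lim (\<lambda>M. (\<Sum>Y\<in>X // cong_rel \<pi> M. the_elem (h ` Y)) / of_nat (card (X // cong_rel \<pi> M)))"

definition exp_sum :: "nat \<Rightarrow> ('q::nonarch_field \<Rightarrow> 'k::nonarch_field) \<Rightarrow> 'k \<Rightarrow> 'n::finite set \<Rightarrow>
    ('k, 'n) laurent \<Rightarrow> nat \<Rightarrow> 'k \<Rightarrow> complex" where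
  "exp_sum p \<iota> \<pi> I f m u =
    (\<Sum>X\<in>sum_domain I // cong_rel \<pi> m.
      class_value \<pi> (\<lambda>x. add_char p \<iota> (u / \<pi> ^ m * laurent_eval f x)) X)
    / of_nat (residue_card TYPE('k) ^ (m * CARD('n)))"

lemma class_value_const:
  fixes X :: "('k::nonarch_field ^ 'n::finite) set"
  assumes X: "X \<in> UNIV // cong_rel \<pi> m" and \<pi>: "uniformizer \<pi>"
    and fin: "\<And>M. finite (X // cong_rel \<pi> M)"
    and const: "\<And>x. x \<in> X \<Longrightarrow> h x = w"
  shows "class_value \<pi> h X = w"
proof -
  have one: "absval (1::'k) = 1"
    using absval_mult[of "1::'k" 1] absval_eq_0[of "1::'k"] by simp
  have sum_closed: "a + b \<in> valuation_ring"
    if "a \<in> valuation_ring" "b \<in> valuation_ring" for a b :: 'k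
    using that absval_add[of a b] by (auto simp: valuation_ring_def)
  have "\<pi> \<in> max_ideal"
    using \<pi> one unfolding uniformizer_def valuation_ring_def by force
  then have n\<pi>: "absval \<pi> < 1" by (simp add: max_ideal_def)
  have pow: "absval (\<pi> ^ k) \<le> 1" for k
    by (induction k)
      (use n\<pi> one absval_nonneg[of \<pi>] absval_nonneg in
        \<open>auto simp: absval_mult intro!: mult_le_one\<close>)
  have sub: "max_ideal_pow \<pi> M \<subseteq> max_ideal_pow \<pi> m" if "m \<le> M" for M
  proof
    fix y assume "y \<in> max_ideal_pow \<pi> M"
    then obtain c where c: "y = \<pi> ^ M * c" "absval c \<le> 1"
      by (auto simp: max_ideal_pow_def valuation_ring_def)
    have "y = \<pi> ^ m * (\<pi> ^ (M - m) * c)"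
      using c that by (simp add: mult.assoc[symmetric] power_add[symmetric])
    moreover have "absval (\<pi> ^ (M - m) * c) \<le> 1"
      using c(2) pow absval_nonneg by (auto simp: absval_mult intro!: mult_le_one)
    ultimately show "y \<in> max_ideal_pow \<pi> m"
      by (auto simp: max_ideal_pow_def valuation_ring_def)
  qed
  have add: "a + b \<in> max_ideal_pow \<pi> m"
    if a: "a \<in> max_ideal_pow \<pi> m" and b: "b \<in> max_ideal_pow \<pi> m" for a b
  proof -
    obtain c e where "a = \<pi> ^ m * c" "b = \<pi> ^ m * e" "c \<in> valuation_ring" "e \<in> valuation_ring"
      using a b by (auto simp: max_ideal_pow_def)
    then show ?thesis
      using sum_closed[of c e] unfolding max_ideal_pow_def by (metis distrib_left imageI)
  qed
  have zero: "0 \<in> max_ideal_pow \<pi> M" for M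
    unfolding max_ideal_pow_def valuation_ring_def
    using absval_eq_0[of "0::'k"] by (intro image_eqI[of _ _ 0]) auto
  obtain x0 where x0: "X = cong_rel \<pi> m `` {x0}" using X by (auto simp: quotient_def)
  have x0X: "x0 \<in> X" using zero by (simp add: x0 cong_rel_def)
  have Y: "the_elem (h ` Y) = w" if M: "m \<le> M" and YX: "Y \<in> X // cong_rel \<pi> M" for M Y
  proof -
    obtain x where x: "x \<in> X" "Y = cong_rel \<pi> M `` {x}"
      using YX by (rule quotientE)
    have "x \<in> Y" using x zero by (simp add: cong_rel_def)
    have "Y \<subseteq> X"
    proof
      fix y assume "y \<in> Y"
      then have "x $ i - y $ i \<in> max_ideal_pow \<pi> m" for i
        using x sub[OF M] by (auto simp: cong_rel_def)
      moreover have "x0 $ i - x $ i \<in> max_ideal_pow \<pi> m" for i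
        using x(1) by (auto simp: x0 cong_rel_def)
      ultimately have "(x0 $ i - x $ i) + (x $ i - y $ i) \<in> max_ideal_pow \<pi> m" for i
        using add by blast
      then show "y \<in> X" by (simp add: x0 cong_rel_def)
    qed
    then have "h ` Y = {w}" using const \<open>x \<in> Y\<close> by blast
    then show ?thesis by simp
  qed
  have "(\<Sum>Y\<in>X // cong_rel \<pi> M. the_elem (h ` Y)) / of_nat (card (X // cong_rel \<pi> M)) = w"
    if "m \<le> M" for M
  proof -
    have "X // cong_rel \<pi> M \<noteq> {}" using x0X by (auto simp: quotient_def)
    then have "card (X // cong_rel \<pi> M) \<noteq> 0" using fin[of M] by simp
    then show ?thesis using Y[OF that] by simp
  qed
  then have "(\<lambda>M. (\<Sum>Y\<in>X // cong_rel \<pi> M. the_elem (h ` Y))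
      / of_nat (card (X // cong_rel \<pi> M))) \<longlonglongrightarrow> w"
    by (intro tendsto_eventually) (auto simp: eventually_sequentially)
  then show ?thesis unfolding class_value_def by (rule limI)
qed

end

theory Submission
  imports Defs
begin

text \<open>
  Let \<open>\<rho> = |\<pi>|\<close> and let \<open>d(k)\<close> be the minimum of \<open>\<langle>k, m\<rangle>\<close> over the exponents \<open>m\<close> of \<open>f\<close>. The sum is
  an average over residue classes modulo \<open>\<pi>^M\<close>, with \<open>M\<close> as large as we like, and it splits according
  to the vector \<open>k\<close> of the valuations of the coordinates.

  Write \<open>k = \<Sum> c_a a\<close> over the generators \<open>a\<close> of an \<open>n\<close>-dimensional cone of the fan and put
  \<open>x_i = \<pi>^{k_i} y_i\<close>. Then \<open>x_i \<partial>_i f(x) = \<pi>^{d(k)} G_i(t, y)\<close> with \<open>t_a = \<pi>^{c_a}\<close>, where \<open>G_i\<close> is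
  polynomial in \<open>t\<close> and Laurent in \<open>y\<close>. The \<open>G_i\<close> have no common zero with \<open>t\<close> integral and \<open>y\<close> a vector
  of units: if no \<open>t_a\<close> vanishes this is the absence of critical points; otherwise a common zero gives a
  torus point where the logarithmic derivatives of a face function vanish, and Euler's identity for
  one \<open>a\<close> with \<open>t_a = 0\<close> (here \<open>d(a) \<noteq> 0\<close> is needed) makes the face function itself vanish. By
  compactness the logarithmic gradient has size at least \<open>\<epsilon> \<rho>^{d(k)}\<close>, uniformly in \<open>k\<close>.

  Averaging over \<open>x \<mapsto> x (1 + \<pi>^s w)\<close> with \<open>s = m - d(k) - O(1)\<close> therefore kills the contribution of \<open>k\<close>
  unless \<open>d(k) > m - O(1)\<close>. The remaining \<open>k\<close> are estimated trivially by \<open>q^{-|k|} \<le> q^{\<beta> d(k)}\<close>, and at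
  most \<open>O((t+1)^{n-1})\<close> of them have \<open>d(k) = t\<close>.
\<close>

section \<open>Non-archimedean absolute values\<close>

text \<open>The vectors \<open>k\<close> form an infinite set, whereas compactness needs a compact
  space of parameters. The closed unit ball for the \<open>t_a\<close> provides one: it adds the
  limits in which valuations tend to infinity, where \<open>f\<close> degenerates to a face
  function. Weak non-degeneracy controls these limits, the absence of critical points the rest.

  The exponent \<open>n-1\<close> and the constant \<open>\<beta>\<close> come from the generators
  that vanish on the unit coordinates; only these occur in the vector \<open>k\<close> of a point of
  the domain. Exponents of \<open>f\<close> are nonnegative off the unit coordinates, so
  \<open>d(a) \<ge> 0\<close> for such \<open>a\<close>, hence \<open>d(a) > 0\<close>. They lie in
  a coordinate hyperplane, so each cone has at most \<open>n-1\<close> of them.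

  Points with a coordinate divisible by \<open>\<pi>^M\<close> have no valuation vector that is
  visible modulo \<open>\<pi>^M\<close>. Their proportion is at most \<open>n q^{-M}\<close>, and
  since the sum does not depend on \<open>M\<close> once \<open>M\<close> is large, the limit in
  \<open>M\<close> removes them. The exponential sum thus has to be rewritten at every fine level
  \<open>M\<close>, which also copes with coefficients of \<open>f\<close> that are not
  integral.\<close>

context nonarch_field
begin

lemma absval_zero [simp]: "absval 0 = 0"
  by (simp add: absval_eq_0)

lemma absval_pos: "x \<noteq> 0 \<Longrightarrow> 0 < absval x"
  using absval_nonneg[of x] absval_eq_0[of x] by linarith

lemma absval_one [simp]: "absval 1 = 1"
  using absval_mult[of 1 1] absval_eq_0[of 1] by simp

lemma absval_minus [simp]: "absval (- x) = absval x"
  using dist_absval[of x 0] dist_absval[of 0 x] dist_commute[of x 0] by simp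

lemma absval_diff: "absval (x - y) \<le> max (absval x) (absval y)"
  using absval_add[of x "- y"] by simp

lemma absval_minus_commute: "absval (x - y) = absval (y - x)"
  using absval_minus[of "x - y"] by simp

lemma absval_power: "absval (x ^ k) = absval x ^ k"
  by (induction k) (simp_all add: absval_mult)

lemma absval_prod: "absval (\<Prod>i\<in>A. g i) = (\<Prod>i\<in>A. absval (g i))"
  by (induction A rule: infinite_finite_induct) (simp_all add: absval_mult)

lemma absval_add_le: "absval x \<le> B \<Longrightarrow> absval y \<le> B \<Longrightarrow> absval (x + y) \<le> B"
  using absval_add[of x y] by simp

lemma absval_diff_le: "absval x \<le> B \<Longrightarrow> absval y \<le> B \<Longrightarrow> absval (x - y) \<le> B"
  using absval_diff[of x y] by simp

lemma absval_sum_le: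
  assumes "0 \<le> B" "\<And>i. i \<in> A \<Longrightarrow> absval (g i) \<le> B"
  shows "absval (\<Sum>i\<in>A. g i) \<le> B"
  using assms by (induction A rule: infinite_finite_induct) (auto intro: absval_add_le)

lemma absval_of_nat_le: "absval (of_nat k) \<le> 1"
  by (induction k) (auto intro: absval_add_le)

lemma absval_of_int_le: "absval (of_int k) \<le> 1"
  by (cases k rule: int_cases2) (simp_all add: absval_of_nat_le)

text \<open>Otherwise \<open>x = (x + y) - y\<close> would be smaller than itself. This is how
  valuations survive small perturbations throughout.\<close>

lemma absval_unit_perturb: "absval y < absval x \<Longrightarrow> absval (x + y) = absval x"
  using absval_add[of x y] absval_diff[of "x + y" y] by auto

end

lemma absval_inverse: "absval (inverse x) = inverse (absval x)" for x :: "'a::nonarch_field"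
proof (cases "x = 0")
  case False
  then have "absval x * absval (inverse x) = 1"
    by (simp flip: absval_mult)
  then show ?thesis
    by (metis inverse_unique)
qed simp

lemma absval_divide: "absval (x / y) = absval x / absval y" for x y :: "'a::nonarch_field"
  by (simp add: divide_inverse absval_mult absval_inverse)

lemma absval_power_int: "absval (x powi k) = absval x powi k" for x :: "'a::nonarch_field"
  by (simp add: power_int_def absval_power absval_inverse)

lemma tendsto_absval_iff:
  fixes f :: "'b \<Rightarrow> 'a::nonarch_field"
  shows "(f \<longlongrightarrow> l) F \<longleftrightarrow> ((\<lambda>x. absval (f x - l)) \<longlongrightarrow> 0) F"
  by (subst tendsto_dist_iff) (simp add: dist_absval)

text \<open>With this instance and the next one, \<open>continuous_intros\<close> proves polynomial
  expressions over the field continuous.\<close>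

instance nonarch_field < topological_ab_group_add
proof
  fix a b :: 'a
  have 1: "(fst \<longlongrightarrow> a) (nhds a \<times>\<^sub>F nhds b)" "(snd \<longlongrightarrow> b) (nhds a \<times>\<^sub>F nhds b)"
    by (rule filterlim_fst, rule filterlim_snd)
  show "LIM x (nhds a \<times>\<^sub>F nhds b). fst x + snd x :> nhds (a + b)"
    unfolding tendsto_absval_iff
  proof (rule tendsto_sandwich[where f = "\<lambda>_. 0"])
    show "\<forall>\<^sub>F x in nhds a \<times>\<^sub>F nhds b. absval (fst x + snd x - (a + b))
        \<le> max (absval (fst x - a)) (absval (snd x - b))"
    proof (rule always_eventually, rule allI)
      fix x :: "'a \<times> 'a"
      show "absval (fst x + snd x - (a + b)) \<le> max (absval (fst x - a)) (absval (snd x - b))"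
        using absval_add[of "fst x - a" "snd x - b"] by (simp add: algebra_simps)
    qed
    have "((\<lambda>x. max (absval (fst x - a)) (absval (snd x - b))) \<longlongrightarrow> max 0 0) (nhds a \<times>\<^sub>F nhds b)"
      using 1 unfolding tendsto_absval_iff by (rule tendsto_max)
    then show "((\<lambda>x. max (absval (fst x - a)) (absval (snd x - b))) \<longlongrightarrow> 0) (nhds a \<times>\<^sub>F nhds b)"
      by simp
    show "((\<lambda>_. 0 :: real) \<longlongrightarrow> 0) (nhds a \<times>\<^sub>F nhds b)" by simp
  qed (simp add: absval_nonneg)
  have "((\<lambda>x. x) \<longlongrightarrow> a) (nhds a)" by (rule filterlim_ident)
  then show "(uminus \<longlongrightarrow> - a) (nhds a)"
    unfolding tendsto_absval_iff
    by (rule Lim_transform_eventually) (simp add: absval_minus_commute[of _ a])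
qed

instance nonarch_field < topological_comm_monoid_mult
proof
  fix a b :: 'a
  have fst: "(fst \<longlongrightarrow> a) (nhds a \<times>\<^sub>F nhds b)" and snd: "(snd \<longlongrightarrow> b) (nhds a \<times>\<^sub>F nhds b)"
    by (rule filterlim_fst, rule filterlim_snd)
  have lim: "((\<lambda>x. absval (fst x - a) * absval (snd x - b) + absval (fst x - a) * absval b +
      absval a * absval (snd x - b)) \<longlongrightarrow> 0 * 0 + 0 * absval b + absval a * 0) (nhds a \<times>\<^sub>F nhds b)"
    using fst snd unfolding tendsto_absval_iff by (intro tendsto_intros)
  show "LIM x (nhds a \<times>\<^sub>F nhds b). fst x * snd x :> nhds (a * b)"
    unfolding tendsto_absval_iff
  proof (rule tendsto_sandwich[where f = "\<lambda>_. 0"])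
    show "\<forall>\<^sub>F x in nhds a \<times>\<^sub>F nhds b. absval (fst x * snd x - a * b)
        \<le> absval (fst x - a) * absval (snd x - b) + absval (fst x - a) * absval b +
          absval a * absval (snd x - b)"
    proof (rule always_eventually, rule allI)
      fix x :: "'a \<times> 'a"
      define c d where "c = fst x - a" and "d = snd x - b"
      have "fst x * snd x - a * b = c * d + c * b + a * d"
        by (simp add: c_def d_def algebra_simps)
      moreover have "absval (c * d + c * b + a * d) \<le> absval c * absval d + absval c * absval b + absval a * absval d"
        by (intro absval_add_le) (auto simp: absval_mult absval_nonneg add_nonneg_nonneg intro: add_increasing add_increasing2)
      ultimately show "absval (fst x * snd x - a * b) \<le> absval (fst x - a) * absval (snd x - b) +
          absval (fst x - a) * absval b + absval a * absval (snd x - b)"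
        by (simp add: c_def d_def)
    qed
    show "((\<lambda>x. absval (fst x - a) * absval (snd x - b) + absval (fst x - a) * absval b +
      absval a * absval (snd x - b)) \<longlongrightarrow> 0) (nhds a \<times>\<^sub>F nhds b)"
      using lim by simp
    show "((\<lambda>_. 0 :: real) \<longlongrightarrow> 0) (nhds a \<times>\<^sub>F nhds b)" by simp
  qed (simp add: absval_nonneg)
qed

lemma tendsto_absval [tendsto_intros]:
  fixes f :: "'b \<Rightarrow> 'a::nonarch_field"
  assumes "(f \<longlongrightarrow> l) F"
  shows "((\<lambda>x. absval (f x)) \<longlongrightarrow> absval l) F"
  using tendsto_dist[OF assms tendsto_const[of 0]] by (simp add: dist_absval)

lemma continuous_on_absval [continuous_intros]:
  fixes f :: "'b::topological_space \<Rightarrow> 'a::nonarch_field"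
  shows "continuous_on S f \<Longrightarrow> continuous_on S (\<lambda>x. absval (f x))"
  unfolding continuous_on_def by (auto intro: tendsto_absval)

text \<open>On units inversion is an isometry, as \<open>1/a - 1/b = (b - a)/(ab)\<close>. Negative
  exponents will only be applied to units.\<close>

lemma continuous_on_unit_inverse:
  fixes f :: "'b::topological_space \<Rightarrow> 'a::nonarch_field"
  assumes f: "continuous_on S f" and unit: "\<And>x. x \<in> S \<Longrightarrow> absval (f x) = 1"
  shows "continuous_on S (\<lambda>x. inverse (f x))"
  unfolding continuous_on_def
proof
  fix a assume a: "a \<in> S"
  have "(f \<longlongrightarrow> f a) (at a within S)"
    using f a by (simp add: continuous_on_def)
  then have "((\<lambda>x. absval (f x - f a)) \<longlongrightarrow> 0) (at a within S)"
    by (simp add: tendsto_absval_iff)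
  moreover have "\<forall>\<^sub>F x in at a within S. absval (f x - f a) = absval (inverse (f x) - inverse (f a))"
    unfolding eventually_at_filter
  proof (rule always_eventually, intro allI impI)
    fix x assume "x \<in> S"
    then have u: "absval (f x) = 1" "absval (f a) = 1" using unit a by auto
    then have "f x \<noteq> 0" "f a \<noteq> 0" using absval_zero by force+
    then have "inverse (f x) - inverse (f a) = inverse (f x) * (f a - f x) * inverse (f a)"
      by (simp add: field_simps)
    then show "absval (f x - f a) = absval (inverse (f x) - inverse (f a))"
      by (simp add: absval_mult absval_inverse u absval_minus_commute[of "f a"])
  qed
  ultimately have "((\<lambda>x. absval (inverse (f x) - inverse (f a))) \<longlongrightarrow> 0) (at a within S)"
    by (rule Lim_transform_eventually)
  then show "((\<lambda>x. inverse (f x)) \<longlongrightarrow> inverse (f a)) (at a within S)"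
    by (simp add: tendsto_absval_iff)
qed

lemma continuous_on_unit_power_int:
  fixes f :: "'b::topological_space \<Rightarrow> 'a::nonarch_field"
  assumes "continuous_on S f" "\<And>x. x \<in> S \<Longrightarrow> absval (f x) = 1"
  shows "continuous_on S (\<lambda>x. f x powi k)"
  using assms continuous_on_unit_inverse[OF assms]
  by (cases "k \<ge> 0") (auto simp: power_int_def intro!: continuous_intros)

section \<open>Local compactness\<close>

context padic_numbers
begin

lemma p_gt_1: "1 < p"
  using prime_p prime_gt_1_nat by blast

lemma absval_p_power: "absval (of_nat p ^ k :: 'q) = 1 / real p ^ k"
proof -
  have "absval (of_int (int p ^ k) :: 'q) = real p powi (- int (multiplicity (int p) (int p ^ k)))"
    using p_gt_1 by (intro absval_of_int) auto
  moreover have "multiplicity (int p) (int p ^ k) = k"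
    using prime_p by (intro multiplicity_same_power) auto
  ultimately show ?thesis by (simp add: power_int_minus inverse_eq_divide)
qed

lemma absval_of_int_dvd: "int p ^ k dvd a \<longleftrightarrow> absval (of_int a :: 'q) \<le> 1 / real p ^ k"
proof (cases "a = 0")
  case False
  have "int p ^ k dvd a \<longleftrightarrow> k \<le> multiplicity (int p) a"
    using False prime_p p_gt_1 by (intro power_dvd_iff_le_multiplicity) auto
  also have "\<dots> \<longleftrightarrow> real p ^ k \<le> real p ^ multiplicity (int p) a"
    using p_gt_1 by simp
  also have "\<dots> \<longleftrightarrow> absval (of_int a :: 'q) \<le> 1 / real p ^ k"
    using p_gt_1 False by (simp add: absval_of_int power_int_minus divide_simps)
  finally show ?thesis .
qed simp

text \<open>A rational \<open>A/D\<close> in lowest terms close to \<open>x\<close> is p-integral,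
  so \<open>p\<close> does not divide \<open>D\<close>. Then \<open>D\<close> is invertible modulo
  \<open>p^N\<close>, and the residue of \<open>A/D\<close> is the required integer.\<close>

lemma approx_nat:
  assumes x: "absval (x :: 'q) \<le> 1"
  obtains a where "a < p ^ N" "absval (x - of_nat a) \<le> 1 / real p ^ N"
proof -
  have p0: "0 < real p" using p_gt_1 by simp
  have "x \<in> closure \<rat>" using dense_Rats by simp
  then obtain s where s: "s \<in> \<rat>" "dist s x < 1 / real p ^ N"
    unfolding closure_approachable using p0 by (meson divide_pos_pos zero_less_one zero_less_power)
  then obtain A D :: int where AD: "D > 0" "coprime A D" "s = of_int A / of_int D"
    by (metis Rats_cases')
  have sx: "absval (s - x) < 1 / real p ^ N" using s by (simp add: dist_absval)
  also have "\<dots> \<le> 1" using p_gt_1 by (simp add: divide_simps)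
  finally have s1: "absval s \<le> 1"
    using absval_add_le[of "s - x" 1 x] x by simp
  have D0: "(of_int D :: 'q) \<noteq> 0" using AD by simp
  have nd: "\<not> int p dvd D"
  proof
    assume pD: "int p dvd D"
    then have "\<not> int p dvd A"
      using AD prime_p by (meson coprime_common_divisor not_prime_unit prime_nat_int_transfer)
    then have A1: "absval (of_int A :: 'q) > 1 / real p" using absval_of_int_dvd[of 1 A] by simp
    have "absval (of_int D :: 'q) \<le> 1 / real p" using pD absval_of_int_dvd[of 1 D] by simp
    moreover have "absval (of_int A :: 'q) \<le> absval (of_int D :: 'q)"
      using s1 AD absval_pos[OF D0] by (simp add: absval_divide)
    ultimately show False using A1 by simp
  qed
  then have D1: "absval (of_int D :: 'q) = 1"
    using absval_of_int[of D] AD by (simp add: not_dvd_imp_multiplicity_0)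
  have "coprime D (int p ^ N)"
    using nd prime_p by (metis coprime_commute coprime_power_right_iff prime_imp_coprime prime_nat_int_transfer)
  then obtain e g where e: "e * D + g * int p ^ N = 1"
    using bezout_int[of D "int p ^ N"] by (auto simp: coprime_iff_gcd_eq_1)
  define b where "b = (A * e) mod int p ^ N"
  have b: "0 \<le> b" "b < int p ^ N" using p_gt_1 by (simp_all add: b_def)
  have "A = A * (e * D + g * int p ^ N)" using e by simp
  then have "A - b * D = int p ^ N * (A * g) + (A * e - b) * D" by (simp add: algebra_simps)
  moreover have "int p ^ N dvd A * e - b" by (simp add: b_def minus_mod_eq_mult_div)
  ultimately have "int p ^ N dvd A - b * D" by (metis dvd_add dvd_mult2 dvd_triv_left)
  then have dv: "absval (of_int (A - b * D) :: 'q) \<le> 1 / real p ^ N"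
    by (simp add: absval_of_int_dvd)
  have "s - of_int b = of_int (A - b * D) / of_int D"
    using D0 AD by (simp add: field_simps)
  then have "absval (s - of_int b) \<le> 1 / real p ^ N"
    using dv D1 by (simp add: absval_divide)
  then have "absval ((s - of_int b) - (s - x)) \<le> 1 / real p ^ N"
    using sx by (rule absval_diff_le[OF _ less_imp_le])
  then have "absval (x - of_nat (nat b)) \<le> 1 / real p ^ N"
    using b by simp
  moreover have "nat b < p ^ N"
    using b by (simp add: nat_less_iff)
  ultimately show ?thesis using that by blast
qed

text \<open>Complete and totally bounded: multiplication by \<open>p^k\<close> makes the ball
  integral, and integers below \<open>p^(N + k)\<close>, divided by \<open>p^k\<close> again, form a
  net of mesh \<open>p^{-N}\<close>.\<close>

lemma compact_absval_ball: "compact {x :: 'q. absval x \<le> r}"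
proof -
  have p0: "0 < real p" "1 < real p" using p_gt_1 by simp_all
  have "{x :: 'q. absval x \<le> r} = cball 0 r"
    by (auto simp: dist_absval)
  then have "complete {x :: 'q. absval x \<le> r}"
    using complete_closed_subset[OF _ _ complete_Qp] by auto
  moreover have "\<exists>C. finite C \<and> {x :: 'q. absval x \<le> r} \<subseteq> (\<Union>x\<in>C. ball x e)" if e: "e > 0" for e
  proof -
    obtain k where k: "r < real p ^ k" using real_arch_pow[OF p0(2)] by blast
    obtain N where "1 / e < real p ^ N" using real_arch_pow[OF p0(2)] by blast
    then have N: "1 / real p ^ N < e" using e p0 by (simp add: field_simps)
    let ?C = "(\<lambda>a. of_nat a / of_nat p ^ k :: 'q) ` {..<p ^ (N + k)}"
    have "\<exists>c\<in>?C. x \<in> ball c e" if "absval x \<le> r" for x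
    proof -
      have "absval (x * of_nat p ^ k) \<le> 1"
        unfolding absval_mult absval_p_power using k that p0 by (simp add: divide_simps)
      then obtain a where a: "a < p ^ (N + k)" "absval (x * of_nat p ^ k - of_nat a) \<le> 1 / real p ^ (N + k)"
        by (rule approx_nat)
      have "(of_nat p :: 'q) ^ k \<noteq> 0" using p0 by simp
      then have "x - of_nat a / of_nat p ^ k = (x * of_nat p ^ k - of_nat a) / of_nat p ^ k"
        by (simp add: field_simps)
      then have "absval (x - of_nat a / of_nat p ^ k) = absval (x * of_nat p ^ k - of_nat a) * real p ^ k"
        by (simp add: absval_divide absval_p_power)
      also have "\<dots> \<le> 1 / real p ^ (N + k) * real p ^ k"
        using a p0 by (intro mult_right_mono) auto
      also have "\<dots> = 1 / real p ^ N" using p0 by (simp add: power_add)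
      finally have "x \<in> ball (of_nat a / of_nat p ^ k) e"
        using N by (simp add: dist_absval absval_minus_commute)
      then show ?thesis using a by blast
    qed
    then show ?thesis by (intro exI[of _ ?C]) blast
  qed
  ultimately show ?thesis
    by (simp add: compact_eq_totally_bounded)
qed

end

section \<open>Finite extensions: closed subspaces and compact balls\<close>

context padic_field
begin

lemma emb_0 [simp]: "\<iota> 0 = 0"
  using emb_add[of 0 0] by simp

lemma emb_minus: "\<iota> (- x) = - \<iota> x"
  using emb_add[of x "- x"] by (simp add: eq_neg_iff_add_eq_0 add.commute)

lemma emb_diff: "\<iota> (x - y) = \<iota> x - \<iota> y"
  using emb_add[of x "- y"] by (simp add: emb_minus)

lemma emb_of_nat: "\<iota> (of_nat k) = of_nat k"
  by (induction k) (simp_all add: emb_add emb_1)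

sublocale ext: vector_space "ext_scale \<iota>"
  by unfold_locales (simp_all add: ext_scale_def emb_add emb_mult emb_1 algebra_simps)

lemma continuous_on_emb: "continuous_on S \<iota>"
  unfolding continuous_on_iff
  by (auto simp: dist_absval absval_emb simp flip: emb_diff intro: exI)

text \<open>A limit point of \<open>V\<close> is already a limit of a bounded part of
  \<open>V\<close>, and that part is compact, hence closed.\<close>

lemma closed_if_compact_balls:
  fixes V :: "'k set"
  assumes "\<And>r. compact {x \<in> V. absval x \<le> r}"
  shows "closed V"
proof -
  have "x \<in> V" if x: "x \<in> closure V" for x
  proof -
    have "x \<in> closure {y \<in> V. absval y \<le> max (absval x) 1}"
      unfolding closure_approachable
    proof (intro allI impI)
      fix e :: real assume "e > 0"
      then have "min e 1 > 0" by simp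
      then obtain y where y: "y \<in> V" "dist y x < min e 1"
        using x unfolding closure_approachable by blast
      then have "absval y \<le> max (absval x) 1"
        using absval_add[of "y - x" x] by (auto simp: dist_absval)
      then show "\<exists>y\<in>{y \<in> V. absval y \<le> max (absval x) 1}. dist y x < e"
        using y by auto
    qed
    then show ?thesis
      using closure_closed[OF compact_imp_closed[OF assms]] by blast
  qed
  then show ?thesis
    using closure_subset_eq by blast
qed

lemma closed_gap:
  fixes V :: "'k set"
  assumes "closed V" "b \<notin> V"
  obtains \<delta> where "\<delta> > 0" "\<And>v. v \<in> V \<Longrightarrow> \<delta> \<le> absval (b - v)"
proof -
  have "open (- V)" "b \<in> - V" using assms by auto
  then obtain \<delta> where "\<delta> > 0" "ball b \<delta> \<subseteq> - V"
    using open_contains_ball by blast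
  then show ?thesis using that[of \<delta>] by (force simp: dist_absval)
qed

text \<open>Division by \<open>c\<close> turns \<open>c b + v\<close> into \<open>b\<close> minus an
  element of \<open>V\<close>. So the coordinate along \<open>b\<close> is bounded by the size of
  the whole vector.\<close>

lemma gap_scale:
  assumes V: "ext.subspace V" and gap: "\<And>v. v \<in> V \<Longrightarrow> \<delta> \<le> absval (b - v)"
    and v: "v \<in> V"
  shows "absval c * \<delta> \<le> absval (\<iota> c * b + v)"
proof (cases "c = 0")
  case False
  then have c: "\<iota> c \<noteq> 0" using absval_emb[of c] absval_eq_0 by metis
  have "ext_scale \<iota> (- inverse c) v \<in> V" using V v by (rule ext.subspace_scale)
  then have "\<delta> \<le> absval (b - ext_scale \<iota> (- inverse c) v)" by (rule gap)
  moreover have "\<iota> c * (b - ext_scale \<iota> (- inverse c) v) = \<iota> c * b + v"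
  proof -
    have "\<iota> c * \<iota> (inverse c) = 1" using False by (simp flip: emb_mult add: emb_1)
    then show ?thesis by (simp add: ext_scale_def emb_minus algebra_simps)
  qed
  ultimately show ?thesis
    by (metis absval_emb absval_mult absval_nonneg mult_left_mono)
qed (simp add: absval_nonneg)

text \<open>Induction on the generators. The smaller span is closed by induction, so a new
  \<open>b\<close> has positive distance from it; this bounds both components of a bounded vector,
  and the ball is a closed part of the continuous image of a compact product.\<close>

lemma compact_span_ball:
  assumes "finite B"
  shows "compact {x \<in> ext.span B. absval x \<le> r}"
  using assms
proof (induction B arbitrary: r rule: finite_induct)
  case empty
  have "finite {x \<in> ext.span {}. absval x \<le> r}" by simp
  then show ?case by (rule finite_imp_compact)
next
  case (insert b B)
  show ?case
  proof (cases "b \<in> ext.span B \<or> r < 0")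
    case True
    then show ?thesis
    proof
      assume "b \<in> ext.span B"
      then show ?thesis using insert.IH by (simp add: ext.span_redundant)
    next
      assume "r < 0"
      then have "\<not> absval x \<le> r" for x :: 'k
        using absval_nonneg[of x] by linarith
      then have "{x \<in> ext.span (insert b B). absval x \<le> r} = {}" by blast
      then show ?thesis by (simp only: compact_empty)
    qed
  next
    case False
    then have b: "b \<notin> ext.span B" and r: "r \<ge> 0" by auto
    have "closed (ext.span B)"
      using insert.IH by (rule closed_if_compact_balls)
    then obtain \<delta> where \<delta>: "\<delta> > 0" "\<And>v. v \<in> ext.span B \<Longrightarrow> \<delta> \<le> absval (b - v)"
      using closed_gap[of "ext.span B" b] b by blast
    \<comment> \<open>The ultrametric bound for \<open>v = x - c b\<close> when
      \<open>absval x \<le> r\<close> and \<open>absval c \<le> r / \<delta>\<close>.\<close>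
    define R where "R = max r (r / \<delta> * absval b)"
    define P where "P = {c :: 'q. absval c \<le> r / \<delta>} \<times> {v \<in> ext.span B. absval v \<le> R}"
    have cP: "compact P"
      unfolding P_def by (intro compact_Times compact_absval_ball insert.IH)
    have "continuous_on P (\<lambda>z. \<iota> (fst z) * b + snd z)"
      by (intro continuous_intros continuous_on_compose2[OF continuous_on_emb]) auto
    then have "compact ((\<lambda>z. \<iota> (fst z) * b + snd z) ` P)"
      using cP compact_continuous_image by blast
    moreover have "closed {x :: 'k. absval x \<le> r}"
      by (intro closed_Collect_le continuous_intros)
    ultimately have "compact ((\<lambda>z. \<iota> (fst z) * b + snd z) ` P \<inter> {x. absval x \<le> r})"
      by (rule compact_Int_closed)
    moreover have "{x \<in> ext.span (insert b B). absval x \<le> r} =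
        (\<lambda>z. \<iota> (fst z) * b + snd z) ` P \<inter> {x. absval x \<le> r}"
    proof (intro set_eqI iffI)
      fix x assume x: "x \<in> {x \<in> ext.span (insert b B). absval x \<le> r}"
      then obtain c where c: "x - ext_scale \<iota> c b \<in> ext.span B"
        by (auto simp: ext.span_breakdown_eq)
      define v where "v = x - ext_scale \<iota> c b"
      have xv: "x = \<iota> c * b + v" by (simp add: v_def ext_scale_def)
      have v: "v \<in> ext.span B" using c by (simp add: v_def)
      have "absval c * \<delta> \<le> absval x"
        unfolding xv using ext.subspace_span \<delta>(2) v by (rule gap_scale)
      then have c1: "absval c \<le> r / \<delta>"
        using x \<delta>(1) by (simp add: field_simps)
      have "absval v \<le> max (absval x) (absval (\<iota> c * b))"
        using absval_diff[of x "\<iota> c * b"] xv by simp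
      moreover have "absval (\<iota> c * b) \<le> r / \<delta> * absval b"
        unfolding absval_mult absval_emb using c1 absval_nonneg by (rule mult_right_mono)
      ultimately have "absval v \<le> R" using x by (auto simp: R_def)
      then have "(c, v) \<in> P" using c1 v by (simp add: P_def)
      then show "x \<in> (\<lambda>z. \<iota> (fst z) * b + snd z) ` P \<inter> {x. absval x \<le> r}"
        using x xv by force
    next
      fix x assume "x \<in> (\<lambda>z. \<iota> (fst z) * b + snd z) ` P \<inter> {x. absval x \<le> r}"
      then obtain c v where "x = \<iota> c * b + v" "v \<in> ext.span B" "absval x \<le> r"
        by (auto simp: P_def)
      then show "x \<in> {x \<in> ext.span (insert b B). absval x \<le> r}"
        by (auto simp: ext.span_breakdown_eq ext_scale_def intro!: exI[of _ c])
    qed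
    ultimately show ?thesis by simp
  qed
qed

lemma compact_ext_ball: "compact {x :: 'k. absval x \<le> r}"
proof -
  obtain B :: "'k set" where "finite B" "ext.span B = UNIV" using finite_ext by blast
  then show ?thesis using compact_span_ball[of B r] by simp
qed

section \<open>Linear functionals and the trace\<close>

lemma subspace_finite_basis:
  assumes "ext.subspace V"
  obtains B where "finite B" "ext.independent B" "ext.span B = V"
proof -
  obtain T where T: "finite T" "ext.span T = UNIV" using finite_ext by blast
  obtain B where B: "B \<subseteq> V" "ext.independent B" "V \<subseteq> ext.span B"
    using ext.maximal_independent_subset by blast
  have "finite B" using ext.independent_span_bound[OF T(1) B(2)] T(2) by simp
  moreover have "ext.span B \<subseteq> V" using B(1) assms by (rule ext.span_minimal)
  ultimately show ?thesis using B that by blast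
qed

text \<open>The kernel is a finite-dimensional subspace, hence closed. A vector \<open>e\<close>
  outside it keeps a distance \<open>\<delta>\<close>, and \<open>gap_scale\<close> bounds the
  coefficient \<open>l x / l e\<close>.\<close>

lemma functional_bounded:
  fixes l :: "'k \<Rightarrow> 'q"
  assumes add: "\<And>x y. l (x + y) = l x + l y" and scale: "\<And>c x. l (\<iota> c * x) = c * l x"
  obtains D where "D > 0" "\<And>x. absval (l x) \<le> D * absval x"
proof (cases "\<forall>x. l x = 0")
  case True
  then show ?thesis using that[of 1] by (simp add: absval_nonneg)
next
  case False
  then obtain e where e: "l e \<noteq> 0" by blast
  let ?H = "{x. l x = 0}"
  have H: "ext.subspace ?H"
    using scale[of 0 0] by (auto simp: ext.subspace_def ext_scale_def add scale)
  then obtain B where "finite B" "ext.span B = ?H" by (rule subspace_finite_basis)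
  then have "closed ?H" using closed_if_compact_balls compact_span_ball by metis
  then obtain \<delta> where \<delta>: "\<delta> > 0" "\<And>v. v \<in> ?H \<Longrightarrow> \<delta> \<le> absval (e - v)"
    using e closed_gap[of ?H e] by auto
  have minus: "l (- x) = - l x" for x
    using add[of x "- x"] scale[of 0 0] by (simp add: eq_neg_iff_add_eq_0 add.commute)
  have "absval (l x) \<le> absval (l e) / \<delta> * absval x" for x
  proof -
    define c where "c = l x / l e"
    have "l (x + - (\<iota> c * e)) = 0"
      unfolding add minus scale using e by (simp add: c_def)
    then have "x + - (\<iota> c * e) \<in> ?H" by simp
    then have "absval c * \<delta> \<le> absval (\<iota> c * e + (x + - (\<iota> c * e)))"
      using gap_scale[OF H \<delta>(2)] by blast
    then have "absval c * \<delta> \<le> absval x" by simp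
    then show ?thesis
      using \<delta>(1) absval_pos[OF e] by (simp add: c_def absval_divide field_simps)
  qed
  then show ?thesis
    using that[of "absval (l e) / \<delta>"] \<delta>(1) absval_pos[OF e] by simp
qed

text \<open>Linearity is inherited from the coordinates in the basis that \<open>SOME\<close>
  chooses. At 1 the trace is the degree, nonzero in characteristic 0; this will make the additive
  character nontrivial.\<close>

lemma field_trace_props:
  shows field_trace_add: "field_trace \<iota> (x + y) = field_trace \<iota> x + field_trace \<iota> y"
    and field_trace_scale: "field_trace \<iota> (\<iota> c * x) = c * field_trace \<iota> x"
    and field_trace_one: "\<exists>k>0. field_trace \<iota> 1 = of_nat k"
proof -
  let ?P = "\<lambda>B. ext.independent B \<and> ext.span B = UNIV"
  define B where "B = (SOME B. ?P B)"
  have "\<exists>B. ?P B"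
    using subspace_finite_basis[OF ext.subspace_UNIV] by metis
  then have "?P B" unfolding B_def by (rule someI_ex)
  then have B: "ext.independent B" "ext.span B = UNIV" by simp_all
  obtain T where "finite T" "ext.span T = UNIV" using finite_ext by blast
  then have fin: "finite B" using ext.independent_span_bound[of T B] B by simp
  have tr: "field_trace \<iota> z = (\<Sum>b\<in>B. ext.representation B (z * b) b)" for z
    by (simp add: field_trace_def Let_def B_def)
  show "field_trace \<iota> (x + y) = field_trace \<iota> x + field_trace \<iota> y"
    using B by (simp add: tr distrib_right ext.representation_add sum.distrib)
  have "ext.representation B (\<iota> c * x * b) b = c * ext.representation B (x * b) b" for b c x
    using ext.representation_scale[OF B(1), of "x * b" c] B(2) by (simp add: ext_scale_def mult.assoc)
  then show "field_trace \<iota> (\<iota> c * x) = c * field_trace \<iota> x"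
    by (simp add: tr sum_distrib_left)
  have "field_trace \<iota> 1 = of_nat (card B)"
    using B by (simp add: tr ext.representation_basis)
  moreover have "B \<noteq> {}"
  proof
    assume "B = {}"
    then have "(UNIV :: 'k set) = {0}" using B by simp
    then show False by (metis UNIV_I singletonD zero_neq_one)
  qed
  ultimately show "\<exists>k>0. field_trace \<iota> 1 = of_nat k"
    using fin by (metis card_gt_0_iff)
qed

end

section \<open>The additive character\<close>

context padic_numbers
begin

text \<open>A fraction with denominator a power of \<open>p\<close> that is also a p-adic integer is
  an integer. Both the uniqueness of the fractional part and its additivity modulo integers rest on
  this.\<close>

lemma absval_of_rat_integral:
  assumes "absval (of_rat (of_int a / of_nat p ^ k) :: 'q) \<le> 1"
  shows "(of_int a / of_nat p ^ k :: rat) \<in> \<int>"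
proof -
  have "(of_rat (of_int a / of_nat p ^ k) :: 'q) = of_int a / of_nat p ^ k"
    by (simp add: of_rat_divide of_rat_power)
  then have "absval (of_rat (of_int a / of_nat p ^ k) :: 'q) = absval (of_int a :: 'q) * real p ^ k"
    by (simp only: absval_divide absval_p_power) simp
  then have "absval (of_int a :: 'q) \<le> 1 / real p ^ k"
    using assms p_gt_1 by (simp add: pos_le_divide_eq)
  then have "int p ^ k dvd a" by (simp add: absval_of_int_dvd)
  then obtain b where "a = int p ^ k * b" by (elim dvdE)
  then have "(of_int a / of_nat p ^ k :: rat) = of_int b" using p_gt_1 by simp
  then show ?thesis by simp
qed

lemma padic_fraction_diff:
  "\<exists>a. (of_int b / of_nat p ^ k - of_int c / of_nat p ^ l :: rat) = of_int a / of_nat p ^ (k + l)"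
  using p_gt_1 by (intro exI[of _ "b * int p ^ l - c * int p ^ k"]) (simp add: field_simps power_add)

lemma padic_frac_unique:
  assumes t: "t = of_nat a / of_nat p ^ k" "a < p ^ k" "absval (x - of_rat t :: 'q) \<le> 1"
    and t': "t' = of_nat a' / of_nat p ^ k'" "a' < p ^ k'" "absval (x - of_rat t' :: 'q) \<le> 1"
  shows "t = t'"
proof -
  obtain b where b: "t - t' = of_int b / of_nat p ^ (k + k')"
    using padic_fraction_diff[of "int a" k "int a'" k'] t t' by auto
  have "absval (of_rat (t - t') :: 'q) \<le> 1"
    using absval_diff_le[OF t'(3) t(3)] by (simp add: of_rat_diff)
  then have "t - t' \<in> \<int>" using absval_of_rat_integral b by metis
  moreover have "0 \<le> t" "0 \<le> t'" using t t' by simp_all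
  moreover have "t < 1" "t' < 1"
    unfolding t(1) t'(1) using t(2) t'(2) p_gt_1 by (simp_all flip: of_nat_power)
  ultimately obtain z :: int where "t - t' = of_int z" "- 1 < t - t'" "t - t' < 1"
    by (auto elim!: Ints_cases)
  then have "z = 0" by linarith
  then show ?thesis using \<open>t - t' = of_int z\<close> by simp
qed

lemma padic_frac_ex:
  "\<exists>t. (\<exists>a k. a < p ^ k \<and> t = of_nat a / of_nat p ^ k) \<and> absval (x - of_rat t :: 'q) \<le> 1"
proof -
  have p0: "1 < real p" using p_gt_1 by simp
  obtain k where k: "absval x < real p ^ k" using real_arch_pow[OF p0] by blast
  have "absval (x * of_nat p ^ k) \<le> 1"
    using k p0 by (simp add: absval_mult absval_p_power divide_simps)
  then obtain a where a: "a < p ^ k" "absval (x * of_nat p ^ k - of_nat a) \<le> 1 / real p ^ k"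
    by (rule approx_nat)
  have "x - of_nat a / of_nat p ^ k = (x * of_nat p ^ k - of_nat a) / of_nat p ^ k"
    using p0 by (simp add: field_simps)
  then have "absval (x - of_nat a / of_nat p ^ k) \<le> 1"
    using a p0 by (simp add: absval_divide absval_p_power field_simps)
  then show ?thesis
    using a by (intro exI[of _ "of_nat a / of_nat p ^ k"]) (auto simp: of_rat_divide of_rat_power)
qed

lemma padic_frac_eqI:
  assumes "a < p ^ k" "absval (x - of_rat (of_nat a / of_nat p ^ k) :: 'q) \<le> 1"
  shows "padic_frac p x = of_nat a / of_nat p ^ k"
  unfolding padic_frac_def using assms padic_frac_unique by (intro the_equality) blast+

lemma padic_frac_spec:
  obtains a k where "a < p ^ k" "padic_frac p x = of_nat a / of_nat p ^ k"
    "absval (x - of_rat (padic_frac p x) :: 'q) \<le> 1"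
  using padic_frac_ex[of x] padic_frac_eqI[of _ _ x] by metis

lemma padic_frac_add: "padic_frac p x + padic_frac p y - padic_frac p (x + y :: 'q) \<in> \<int>"
proof -
  obtain a k where x: "padic_frac p x = of_nat a / of_nat p ^ k"
      "absval (x - of_rat (padic_frac p x)) \<le> 1" by (rule padic_frac_spec[of x])
  obtain b l where y: "padic_frac p y = of_nat b / of_nat p ^ l"
      "absval (y - of_rat (padic_frac p y)) \<le> 1" by (rule padic_frac_spec[of y])
  obtain c m where z: "padic_frac p (x + y) = of_nat c / of_nat p ^ m"
      "absval (x + y - of_rat (padic_frac p (x + y))) \<le> 1" by (rule padic_frac_spec[of "x + y"])
  define t where "t = padic_frac p x + padic_frac p y - padic_frac p (x + y)"
  obtain d where d: "padic_frac p x - padic_frac p (x + y) = of_int d / of_nat p ^ (k + m)"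
    using padic_fraction_diff[of "int a" k "int c" m] x z by auto
  have "t = of_int d / of_nat p ^ (k + m) - of_int (- int b) / of_nat p ^ l"
    by (simp add: t_def d[symmetric] y)
  then obtain e where e: "t = of_int e / of_nat p ^ (k + m + l)"
    using padic_fraction_diff by metis
  have "(of_rat t :: 'q) = (x + y - of_rat (padic_frac p (x + y)))
      - (x - of_rat (padic_frac p x)) - (y - of_rat (padic_frac p y))"
    by (simp add: t_def of_rat_add of_rat_diff)
  then have "absval (of_rat t :: 'q) \<le> 1"
    using x y z by (metis absval_diff_le)
  then show ?thesis using absval_of_rat_integral e t_def by metis
qed

end

section \<open>The character of the extension: additivity, triviality near 0, nontriviality\<close>

context padic_field
begin

lemma add_char_add: "add_char p \<iota> (x + y) = add_char p \<iota> x * add_char p \<iota> y"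
proof -
  let ?f = "\<lambda>z. padic_frac p (field_trace \<iota> z)"
  obtain j where j: "?f x + ?f y - ?f (x + y) = of_int j"
    using padic_frac_add[of "field_trace \<iota> x" "field_trace \<iota> y"]
    by (auto simp: field_trace_add elim: Ints_cases)
  have "(of_rat (?f x) + of_rat (?f y) :: complex) = of_rat (?f (x + y) + of_int j)"
    unfolding j[symmetric] by (simp add: of_rat_add)
  then have eq: "(of_rat (?f x) + of_rat (?f y) :: complex) = of_rat (?f (x + y)) + of_int j"
    by (simp add: of_rat_add)
  have "add_char p \<iota> x * add_char p \<iota> y
      = exp (2 * of_real pi * \<i> * (of_rat (?f x) + of_rat (?f y)))"
    unfolding add_char_def by (simp add: exp_add distrib_left)
  also have "\<dots> = add_char p \<iota> (x + y) * exp (2 * of_int j * of_real pi * \<i>)"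
    unfolding eq add_char_def by (simp add: exp_add distrib_left mult_ac)
  also have "exp (2 * of_int j * of_real pi * \<i>) = (1 :: complex)"
    using exp_integer_2pi[of "of_int j"] by simp
  finally show ?thesis by simp
qed

lemma norm_add_char [simp]: "norm (add_char p \<iota> x) = 1"
proof -
  have "\<exists>r. of_rat t = complex_of_real r" for t
    by (cases t) (simp add: of_rat_rat, metis of_real_divide of_real_of_int_eq)
  then obtain r where "of_rat (padic_frac p (field_trace \<iota> x)) = complex_of_real r" by blast
  then have "add_char p \<iota> x = exp (\<i> * complex_of_real (2 * pi * r))"
    by (simp add: add_char_def mult_ac)
  then show ?thesis by (simp only: norm_exp_i_times)
qed

text \<open>The trace is bounded, so it maps a small enough ball into the p-adic integers, where the
  fractional part is 0.\<close>

lemma add_char_trivial_ball: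
  obtains \<kappa> where "\<kappa> > 0" "\<And>z. absval z \<le> \<kappa> \<Longrightarrow> add_char p \<iota> z = 1"
proof -
  obtain D where D: "D > 0" "\<And>x. absval (field_trace \<iota> x) \<le> D * absval x"
    using functional_bounded[of "field_trace \<iota>"] field_trace_add field_trace_scale by metis
  have "add_char p \<iota> z = 1" if "absval z \<le> 1 / D" for z
  proof -
    have "absval (field_trace \<iota> z) \<le> 1"
      using D(2)[of z] that D(1) by (simp add: field_simps)
    then have "padic_frac p (field_trace \<iota> z) = of_nat 0 / of_nat p ^ 0"
      by (intro padic_frac_eqI) auto
    then show ?thesis by (simp add: add_char_def)
  qed
  then show ?thesis using that[of "1 / D"] D(1) by simp
qed

lemma add_char_nontrivial: "\<exists>z. add_char p \<iota> z \<noteq> 1"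
proof -
  obtain k where k: "k > 0" "field_trace \<iota> 1 = of_nat k" using field_trace_one by blast
  \<comment> \<open>Chosen so that the trace is exactly \<open>1 / p\<close>; the character value is
    then a primitive \<open>p\<close>-th root of unity.\<close>
  define c :: 'q where "c = 1 / (of_nat k * of_nat p)"
  have "field_trace \<iota> (\<iota> c * 1) = c * of_nat k" using k field_trace_scale by metis
  then have tr: "field_trace \<iota> (\<iota> c) = 1 / of_nat p" using k p_gt_1 by (simp add: c_def)
  have "padic_frac p (field_trace \<iota> (\<iota> c)) = of_nat 1 / of_nat p ^ 1"
    unfolding tr using p_gt_1 by (intro padic_frac_eqI) (auto simp: of_rat_divide)
  then have eq: "add_char p \<iota> (\<iota> c) = exp (2 * of_real pi * \<i> / of_nat p)"
    by (simp add: add_char_def of_rat_divide)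
  have "exp (2 * of_real pi * \<i> / of_nat p :: complex) \<noteq> 1"
  proof
    assume "exp (2 * of_real pi * \<i> / of_nat p :: complex) = 1"
    then obtain n :: int where "Im (2 * of_real pi * \<i> / of_nat p) = of_int (2 * n) * pi"
      unfolding exp_eq_1 by blast
    then have "2 * pi * (1 / real p) = 2 * pi * of_int n" by simp
    then have "1 / real p = of_int n" by (rule mult_left_cancel[THEN iffD1, rotated]) simp
    moreover have "0 < 1 / real p" "1 / real p < 1" using p_gt_1 by simp_all
    ultimately have "0 < real_of_int n" "real_of_int n < 1" by simp_all
    then show False by simp
  qed
  then show ?thesis using eq by metis
qed

end

section \<open>Residue classes\<close>

text \<open>Residue classes become fibres of a map to representatives, so sums and counts over
  quotients turn into sums and counts over an image.\<close>

lemma quotient_kernel: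
  "A // {(x, y). g x = g y} = (\<lambda>v. g -` {v}) ` g ` A"
proof -
  have "{(x, y). g x = g y} `` {x} = g -` {g x}" for x by auto
  then show ?thesis by (auto simp: quotient_def)
qed

lemma inj_on_vimage_singleton: "inj_on (\<lambda>v. g -` {v}) (g ` A)"
  by (rule inj_onI) (metis imageE vimage_singleton_eq)

lemma card_quotient_kernel: "card (A // {(x, y). g x = g y}) = card (g ` A)"
  unfolding quotient_kernel by (rule card_image) (rule inj_on_vimage_singleton)

text \<open>Both images are in bijection with the quotient of \<open>A\<close> by the common
  kernel.\<close>

lemma card_image_kernel_eq:
  assumes "\<And>x y. x \<in> A \<Longrightarrow> y \<in> A \<Longrightarrow> g x = g y \<longleftrightarrow> h x = h y"
  shows "card (g ` A) = card (h ` A)"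
proof (rule bij_betw_same_card)
  show "bij_betw (\<lambda>v. h (SOME x. x \<in> A \<and> g x = v)) (g ` A) (h ` A)"
  proof (rule bij_betw_imageI)
    have *: "(SOME y. y \<in> A \<and> g y = g x) \<in> A \<and> g (SOME y. y \<in> A \<and> g y = g x) = g x" if "x \<in> A" for x
      using someI[of "\<lambda>y. y \<in> A \<and> g y = g x" x] that by simp
    then have **: "h (SOME y. y \<in> A \<and> g y = g x) = h x" if "x \<in> A" for x
      using assms that by blast
    show "inj_on (\<lambda>v. h (SOME x. x \<in> A \<and> g x = v)) (g ` A)"
      by (rule inj_onI) (use ** assms in auto)
    show "(\<lambda>v. h (SOME x. x \<in> A \<and> g x = v)) ` g ` A = h ` A"
      using ** by (auto simp: image_image)
  qed
qed

lemma card_vec_box: "card {w :: 'a ^ 'n::finite. \<forall>i. w $ i \<in> A i} = (\<Prod>i\<in>UNIV. card (A i))"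
proof -
  have "bij_betw vec_lambda (PiE UNIV A) {w :: 'a ^ 'n. \<forall>i. w $ i \<in> A i}"
    by (rule bij_betwI[where g = vec_nth]) (auto simp: PiE_def)
  then have "card (PiE UNIV A) = card {w :: 'a ^ 'n. \<forall>i. w $ i \<in> A i}"
    by (rule bij_betw_same_card)
  then show ?thesis by (simp add: card_PiE)
qed

lemma finite_vec_box:
  assumes "\<And>i. finite (A i)"
  shows "finite {w :: 'a ^ 'n::finite. \<forall>i. w $ i \<in> A i}"
proof -
  have "{w :: 'a ^ 'n. \<forall>i. w $ i \<in> A i} \<subseteq> vec_lambda ` PiE UNIV A"
    by (auto simp: image_iff intro!: bexI[of _ "vec_nth _"])
  then show ?thesis
    by (rule finite_subset) (intro finite_imageI finite_PiE finite_class.finite_UNIV assms)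
qed

locale padic_uniformizer = padic_field p \<iota>
  for p :: nat and \<iota> :: "'q::nonarch_field \<Rightarrow> 'k::nonarch_field" +
  fixes \<pi> :: 'k
  assumes unif: "uniformizer \<pi>"
begin

abbreviation "\<rho> \<equiv> absval \<pi>"

lemma rho_less_1: "\<rho> < 1"
proof -
  have "\<pi> * 1 \<in> max_ideal"
    unfolding unif[unfolded uniformizer_def] by (rule imageI) (simp add: valuation_ring_def)
  then show ?thesis by (simp add: max_ideal_def)
qed

lemma pi_nonzero [simp]: "\<pi> \<noteq> 0"
proof
  assume "\<pi> = 0"
  then have "max_ideal \<subseteq> {0 :: 'k}" using unif by (auto simp: uniformizer_def)
  moreover have "absval (of_nat p :: 'k) = 1 / real p"
    using absval_emb[of "of_nat p"] absval_p_power[of 1] by (simp add: emb_of_nat)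
  then have "of_nat p \<in> (max_ideal :: 'k set)" using p_gt_1 by (simp add: max_ideal_def)
  ultimately show False using p_gt_1 by auto
qed

lemma rho_pos: "0 < \<rho>"
  by (rule absval_pos) simp

text \<open>Discreteness of the valuation: \<open>\<pi>\<close> generates the maximal ideal, so no
  absolute value lies strictly between \<open>\<rho>\<close> and 1.\<close>

lemma max_ideal_eq: "absval x < 1 \<longleftrightarrow> absval x \<le> \<rho>" for x :: 'k
proof
  assume "absval x < 1"
  then have "x \<in> (\<lambda>y. \<pi> * y) ` valuation_ring"
    using unif by (auto simp: uniformizer_def max_ideal_def)
  then show "absval x \<le> \<rho>"
    using rho_pos by (auto simp: valuation_ring_def absval_mult)
qed (use rho_less_1 in simp)

lemma max_ideal_pow_eq: "max_ideal_pow \<pi> M = {x. absval x \<le> \<rho> ^ M}"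
proof (intro set_eqI iffI)
  fix x :: 'k assume "x \<in> {x. absval x \<le> \<rho> ^ M}"
  then have "absval (x / \<pi> ^ M) \<le> 1"
    using rho_pos by (simp add: absval_divide absval_power)
  then show "x \<in> max_ideal_pow \<pi> M"
    unfolding max_ideal_pow_def valuation_ring_def by (intro image_eqI[of _ _ "x / \<pi> ^ M"]) auto
qed (use rho_pos in \<open>auto simp: max_ideal_pow_def valuation_ring_def absval_mult absval_power\<close>)

text \<open>For the last \<open>k\<close> with \<open>absval x \<le> \<rho> ^ k\<close>, the
  quotient \<open>x / \<pi> ^ k\<close> is integral but not in the maximal ideal, hence a
  unit.\<close>

lemma absval_integral:
  fixes x :: 'k
  assumes "x \<noteq> 0" "absval x \<le> 1"
  obtains k where "absval x = \<rho> ^ k"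
proof -
  have "\<exists>n. \<rho> ^ n < absval x"
    using real_arch_pow_inv[OF absval_pos[OF assms(1)] rho_less_1] .
  then obtain n where n: "\<rho> ^ n < absval x" "\<And>j. j < n \<Longrightarrow> \<not> \<rho> ^ j < absval x"
    using exists_least_iff[of "\<lambda>n. \<rho> ^ n < absval x"] by blast
  have "n \<noteq> 0" using n(1) assms(2) by (cases n) auto
  then obtain k where k: "n = Suc k" by (cases n) auto
  have "absval (x / \<pi> ^ k) \<le> 1"
    using n(2)[of k] k rho_pos by (simp add: absval_divide absval_power)
  moreover have "\<not> absval (x / \<pi> ^ k) \<le> \<rho>"
    using n(1) k rho_pos by (simp add: absval_divide absval_power pos_divide_le_eq)
  ultimately have "absval (x / \<pi> ^ k) = 1"
    unfolding max_ideal_eq[symmetric] by simp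
  then have "absval x = \<rho> ^ k"
    using rho_pos by (simp add: absval_divide absval_power)
  then show ?thesis by (rule that)
qed

text \<open>A canonical representative modulo \<open>\<pi>^M\<close>: by the ultrametric inequality
  congruent points define the same predicate, so \<open>SOME\<close> picks the same value for
  them.\<close>

definition rep :: "nat \<Rightarrow> 'k \<Rightarrow> 'k" where
  "rep M x = (SOME y. absval (x - y) \<le> \<rho> ^ M)"

definition vrep :: "nat \<Rightarrow> 'k ^ 'n::finite \<Rightarrow> 'k ^ 'n" where
  "vrep M x = (\<chi> i. rep M (x $ i))"

definition ints :: "('k ^ 'n::finite) set" where
  "ints = {x. \<forall>i. absval (x $ i) \<le> 1}"

lemma absval_rep: "absval (x - rep M x) \<le> \<rho> ^ M"
  unfolding rep_def by (rule someI[of "\<lambda>y. absval (x - y) \<le> \<rho> ^ M" x]) (use rho_pos in simp)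

lemma rep_eq_iff: "rep M x = rep M y \<longleftrightarrow> absval (x - y) \<le> \<rho> ^ M"
proof
  assume "rep M x = rep M y"
  then show "absval (x - y) \<le> \<rho> ^ M"
    using absval_diff_le[OF absval_rep[of x M] absval_rep[of y M]] by simp
next
  assume xy: "absval (x - y) \<le> \<rho> ^ M"
  have "absval (x - z) \<le> \<rho> ^ M \<longleftrightarrow> absval (y - z) \<le> \<rho> ^ M" for z
    using absval_add_le[OF xy, of "y - z"] absval_diff_le[OF _ xy, of "x - z"] by auto
  then show "rep M x = rep M y" by (simp add: rep_def)
qed

lemma rep_rep [simp]: "rep M (rep M x) = rep M x"
  using absval_rep[of x M] by (simp add: rep_eq_iff absval_minus_commute)

lemma rep_rep_le: "k \<le> M \<Longrightarrow> rep k (rep M x) = rep k x"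
  using order.trans[OF absval_rep[of x M] power_decreasing[of k M \<rho>]] rho_pos rho_less_1
  by (simp add: rep_eq_iff absval_minus_commute[of _ x])

lemma vrep_eq_iff: "vrep M x = vrep M y \<longleftrightarrow> (\<forall>i. absval (x $ i - y $ i) \<le> \<rho> ^ M)"
  by (simp add: vrep_def vec_eq_iff rep_eq_iff)

lemma vrep_vrep [simp]: "vrep M (vrep M x) = vrep M x"
  by (simp add: vrep_def)

lemma vrep_vrep_le: "k \<le> M \<Longrightarrow> vrep k (vrep M x) = vrep k x"
  by (simp add: vrep_def rep_rep_le)

lemma cong_rel_eq: "cong_rel \<pi> M = {(x, y). vrep M x = vrep M y}"
  by (simp add: cong_rel_def max_ideal_pow_eq vrep_eq_iff)

text \<open>Compactness leaves finitely many balls of radius \<open>\<rho> ^ M\<close>, with one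
  representative each. In particular the residue field is finite.\<close>

lemma finite_rep_ball: "finite (rep M ` {x. absval x \<le> r})"
proof -
  let ?B = "{x :: 'k. absval x \<le> r}"
  have "?B \<subseteq> (\<Union>x\<in>?B. ball x (\<rho> ^ M))" using rho_pos by auto
  then obtain C where C: "finite C" "?B \<subseteq> (\<Union>x\<in>C. ball x (\<rho> ^ M))"
    by (rule compactE_image[OF compact_ext_ball[of r], rotated]) auto
  have "rep M ` ?B \<subseteq> rep M ` C"
  proof
    fix t assume "t \<in> rep M ` ?B"
    then obtain x where x: "x \<in> ?B" "t = rep M x" by blast
    then obtain c where "c \<in> C" "dist c x < \<rho> ^ M" using C by auto
    then have "rep M c = rep M x" by (simp add: rep_eq_iff dist_absval)
    then show "t \<in> rep M ` C" using x(2) \<open>c \<in> C\<close> by (metis imageI)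
  qed
  then show ?thesis using C by (meson finite_imageI finite_subset)
qed

definition q :: nat where
  "q = residue_card TYPE('k)"

lemma q_eq: "q = card (rep 1 ` {x. absval x \<le> 1})"
proof -
  have "{(x, y). x - y \<in> max_ideal} = {(x, y). rep 1 x = rep 1 y}"
    by (simp add: max_ideal_def max_ideal_eq rep_eq_iff)
  then show ?thesis
    unfolding q_def residue_card_def by (simp add: card_quotient_kernel valuation_ring_def)
qed

lemma q_gt_1: "1 < q"
proof -
  have "rep 1 0 \<noteq> rep 1 1" using rho_less_1 by (simp add: rep_eq_iff)
  then have "card {rep 1 0, rep 1 1} = 2" by simp
  moreover have "card {rep 1 0, rep 1 1} \<le> q"
    unfolding q_eq by (rule card_mono[OF finite_rep_ball]) auto
  ultimately show ?thesis by simp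
qed

lemma ball_eq_image: "{x. absval (x - a) \<le> \<rho> ^ k} = (\<lambda>s. a + \<pi> ^ k * s) ` {s. absval s \<le> 1}"
proof (intro set_eqI iffI)
  fix x assume "x \<in> {x. absval (x - a) \<le> \<rho> ^ k}"
  then have "absval ((x - a) / \<pi> ^ k) \<le> 1"
    using rho_pos by (simp add: absval_divide absval_power)
  then show "x \<in> (\<lambda>s. a + \<pi> ^ k * s) ` {s. absval s \<le> 1}"
    by (intro image_eqI[of _ _ "(x - a) / \<pi> ^ k"]) auto
qed (use rho_pos in \<open>auto simp: absval_mult absval_power\<close>)

text \<open>The map \<open>s \<mapsto> a + \<pi>^k s\<close> carries congruence modulo
  \<open>\<pi>^(M - k)\<close> to congruence modulo \<open>\<pi>^M\<close>.\<close>

lemma card_rep_ball_shift: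
  assumes "k \<le> M"
  shows "card (rep M ` {x. absval (x - a) \<le> \<rho> ^ k}) = card (rep (M - k) ` {s. absval s \<le> 1})"
  unfolding ball_eq_image image_image
proof (rule card_image_kernel_eq)
  fix x y :: 'k
  have "\<rho> ^ M = \<rho> ^ k * \<rho> ^ (M - k)" using assms by (simp flip: power_add)
  moreover have "a + \<pi> ^ k * x - (a + \<pi> ^ k * y) = \<pi> ^ k * (x - y)" by (simp add: algebra_simps)
  ultimately show "rep M (a + \<pi> ^ k * x) = rep M (a + \<pi> ^ k * y) \<longleftrightarrow> rep (M - k) x = rep (M - k) y"
    using rho_pos by (simp add: rep_eq_iff absval_mult absval_power)
qed

text \<open>The fibres of the reduction from modulus \<open>\<pi>^(Suc M)\<close> to
  \<open>\<pi>^M\<close> are balls of radius \<open>\<rho> ^ M\<close>, each with \<open>q\<close>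
  classes.\<close>

lemma card_rep_unit_ball: "card (rep M ` {x. absval x \<le> 1}) = q ^ M"
proof (induction M)
  case 0
  have "rep 0 ` {x. absval x \<le> 1} = (\<lambda>_. rep 0 0) ` {x :: 'k. absval x \<le> 1}"
    by (rule image_cong[OF refl]) (simp add: rep_eq_iff)
  also have "\<dots> = {rep 0 0}" by (auto simp: image_constant_conv intro!: exI[of _ 0])
  finally show ?case by simp
next
  case (Suc M)
  let ?R = "{x :: 'k. absval x \<le> 1}"
  let ?T = "rep (Suc M) ` ?R"
  have fin: "finite ?T" by (rule finite_rep_ball)
  have "card ?T = (\<Sum>v\<in>rep M ` ?T. card {w \<in> ?T. rep M w = v})"
    using sum.image_gen[OF fin, of "\<lambda>_. 1 :: nat" "rep M"] by simp
  also have "\<dots> = (\<Sum>v\<in>rep M ` ?T. q)"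
  proof (rule sum.cong[OF refl])
    fix v assume "v \<in> rep M ` ?T"
    then obtain x where x: "absval x \<le> 1" "v = rep M x" by (auto simp: rep_rep_le)
    have "{w \<in> ?T. rep M w = v} = rep (Suc M) ` {y. absval (y - x) \<le> \<rho> ^ M}"
    proof (intro set_eqI iffI)
      fix w assume "w \<in> rep (Suc M) ` {y. absval (y - x) \<le> \<rho> ^ M}"
      then obtain y where y: "w = rep (Suc M) y" "absval (y - x) \<le> \<rho> ^ M" by auto
      have "\<rho> ^ M \<le> 1" using rho_pos rho_less_1 by (simp add: power_le_one)
      then have "absval y \<le> 1" using absval_add_le[of "y - x" 1 x] y x by simp
      moreover have "rep M y = rep M x" using y by (simp add: rep_eq_iff)
      ultimately show "w \<in> {w \<in> ?T. rep M w = v}"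
        using y x by (auto simp: rep_rep_le)
    next
      fix w assume "w \<in> {w \<in> ?T. rep M w = v}"
      then obtain y where "w = rep (Suc M) y" "rep M y = rep M x" using x by (auto simp: rep_rep_le)
      then show "w \<in> rep (Suc M) ` {y. absval (y - x) \<le> \<rho> ^ M}" by (auto simp: rep_eq_iff)
    qed
    then show "card {w \<in> ?T. rep M w = v} = q"
      by (simp add: card_rep_ball_shift q_eq)
  qed
  also have "rep M ` ?T = rep M ` ?R" by (simp add: image_image rep_rep_le)
  finally show ?case using Suc by simp
qed

lemma card_rep_ball:
  assumes "k \<le> M"
  shows "card (rep M ` {x. absval (x - a) \<le> \<rho> ^ k}) = q ^ (M - k)"
  using assms by (simp add: card_rep_ball_shift card_rep_unit_ball)

lemma vrep_box: "vrep M ` {x. \<forall>i. x $ i \<in> A i} = {w. \<forall>i. w $ i \<in> rep M ` A i}"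
proof (intro set_eqI iffI)
  fix w assume "w \<in> {w. \<forall>i. w $ i \<in> rep M ` A i}"
  then obtain g where "\<forall>i. g i \<in> A i \<and> w $ i = rep M (g i)" by (auto simp: image_iff) metis
  then show "w \<in> vrep M ` {x. \<forall>i. x $ i \<in> A i}"
    by (intro image_eqI[of _ _ "\<chi> i. g i"]) (auto simp: vrep_def vec_eq_iff)
qed (auto simp: vrep_def)

lemma card_vrep_ball:
  fixes a :: "'k ^ 'n::finite"
  assumes "\<And>i. k i \<le> M"
  shows "card (vrep M ` {x. \<forall>i. absval (x $ i - a $ i) \<le> \<rho> ^ k i}) = q ^ (\<Sum>i\<in>UNIV. M - k i)"
  using vrep_box[of M "\<lambda>i. {t. absval (t - a $ i) \<le> \<rho> ^ k i}"] assms
  by (simp add: card_vec_box card_rep_ball power_sum)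

lemma finite_vrep_ints: "finite (vrep M ` (ints :: ('k ^ 'n::finite) set))"
proof -
  have eq: "(ints :: ('k ^ 'n) set) = {x. \<forall>i. x $ i \<in> {t. absval t \<le> 1}}"
    by (simp add: ints_def)
  have "finite {w :: 'k ^ 'n. \<forall>i. w $ i \<in> rep M ` {t. absval t \<le> 1}}"
    by (rule finite_vec_box) (rule finite_rep_ball)
  then show ?thesis unfolding eq vrep_box .
qed

text \<open>Unions of classes modulo \<open>\<pi>^M\<close>. Inclusion in \<open>ints\<close> makes
  the representatives finite in number, and saturation keeps them inside \<open>X\<close>.\<close>

definition saturated :: "nat \<Rightarrow> ('k ^ 'n::finite) set \<Rightarrow> bool" where
  "saturated M X \<longleftrightarrow> X \<subseteq> ints \<and> (\<forall>x\<in>X. \<forall>y. vrep M x = vrep M y \<longrightarrow> y \<in> X)"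

definition periodic_on :: "('k ^ 'n::finite) set \<Rightarrow> nat \<Rightarrow> ('k ^ 'n \<Rightarrow> complex) \<Rightarrow> bool" where
  "periodic_on X M h \<longleftrightarrow> (\<forall>x\<in>X. \<forall>y\<in>X. vrep M x = vrep M y \<longrightarrow> h x = h y)"

lemma finite_vrep_saturated: "saturated M X \<Longrightarrow> finite (vrep N ` X)"
  unfolding saturated_def by (meson finite_subset finite_vrep_ints image_mono)

lemma vrep_mono: "k \<le> M \<Longrightarrow> vrep M x = vrep M y \<Longrightarrow> vrep k x = vrep k y"
  by (metis vrep_vrep_le)

lemma saturated_mono: "saturated k X \<Longrightarrow> k \<le> M \<Longrightarrow> saturated M X"
  unfolding saturated_def using vrep_mono by blast

lemma vrep_mem_saturated: "saturated M X \<Longrightarrow> x \<in> X \<Longrightarrow> vrep M x \<in> X"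
  unfolding saturated_def by (metis vrep_vrep)

text \<open>Each class modulo \<open>\<pi>^k\<close> splits into \<open>q ^ ((M - k) * n)\<close>
  classes modulo \<open>\<pi>^M\<close>, and \<open>h\<close> takes the same value on all of
  them.\<close>

lemma refine_sum:
  fixes X :: "('k ^ 'n::finite) set"
  assumes sat: "saturated k X" and per: "periodic_on X k h" and kM: "k \<le> M"
  shows "(\<Sum>w\<in>vrep M ` X. h w) = of_nat (q ^ ((M - k) * CARD('n))) * (\<Sum>v\<in>vrep k ` X. h v)"
proof -
  have fin: "finite (vrep M ` X)" using sat by (rule finite_vrep_saturated)
  have satM: "saturated M X" using sat kM by (rule saturated_mono)
  have "(\<Sum>w\<in>vrep M ` X. h w) = (\<Sum>v\<in>vrep k ` vrep M ` X. \<Sum>w\<in>{w \<in> vrep M ` X. vrep k w = v}. h w)"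
    by (rule sum.image_gen[OF fin])
  also have "\<dots> = (\<Sum>v\<in>vrep k ` vrep M ` X. of_nat (q ^ ((M - k) * CARD('n))) * h v)"
  proof (rule sum.cong[OF refl])
    fix v assume "v \<in> vrep k ` vrep M ` X"
    then obtain x where x: "x \<in> X" "v = vrep k x" using kM by (auto simp: vrep_vrep_le)
    have vX: "v \<in> X" using sat x vrep_mem_saturated by blast
    have "{w \<in> vrep M ` X. vrep k w = v} = vrep M ` {y. \<forall>i. absval (y $ i - x $ i) \<le> \<rho> ^ k}"
    proof (intro set_eqI iffI)
      fix w assume "w \<in> vrep M ` {y. \<forall>i. absval (y $ i - x $ i) \<le> \<rho> ^ k}"
      then obtain y where y: "w = vrep M y" "vrep k y = vrep k x" by (auto simp: vrep_eq_iff)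
      then have "y \<in> X" using sat x unfolding saturated_def by metis
      then show "w \<in> {w \<in> vrep M ` X. vrep k w = v}" using x y kM by (auto simp: vrep_vrep_le)
    next
      fix w assume "w \<in> {w \<in> vrep M ` X. vrep k w = v}"
      then have "w = vrep M w" "vrep k w = vrep k x" using x by auto
      then show "w \<in> vrep M ` {y. \<forall>i. absval (y $ i - x $ i) \<le> \<rho> ^ k}"
        by (intro image_eqI[of _ _ w]) (auto simp: vrep_eq_iff)
    qed
    then have "card {w \<in> vrep M ` X. vrep k w = v} = q ^ ((M - k) * CARD('n))"
      using card_vrep_ball[of "\<lambda>_. k" M x] kM by (simp add: mult.commute)
    moreover have "h w = h v" if w: "w \<in> {w \<in> vrep M ` X. vrep k w = v}" for w
    proof -
      have "w \<in> X" using w satM vrep_mem_saturated by blast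
      moreover have "vrep k w = vrep k v" using w x by auto
      ultimately show ?thesis using per vX unfolding periodic_on_def by blast
    qed
    ultimately show "(\<Sum>w\<in>{w \<in> vrep M ` X. vrep k w = v}. h w) = of_nat (q ^ ((M - k) * CARD('n))) * h v"
      by simp
  qed
  also have "vrep k ` vrep M ` X = vrep k ` X" using kM by (simp add: image_image vrep_vrep_le)
  finally show ?thesis by (simp add: sum_distrib_left)
qed

lemma periodic_on_mono: "periodic_on X k h \<Longrightarrow> k \<le> M \<Longrightarrow> periodic_on X M h"
  unfolding periodic_on_def using vrep_mono by blast

lemma periodic_on_subset: "periodic_on X k h \<Longrightarrow> Y \<subseteq> X \<Longrightarrow> periodic_on Y k h"
  unfolding periodic_on_def by blast

lemma quotient_sum:
  fixes X :: "('k ^ 'n::finite) set"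
  assumes sat: "saturated M X" and per: "periodic_on X M h"
  shows "(\<Sum>Y\<in>X // cong_rel \<pi> M. the_elem (h ` Y)) = (\<Sum>w\<in>vrep M ` X. h w)"
proof -
  have "(\<Sum>Y\<in>X // cong_rel \<pi> M. the_elem (h ` Y)) = (\<Sum>w\<in>vrep M ` X. the_elem (h ` (vrep M -` {w})))"
    unfolding cong_rel_eq quotient_kernel
    by (subst sum.reindex[OF inj_on_vimage_singleton]) simp
  also have "\<dots> = (\<Sum>w\<in>vrep M ` X. h w)"
  proof (rule sum.cong[OF refl])
    fix w assume "w \<in> vrep M ` X"
    then obtain x where x: "x \<in> X" "w = vrep M x" by blast
    have wX: "w \<in> X" using sat x vrep_mem_saturated by blast
    have hw: "h y = h w" if "y \<in> vrep M -` {w}" for y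
    proof -
      have y: "vrep M y = vrep M w" "vrep M x = vrep M y" using that x by simp_all
      then have "y \<in> X" using sat x(1) unfolding saturated_def by blast
      then show ?thesis using per wX y(1) unfolding periodic_on_def by blast
    qed
    have "w \<in> vrep M -` {w}" using x by simp
    then have "h ` (vrep M -` {w}) = {h w}" using hw by blast
    then show "the_elem (h ` (vrep M -` {w})) = h w" by simp
  qed
  finally show ?thesis .
qed

text \<open>The averages in the limit are stationary from \<open>M\<close> on: refinement multiplies
  numerator and denominator by the same factor.\<close>

lemma class_value_eq:
  fixes X :: "('k ^ 'n::finite) set"
  assumes sat: "saturated k X" and per: "periodic_on X M h" and kM: "k \<le> M"
  shows "class_value \<pi> h X = (\<Sum>w\<in>vrep M ` X. h w) / of_nat (card (vrep M ` X))"
proof -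
  let ?avg = "\<lambda>M. (\<Sum>Y\<in>X // cong_rel \<pi> M. the_elem (h ` Y)) / of_nat (card (X // cong_rel \<pi> M))"
  have satM: "saturated M X" using sat kM by (rule saturated_mono)
  have "?avg N = (\<Sum>w\<in>vrep M ` X. h w) / of_nat (card (vrep M ` X))" if N: "M \<le> N" for N
  proof -
    have satN: "saturated N X" using satM N by (rule saturated_mono)
    \<comment> \<open>For the constant 1 the refinement formula counts classes.\<close>
    have one: "periodic_on X M (\<lambda>_. 1)" by (simp add: periodic_on_def)
    have "(\<Sum>Y\<in>X // cong_rel \<pi> N. the_elem (h ` Y)) = (\<Sum>w\<in>vrep N ` X. h w)"
      using satN periodic_on_mono[OF per N] by (rule quotient_sum)
    also have "\<dots> = of_nat (q ^ ((N - M) * CARD('n))) * (\<Sum>w\<in>vrep M ` X. h w)"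
      using satM per N by (rule refine_sum)
    finally have num: "(\<Sum>Y\<in>X // cong_rel \<pi> N. the_elem (h ` Y)) = \<dots>" .
    have den: "(of_nat (card (X // cong_rel \<pi> N)) :: complex) =
        of_nat (q ^ ((N - M) * CARD('n))) * of_nat (card (vrep M ` X))"
      using refine_sum[OF satM one N] by (simp add: cong_rel_eq card_quotient_kernel)
    show ?thesis unfolding num den using q_gt_1 by simp
  qed
  then have "?avg \<longlonglongrightarrow> (\<Sum>w\<in>vrep M ` X. h w) / of_nat (card (vrep M ` X))"
    by (intro tendsto_eventually) (auto simp: eventually_sequentially)
  then show ?thesis unfolding class_value_def by (rule limI)
qed

lemma saturated_sum_domain:
  fixes J :: "'n::finite set"
  assumes m: "1 \<le> m"
  shows "saturated m (sum_domain J :: ('k ^ 'n) set)"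
proof -
  have "y \<in> sum_domain J" if x: "x \<in> sum_domain J" and xy: "vrep m x = vrep m y" for x y :: "'k ^ 'n"
  proof -
    have lt: "absval (y $ i - x $ i) < 1" for i
    proof -
      have "absval (x $ i - y $ i) \<le> \<rho> ^ m" using xy by (simp add: vrep_eq_iff)
      also have "\<dots> \<le> \<rho>" using power_decreasing[of 1 m \<rho>] m rho_pos rho_less_1 by simp
      also have "\<dots> < 1" by (rule rho_less_1)
      finally show ?thesis by (simp add: absval_minus_commute[of _ "x $ i"])
    qed
    have "absval (y $ i) = 1" if "i \<in> J" for i
      using absval_unit_perturb[of "y $ i - x $ i" "x $ i"] lt[of i] x that
      by (simp add: sum_domain_def unit_group_def)
    moreover have "absval (y $ i) \<le> 1" if "i \<notin> J" for i
      using absval_add_le[of "y $ i - x $ i" 1 "x $ i"] lt[of i] x that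
      by (simp add: sum_domain_def valuation_ring_def)
    ultimately show ?thesis by (simp add: sum_domain_def unit_group_def valuation_ring_def)
  qed
  moreover have "x \<in> ints" if "x \<in> sum_domain J" for x :: "'k ^ 'n"
    using that by (force simp: sum_domain_def ints_def unit_group_def valuation_ring_def)
  ultimately show ?thesis unfolding saturated_def by blast
qed

text \<open>All classes modulo \<open>\<pi>^m\<close> contain equally many representatives modulo
  \<open>\<pi>^M\<close>, so the class means combine into one sum with uniform weights. The level
  \<open>M\<close> stays free, subject to periodicity.\<close>

lemma exp_sum_eq:
  fixes f :: "('k, 'n::finite) laurent"
  assumes m: "1 \<le> m" and mM: "m \<le> M"
    and per: "periodic_on (sum_domain J) M (\<lambda>x. add_char p \<iota> (u / \<pi> ^ m * laurent_eval f x))"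
  shows "exp_sum p \<iota> \<pi> J f m u =
    (\<Sum>x\<in>vrep M ` sum_domain J. add_char p \<iota> (u / \<pi> ^ m * laurent_eval f x)) / of_nat (q ^ (M * CARD('n)))"
proof -
  let ?D = "sum_domain J :: ('k ^ 'n) set"
  define h where "h = (\<lambda>x. add_char p \<iota> (u / \<pi> ^ m * laurent_eval f x))"
  have sat: "saturated m ?D" using m by (rule saturated_sum_domain)
  have fin: "finite (vrep M ` ?D)" using sat by (rule finite_vrep_saturated)
  have "(\<Sum>X\<in>?D // cong_rel \<pi> m. class_value \<pi> h X) = (\<Sum>v\<in>vrep m ` ?D. class_value \<pi> h (vrep m -` {v}))"
    unfolding cong_rel_eq quotient_kernel
    by (subst sum.reindex[OF inj_on_vimage_singleton]) simp
  also have "\<dots> = (\<Sum>v\<in>vrep m ` vrep M ` ?D. (\<Sum>w\<in>{w \<in> vrep M ` ?D. vrep m w = v}. h w) / of_nat (q ^ ((M - m) * CARD('n))))"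
  proof (rule sum.cong)
    show "vrep m ` ?D = vrep m ` vrep M ` ?D" using mM by (simp add: image_image vrep_vrep_le)
    fix v assume "v \<in> vrep m ` vrep M ` ?D"
    then obtain x where x: "x \<in> ?D" "v = vrep m x" using mM by (auto simp: vrep_vrep_le)
    let ?X = "vrep m -` {v}"
    have XD: "?X \<subseteq> ?D" using x sat unfolding saturated_def by auto
    have satX: "saturated m ?X" using XD sat unfolding saturated_def by auto
    have "class_value \<pi> h ?X = (\<Sum>w\<in>vrep M ` ?X. h w) / of_nat (card (vrep M ` ?X))"
      using satX periodic_on_subset[OF per XD] mM unfolding h_def by (rule class_value_eq)
    moreover have "vrep M ` ?X = {w \<in> vrep M ` ?D. vrep m w = v}"
      using XD mM by (auto simp: vrep_vrep_le)
    moreover have "card (vrep M ` ?X) = q ^ ((M - m) * CARD('n))"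
    proof -
      have "?X = {y. \<forall>i. absval (y $ i - x $ i) \<le> \<rho> ^ m}"
        using x by (auto simp flip: vrep_eq_iff)
      then show ?thesis using card_vrep_ball[of "\<lambda>_. m" M x] mM by (simp add: mult.commute)
    qed
    ultimately show "class_value \<pi> h ?X =
        (\<Sum>w\<in>{w \<in> vrep M ` ?D. vrep m w = v}. h w) / of_nat (q ^ ((M - m) * CARD('n)))" by simp
  qed
  also have "\<dots> = (\<Sum>w\<in>vrep M ` ?D. h w) / of_nat (q ^ ((M - m) * CARD('n)))"
    by (subst sum.image_gen[OF fin, of h "vrep m"]) (simp add: sum_divide_distrib)
  finally have "exp_sum p \<iota> \<pi> J f m u =
      (\<Sum>w\<in>vrep M ` ?D. h w) / of_nat (q ^ ((M - m) * CARD('n))) / of_nat (q ^ (m * CARD('n)))"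
    unfolding exp_sum_def h_def q_def by simp
  moreover have "q ^ (M * CARD('n)) = q ^ ((M - m) * CARD('n)) * q ^ (m * CARD('n))"
    using mM by (simp flip: power_add distrib_right)
  ultimately show ?thesis by (simp add: h_def)
qed

end

section \<open>Cones of a simple fan\<close>

definition pairing :: "int ^ 'n::finite \<Rightarrow> int ^ 'n \<Rightarrow> int" where
  "pairing a m = (\<Sum>i\<in>UNIV. a $ i * m $ i)"

lemma inner_real_vec: "real_vec a \<bullet> real_vec m = of_int (pairing a m)"
  by (simp add: inner_vec_def real_vec_def pairing_def)

lemma inj_real_vec: "inj real_vec"
  by (rule injI) (simp add: real_vec_def vec_eq_iff)

lemma real_vec_eq_0 [simp]: "real_vec a = 0 \<longleftrightarrow> a = 0"
  by (simp add: real_vec_def vec_eq_iff)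

lemma real_vec_sum_scale: "real_vec (\<Sum>a\<in>S. c a *s a) = (\<Sum>a\<in>S. of_int (c a) *\<^sub>R real_vec a)"
  by (simp add: real_vec_def vec_eq_iff)

lemma pairing_sum_scale: "pairing (\<Sum>a\<in>S. c a *s a) m = (\<Sum>a\<in>S. c a * pairing a m)"
proof -
  have "pairing (\<Sum>a\<in>S. c a *s a) m = (\<Sum>i\<in>UNIV. \<Sum>a\<in>S. c a * (a $ i * m $ i))"
    by (simp add: pairing_def sum_distrib_right mult.assoc)
  also have "\<dots> = (\<Sum>a\<in>S. \<Sum>i\<in>UNIV. c a * (a $ i * m $ i))" by (rule sum.swap)
  finally show ?thesis by (simp add: pairing_def sum_distrib_left)
qed

lemma weight_sum_scale: "weight (\<Sum>a\<in>S. c a *s a) = (\<Sum>a\<in>S. c a * weight a)"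
proof -
  have "weight (\<Sum>a\<in>S. c a *s a) = (\<Sum>i\<in>UNIV. \<Sum>a\<in>S. c a * a $ i)"
    by (simp add: weight_def)
  also have "\<dots> = (\<Sum>a\<in>S. \<Sum>i\<in>UNIV. c a * a $ i)" by (rule sum.swap)
  finally show ?thesis by (simp add: weight_def sum_distrib_left)
qed

interpretation int_vec: module "(*s) :: int \<Rightarrow> int ^ 'n \<Rightarrow> int ^ 'n::finite"
  by unfold_locales (simp_all add: vec_eq_iff algebra_simps)

text \<open>Each coordinate with respect to \<open>B\<close> is an integer linear functional, hence
  the pairing with the vector of its values on the standard basis.\<close>

lemma lattice_basis_dual:
  assumes B: "lattice_basis B"
  shows "\<exists>E. \<forall>a\<in>B. \<forall>b\<in>B. pairing a (E b) = (if a = b then 1 else 0)"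
proof (intro exI ballI)
  fix a b :: "int ^ 'a" assume a: "a \<in> B" and b: "b \<in> B"
  have ind: "int_vec.independent B" and sp: "int_vec.span B = UNIV"
    using B by (auto simp: lattice_basis_def)
  have "int_vec.representation B (\<Sum>i\<in>UNIV. a $ i *s axis i 1) b
      = (\<Sum>i\<in>UNIV. a $ i * int_vec.representation B (axis i 1) b)"
    using sp by (simp add: int_vec.representation_sum[OF ind] int_vec.representation_scale[OF ind])
  then have "(\<Sum>i\<in>UNIV. a $ i * int_vec.representation B (axis i 1) b) = int_vec.representation B a b"
    by (simp only: basis_expansion)
  then show "pairing a (\<chi> i. int_vec.representation B (axis i 1) b) = (if a = b then 1 else 0)"
    using a ind by (simp add: pairing_def int_vec.representation_basis)
qed

lemma spans_cone_dual:
  assumes "spans_cone S \<sigma>"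
  shows "\<exists>E. \<forall>a\<in>S. \<forall>b\<in>S. pairing a (E b) = (if a = b then 1 else 0)"
proof -
  obtain B where "lattice_basis B" "S \<subseteq> B" using assms by (auto simp: spans_cone_def)
  then show ?thesis using lattice_basis_dual[of B] by (meson subsetD)
qed

text \<open>Pairing a real relation with a dual vector isolates one coefficient, so independence
  over the integers passes to the reals.\<close>

lemma spans_cone_independent:
  assumes S: "spans_cone S \<sigma>"
  shows "independent (real_vec ` S)"
proof -
  obtain E where E: "\<forall>a\<in>S. \<forall>b\<in>S. pairing a (E b) = (if a = b then 1 else 0)"
    using spans_cone_dual[OF S] by blast
  have "u v = 0" if t: "finite t" "t \<subseteq> real_vec ` S" "(\<Sum>v\<in>t. u v *\<^sub>R v) = 0" "v \<in> t" for t u v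
  proof -
    obtain b where b: "b \<in> S" "v = real_vec b" using t by blast
    have "w \<bullet> real_vec (E b) = (if w = v then 1 else 0)" if "w \<in> t" for w
    proof -
      obtain a where "a \<in> S" "w = real_vec a" using t \<open>w \<in> t\<close> by blast
      then show ?thesis using E b by (simp add: inner_real_vec inj_eq[OF inj_real_vec])
    qed
    then have "(\<Sum>w\<in>t. u w * (w \<bullet> real_vec (E b))) = (\<Sum>w\<in>t. u w * (if w = v then 1 else 0))"
      by (intro sum.cong) auto
    also have "\<dots> = u v" using t by (simp add: if_distrib sum.delta cong: if_cong)
    finally have "u v = (\<Sum>w\<in>t. u w *\<^sub>R w) \<bullet> real_vec (E b)" by (simp add: inner_sum_left)
    then show ?thesis using t by simp
  qed
  then show ?thesis unfolding dependent_explicit by blast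
qed

lemma spans_cone_finite:
  assumes "spans_cone S \<sigma>"
  shows "finite S"
proof (rule finite_imageD)
  show "finite (real_vec ` S)"
    using independent_bound[OF spans_cone_independent[OF assms]] by simp
  show "inj_on real_vec S" using inj_real_vec by (rule inj_on_subset) simp
qed

lemma spans_cone_nonzero:
  assumes "spans_cone S \<sigma>" "a \<in> S"
  shows "a \<noteq> 0"
proof
  assume "a = 0"
  then have "0 \<in> real_vec ` S" using assms(2) by (intro image_eqI[of _ _ a]) auto
  then show False using dependent_zero spans_cone_independent[OF assms(1)] by blast
qed

lemma spans_cone_mem: "spans_cone S \<sigma> \<Longrightarrow> a \<in> S \<Longrightarrow> real_vec a \<in> \<sigma>"
  unfolding spans_cone_def by (metis hull_inc imageI)

lemma spans_cone_convex: "spans_cone S \<sigma> \<Longrightarrow> convex \<sigma>"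
  by (auto simp: spans_cone_def intro: convex_convex_cone_hull)

lemma cone_hull_nonneg_combination:
  assumes S: "finite S" and x: "x \<in> convex_cone hull (real_vec ` S)"
  obtains c where "\<And>a. a \<in> S \<Longrightarrow> 0 \<le> c a" "x = (\<Sum>a\<in>S. c a *\<^sub>R real_vec a)"
proof -
  let ?C = "{x. \<exists>c. (\<forall>a\<in>S. 0 \<le> c a) \<and> x = (\<Sum>a\<in>S. c a *\<^sub>R real_vec a)}"
  have "real_vec ` S \<subseteq> ?C"
  proof
    fix y assume "y \<in> real_vec ` S"
    then obtain b where b: "b \<in> S" "y = real_vec b" by blast
    then have "y = (\<Sum>a\<in>S. (if a = b then 1 else 0) *\<^sub>R real_vec a)"
      using S by (simp add: if_distrib[of "\<lambda>c. c *\<^sub>R _"] sum.delta cong: if_cong)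
    then show "y \<in> ?C" by (intro CollectI exI[of _ "\<lambda>a. if a = b then 1 else 0"]) auto
  qed
  moreover have "convex_cone ?C"
    unfolding convex_cone_iff
  proof (intro conjI ballI allI impI)
    show "0 \<in> ?C" by (intro CollectI exI[of _ "\<lambda>_. 0"]) simp
  next
    fix y z assume "y \<in> ?C" "z \<in> ?C"
    then obtain c c' where "\<forall>a\<in>S. 0 \<le> c a" "y = (\<Sum>a\<in>S. c a *\<^sub>R real_vec a)"
      "\<forall>a\<in>S. 0 \<le> c' a" "z = (\<Sum>a\<in>S. c' a *\<^sub>R real_vec a)" by auto
    then show "y + z \<in> ?C"
      by (intro CollectI exI[of _ "\<lambda>a. c a + c' a"]) (auto simp: scaleR_left_distrib sum.distrib)
  next
    fix y and r :: real assume "y \<in> ?C" "0 \<le> r"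
    then obtain c where "\<forall>a\<in>S. 0 \<le> c a" "y = (\<Sum>a\<in>S. c a *\<^sub>R real_vec a)" by auto
    then show "r *\<^sub>R y \<in> ?C" using \<open>0 \<le> r\<close>
      by (intro CollectI exI[of _ "\<lambda>a. r * c a"]) (auto simp: scaleR_sum_right)
  qed
  ultimately have "convex_cone hull (real_vec ` S) \<subseteq> ?C" by (rule hull_minimal)
  then show ?thesis using x that by auto
qed

text \<open>Pairing with the dual vectors recovers the nonnegative real coefficients, which are
  therefore integers. Without them the parameters \<open>\<pi>^{c_a}\<close> would make no
  sense.\<close>

lemma cone_lattice_point:
  assumes S: "spans_cone S \<sigma>" and k: "real_vec k \<in> \<sigma>"
  obtains c :: "int ^ 'n::finite \<Rightarrow> nat" where "k = (\<Sum>a\<in>S. int (c a) *s a)"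
proof -
  have fin: "finite S" using S by (rule spans_cone_finite)
  obtain E where E: "\<forall>a\<in>S. \<forall>b\<in>S. pairing a (E b) = (if a = b then 1 else 0)"
    using spans_cone_dual[OF S] by blast
  have "real_vec k \<in> convex_cone hull (real_vec ` S)" using S k by (simp add: spans_cone_def)
  then obtain c where c: "\<And>a. a \<in> S \<Longrightarrow> 0 \<le> c a" "real_vec k = (\<Sum>a\<in>S. c a *\<^sub>R real_vec a)"
    using cone_hull_nonneg_combination[OF fin] by blast
  have int: "c b = of_int (pairing k (E b))" if b: "b \<in> S" for b
  proof -
    have "of_int (pairing k (E b)) = (\<Sum>a\<in>S. c a * of_int (pairing a (E b)))"
      by (simp add: c(2) inner_sum_left flip: inner_real_vec)
    also have "\<dots> = (\<Sum>a\<in>S. c a * (if a = b then 1 else 0))"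
      using E b by (intro sum.cong) auto
    also have "\<dots> = c b" using fin b by (simp add: if_distrib sum.delta cong: if_cong)
    finally show ?thesis by simp
  qed
  have "c a = of_int (int (nat (pairing k (E a))))" if "a \<in> S" for a
    using int[OF that] c(1)[OF that] by simp
  then have "real_vec k = (\<Sum>a\<in>S. of_int (int (nat (pairing k (E a)))) *\<^sub>R real_vec a)"
    unfolding c(2) by (intro sum.cong) auto
  then have "real_vec k = real_vec (\<Sum>a\<in>S. int (nat (pairing k (E a))) *s a)"
    by (simp only: real_vec_sum_scale)
  then have "k = (\<Sum>a\<in>S. int (nat (pairing k (E a))) *s a)"
    by (rule injD[OF inj_real_vec])
  then show ?thesis by (rule that)
qed

text \<open>A generator from one set is a nonnegative combination of the other set. Expanding back,
  nonnegativity leaves one term, and the dual pairing makes its coefficient 1. Finiteness of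
  \<open>fan_edges\<close>, hence of the ratios defining \<open>\<beta>\<close>, depends on
  this.\<close>

lemma spans_cone_unique:
  assumes "spans_cone S \<sigma>" "spans_cone S' \<sigma>"
  shows "S = S'"
proof -
  have sub: "S' \<subseteq> S" if S: "spans_cone S \<sigma>" and S': "spans_cone S' \<sigma>" for S S'
  proof
    fix b assume b: "b \<in> S'"
    have fin: "finite S" "finite S'" using S S' spans_cone_finite by blast+
    obtain E where E: "\<forall>a\<in>S. \<forall>b\<in>S. pairing a (E b) = (if a = b then 1 else 0)"
      using spans_cone_dual[OF S] by blast
    obtain E' where E': "\<forall>a\<in>S'. \<forall>b\<in>S'. pairing a (E' b) = (if a = b then 1 else 0)"
      using spans_cone_dual[OF S'] by blast
    obtain c where c: "b = (\<Sum>a\<in>S. int (c a) *s a)"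
      using cone_lattice_point[OF S spans_cone_mem[OF S' b]] by blast
    have "\<exists>a\<in>S. c a \<noteq> 0"
    proof (rule ccontr)
      assume "\<not> ?thesis"
      then have "b = 0" unfolding c by simp
      then show False using spans_cone_nonzero[OF S' b] by simp
    qed
    then obtain a where a: "a \<in> S" "c a \<noteq> 0" by blast
    have "\<exists>c'. a = (\<Sum>b\<in>S'. int (c' b) *s b)" if "a \<in> S" for a
      by (rule cone_lattice_point[OF S' spans_cone_mem[OF S that]]) blast
    then obtain c' where c': "\<And>a. a \<in> S \<Longrightarrow> a = (\<Sum>b\<in>S'. int (c' a b) *s b)"
      by metis
    have pE': "pairing e (E' b') = int (c' e b')" if "e \<in> S" "b' \<in> S'" for e b'
    proof -
      have "pairing e (E' b') = (\<Sum>d\<in>S'. int (c' e d) * pairing d (E' b'))"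
        using arg_cong[OF c'[OF that(1)], of "\<lambda>v. pairing v (E' b')"] by (simp only: pairing_sum_scale)
      also have "\<dots> = (\<Sum>d\<in>S'. int (c' e d) * (if d = b' then 1 else 0))"
        using E' that by (intro sum.cong) auto
      finally show ?thesis using fin that by (simp add: if_distrib sum.delta cong: if_cong)
    qed
    \<comment> \<open>The \<open>b'\<close>-coordinate of \<open>b\<close> is 0 and is a sum of
      nonnegative terms; since \<open>c a\<close> is positive, \<open>a\<close> has no
      \<open>b'\<close>-component either.\<close>
    have zero: "c' a b' = 0" if b': "b' \<in> S'" "b' \<noteq> b" for b'
    proof -
      have "0 = pairing b (E' b')" using E' b b' by simp
      also have "\<dots> = (\<Sum>e\<in>S. int (c e) * int (c' e b'))"
        unfolding c pairing_sum_scale using pE' b' by (intro sum.cong) auto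
      finally have "(\<Sum>e\<in>S. int (c e) * int (c' e b')) = 0" by simp
      then have "int (c a) * int (c' a b') = 0"
        using fin a by (subst (asm) sum_nonneg_eq_0_iff) auto
      then show ?thesis using a by simp
    qed
    have "a = (\<Sum>d\<in>S'. int (c' a d) *s d)" using c' a by blast
    also have "\<dots> = (\<Sum>d\<in>S'. if d = b then int (c' a b) *s b else 0)"
      using zero by (intro sum.cong) auto
    also have "\<dots> = int (c' a b) *s b" using fin b by simp
    finally have ab: "a = int (c' a b) *s b" .
    have "1 = pairing a (E a)" using E a by simp
    also have "\<dots> = pairing (\<Sum>d\<in>{b}. int (c' a b) *s d) (E a)"
      using arg_cong[OF ab, of "\<lambda>v. pairing v (E a)"] by simp
    also have "\<dots> = int (c' a b) * pairing b (E a)" by (subst pairing_sum_scale) simp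
    finally have "int (c' a b) * pairing b (E a) = 1" by simp
    then have "int (c' a b) = 1" using zmult_eq_1_iff by auto
    then have "a = b" using arg_cong[OF ab, of "\<lambda>v. v"] by (metis vector_smult_lid)
    then show "b \<in> S" using a by simp
  qed
  show ?thesis using sub[OF assms] sub[OF assms(2,1)] by blast
qed

lemma finite_fan_edges:
  fixes F :: "(real ^ 'n::finite) set set"
  assumes "finite F"
  shows "finite (fan_edges F)"
proof -
  have "finite {S. spans_cone S \<sigma>}" for \<sigma> :: "(real ^ 'n) set"
  proof (cases "\<exists>S. spans_cone S \<sigma>")
    case True
    then obtain S where "spans_cone S \<sigma>" by blast
    then have "{S. spans_cone S \<sigma>} \<subseteq> {S}" using spans_cone_unique by blast
    then show ?thesis by (rule finite_subset) simp
  qed simp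
  moreover have "{S. \<exists>\<sigma>\<in>F. spans_cone S \<sigma>} = (\<Union>\<sigma>\<in>F. {S. spans_cone S \<sigma>})" by blast
  ultimately have "finite {S. \<exists>\<sigma>\<in>F. spans_cone S \<sigma>}" using assms by simp
  then show ?thesis unfolding fan_edges_def using spans_cone_finite by auto
qed

text \<open>Cones of lower dimension have measure zero, so the full-dimensional ones are dense in
  the orthant; being finitely many and closed, they cover it.\<close>

lemma full_cones_cover:
  fixes F :: "(real ^ 'n::finite) set set"
  assumes simple: "simple_fan F" and supp: "\<Union>F = orthant" and x: "x \<in> orthant"
  obtains \<sigma> where "\<sigma> \<in> F" "aff_dim \<sigma> = int CARD('n)" "x \<in> \<sigma>"
proof -
  have fin: "finite F" using simple by (simp add: simple_fan_def fan_def)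
  let ?N = "{\<sigma> \<in> F. aff_dim \<sigma> = int CARD('n)}" and ?L = "{\<sigma> \<in> F. aff_dim \<sigma> \<noteq> int CARD('n)}"
  have hull: "\<exists>V. finite V \<and> \<sigma> = convex_cone hull V" if "\<sigma> \<in> F" for \<sigma>
    using simple that unfolding simple_fan_def fan_def rational_cone_def by (metis finite_imageI)
  then have cl: "closed \<sigma>" if "\<sigma> \<in> F" for \<sigma> using that closed_convex_cone_hull by metis
  have "negligible \<sigma>" if "\<sigma> \<in> ?L" for \<sigma>
  proof -
    have "0 \<in> \<sigma>" using hull that convex_cone_hull_contains_0 by blast
    then have "aff_dim \<sigma> = int (dim \<sigma>)" by (intro aff_dim_zero) (rule hull_inc)
    moreover have "aff_dim \<sigma> \<le> int CARD('n)" using aff_dim_le_DIM[of \<sigma>] by simp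
    ultimately have "dim \<sigma> < DIM(real ^ 'n)" using that by simp
    then show ?thesis by (rule negligible_lowdim)
  qed
  then have neg: "negligible (\<Union>?L)" using fin by (intro negligible_Union) auto
  have "x \<in> closure (\<Union>?N)"
    unfolding closure_approachable
  proof (intro allI impI)
    fix e :: real assume e: "e > 0"
    \<comment> \<open>Restricting to the open orthant gives a set that is open in the whole space,
      hence not negligible, even if \<open>x\<close> is on the boundary.\<close>
    let ?O = "ball x e \<inter> {y. \<forall>i. 0 < y $ i}"
    have "open (\<Inter>i. {y :: real ^ 'n. 0 < y $ i})"
      by (intro open_INT finite ballI open_Collect_less continuous_intros)
    moreover have "(\<Inter>i. {y :: real ^ 'n. 0 < y $ i}) = {y. \<forall>i. 0 < y $ i}" by auto
    ultimately have "open {y :: real ^ 'n. \<forall>i. 0 < y $ i}" by simp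
    then have "open ?O" by blast
    moreover have "?O \<noteq> {}"
    proof -
      define t where "t = e / (2 * real CARD('n))"
      have t: "t > 0" using e by (simp add: t_def)
      have "norm (\<chi> i::'n. t) \<le> (\<Sum>i\<in>(UNIV::'n set). \<bar>t\<bar>)"
        using norm_le_l1_cart[of "\<chi> i::'n. t"] by simp
      also have "\<dots> < e" using e t by (simp add: t_def)
      finally have "x + (\<chi> i. t) \<in> ball x e" by (simp add: dist_norm)
      moreover have "\<forall>i. 0 < (x + (\<chi> i. t)) $ i" using x t by (auto simp: orthant_def add_nonneg_pos)
      ultimately show ?thesis by blast
    qed
    ultimately have "\<not> negligible ?O" by (rule open_not_negligible)
    then obtain y where y: "y \<in> ?O" "y \<notin> \<Union>?L" using neg negligible_subset by blast
    then have "y \<in> orthant" by (auto simp: orthant_def less_imp_le)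
    then have "y \<in> \<Union>?N" using supp y by blast
    moreover have "dist y x < e" using y by (simp add: dist_commute)
    ultimately show "\<exists>y\<in>\<Union>?N. dist y x < e" by blast
  qed
  moreover have "closed (\<Union>?N)" using fin cl by (intro closed_Union) auto
  ultimately show ?thesis using that by auto
qed

section \<open>The support function on the cones\<close>

lemma support_fun_hull_le:
  assumes A: "finite A" and x: "x \<in> convex hull A"
  shows "support_fun (convex hull A) a \<le> a \<bullet> x"
proof -
  have "bounded ((\<lambda>x. a \<bullet> x) ` (convex hull A))"
    using A by (intro bounded_linear_image bounded_convex_hull finite_imp_bounded bounded_linear_inner_right)
  then show ?thesis unfolding support_fun_def using x
    by (intro cINF_lower bounded_imp_bdd_below)
qed

lemma support_fun_hull_greatest:
  assumes A: "A \<noteq> {}" and le: "\<And>x. x \<in> A \<Longrightarrow> c \<le> a \<bullet> x"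
  shows "c \<le> support_fun (convex hull A) a"
proof -
  have "convex hull A \<subseteq> {x. c \<le> a \<bullet> x}"
    using le by (intro hull_minimal convex_halfspace_ge) blast
  then show ?thesis unfolding support_fun_def using A by (intro cINF_greatest) auto
qed

lemma support_fun_hull_attained:
  assumes "finite A" "A \<noteq> {}"
  obtains x where "x \<in> A" "support_fun (convex hull A) a = a \<bullet> x"
proof -
  have "Min ((\<bullet>) a ` A) \<in> (\<bullet>) a ` A" using assms by (intro Min_in) auto
  then obtain x where x: "x \<in> A" "Min ((\<bullet>) a ` A) = a \<bullet> x" by auto
  then have min: "a \<bullet> x \<le> a \<bullet> y" if "y \<in> A" for y
    using Min_le[of "(\<bullet>) a ` A" "a \<bullet> y"] assms that by auto
  then have "support_fun (convex hull A) a = a \<bullet> x"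
    using support_fun_hull_greatest[of A "a \<bullet> x" a] support_fun_hull_le[OF assms(1), of x a] assms(2) min x(1)
    by (intro antisym) (auto intro: hull_inc)
  then show ?thesis using x that by blast
qed

text \<open>A minimiser for one relative interior point minimises throughout the relative interior,
  because the first meet locus is constant there. Boundary points follow by continuity along a
  segment.\<close>

lemma support_fun_linear_on_cone:
  assumes A: "finite A" "A \<noteq> {}" and sub: "subordinated F (convex hull A)"
    and \<sigma>: "\<sigma> \<in> F" "convex \<sigma>" "\<sigma> \<noteq> {}"
  obtains x where "x \<in> A" "\<And>a. a \<in> \<sigma> \<Longrightarrow> support_fun (convex hull A) a = a \<bullet> x"
proof -
  obtain c where c: "c \<in> rel_interior \<sigma>" using \<sigma> rel_interior_eq_empty by blast
  obtain x where x: "x \<in> A" "support_fun (convex hull A) c = c \<bullet> x"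
    using support_fun_hull_attained[OF A] .
  have xG: "x \<in> convex hull A" using x by (simp add: hull_inc)
  have "support_fun (convex hull A) a = a \<bullet> x" if a: "a \<in> \<sigma>" for a
  proof (rule antisym)
    show "support_fun (convex hull A) a \<le> a \<bullet> x" using A xG by (intro support_fun_hull_le)
    show "a \<bullet> x \<le> support_fun (convex hull A) a"
    proof (rule support_fun_hull_greatest[OF A(2)])
      fix y assume y: "y \<in> A"
      have le: "(a - s *\<^sub>R (a - c)) \<bullet> x \<le> (a - s *\<^sub>R (a - c)) \<bullet> y" if s: "0 < s" "s \<le> 1" for s
      proof -
        \<comment> \<open>For \<open>0 < s \<le> 1\<close> this point is in the relative interior,
          even if \<open>a\<close> is not; \<open>s\<close> will tend to 0.\<close>
        let ?b = "a - s *\<^sub>R (a - c)"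
        have "?b \<in> rel_interior \<sigma>" using \<sigma> c a s by (intro rel_interior_convex_shrink)
        then have "first_meet (convex hull A) ?b = first_meet (convex hull A) c"
          using sub \<sigma> c unfolding subordinated_def by blast
        then have "x \<in> first_meet (convex hull A) ?b" using x xG by (simp add: first_meet_def)
        then have "?b \<bullet> x = support_fun (convex hull A) ?b" by (simp add: first_meet_def)
        then show ?thesis using support_fun_hull_le[OF A(1), of y ?b] y by (simp add: hull_inc)
      qed
      have "((\<lambda>s. (a - s *\<^sub>R (a - c)) \<bullet> y - (a - s *\<^sub>R (a - c)) \<bullet> x) \<longlongrightarrow>
          (a - 0 *\<^sub>R (a - c)) \<bullet> y - (a - 0 *\<^sub>R (a - c)) \<bullet> x) (at_right 0)"
        by (intro tendsto_intros)
      moreover have "\<forall>\<^sub>F s in at_right 0. 0 \<le> (a - s *\<^sub>R (a - c)) \<bullet> y - (a - s *\<^sub>R (a - c)) \<bullet> x"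
        unfolding eventually_at_right_field using le by (intro exI[of _ 1]) auto
      ultimately have "0 \<le> (a - 0 *\<^sub>R (a - c)) \<bullet> y - (a - 0 *\<^sub>R (a - c)) \<bullet> x"
        by (rule tendsto_lowerbound) simp
      then show "a \<bullet> x \<le> a \<bullet> y" by simp
    qed
  qed
  then show ?thesis using x that by blast
qed

section \<open>Combinatorics of the polytope and the fan\<close>

definition int_of_nat_vec :: "nat ^ 'n::finite \<Rightarrow> int ^ 'n" where
  "int_of_nat_vec k = (\<chi> i. int (k $ i))"

text \<open>Here \<open>A\<close> stands for the set of exponents and \<open>J\<close> for the
  coordinates restricted to units.\<close>

locale polytope_fan =
  fixes A :: "(int ^ 'n::finite) set" and J :: "'n set" and F :: "(real ^ 'n) set set"
  assumes finite_A: "finite A" and A_nonempty: "A \<noteq> {}"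
    and J_nonempty: "J \<noteq> {}"
    and A_nonneg: "\<And>m i. m \<in> A \<Longrightarrow> i \<notin> J \<Longrightarrow> 0 \<le> m $ i"
    and simple: "simple_fan F"
    and subord: "subordinated F (convex hull (real_vec ` A))"
    and supp: "\<Union>F = orthant"
    and d_nonzero: "\<And>\<sigma> S a. \<lbrakk>\<sigma> \<in> F; aff_dim \<sigma> = int CARD('n); spans_cone S \<sigma>; a \<in> S\<rbrakk>
      \<Longrightarrow> support_fun (convex hull (real_vec ` A)) (real_vec a) \<noteq> 0"
begin

abbreviation "G \<equiv> convex hull (real_vec ` A)"

definition dmin :: "int ^ 'n \<Rightarrow> int" where
  "dmin a = Min (pairing a ` A)"

definition full_cones :: "(real ^ 'n) set set" where
  "full_cones = {\<sigma> \<in> F. aff_dim \<sigma> = int CARD('n)}"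

definition gens :: "(real ^ 'n) set \<Rightarrow> (int ^ 'n) set" where
  "gens \<sigma> = (SOME S. spans_cone S \<sigma>)"

text \<open>The only generators that can occur in the valuation vector of a point whose
  \<open>J\<close>-coordinates are units.\<close>

definition active :: "(real ^ 'n) set \<Rightarrow> (int ^ 'n) set" where
  "active \<sigma> = {a \<in> gens \<sigma>. \<forall>i\<in>J. a $ i = 0}"

definition admissible :: "nat ^ 'n \<Rightarrow> bool" where
  "admissible k \<longleftrightarrow> (\<forall>i\<in>J. k $ i = 0)"

text \<open>On admissible \<open>k\<close> nothing is truncated by \<open>nat\<close>, see
  \<open>dmin_nonneg\<close>.\<close>

definition dord :: "nat ^ 'n \<Rightarrow> nat" where
  "dord k = nat (dmin (int_of_nat_vec k))"

lemma finite_F: "finite F"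
  using simple by (simp add: simple_fan_def fan_def)

lemma spans_gens: "\<sigma> \<in> F \<Longrightarrow> spans_cone (gens \<sigma>) \<sigma>"
  unfolding gens_def by (rule someI_ex) (use simple in \<open>auto simp: simple_fan_def\<close>)

lemma finite_gens: "\<sigma> \<in> F \<Longrightarrow> finite (gens \<sigma>)"
  using spans_gens spans_cone_finite by blast

lemma gens_mem_orthant: "\<sigma> \<in> F \<Longrightarrow> a \<in> gens \<sigma> \<Longrightarrow> real_vec a \<in> orthant"
  using spans_cone_mem[OF spans_gens] supp by blast

lemma gens_nonneg: "\<sigma> \<in> F \<Longrightarrow> a \<in> gens \<sigma> \<Longrightarrow> 0 \<le> a $ i"
  using gens_mem_orthant by (fastforce simp: orthant_def real_vec_def)

lemma dmin_le: "m \<in> A \<Longrightarrow> dmin a \<le> pairing a m"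
  using finite_A by (simp add: dmin_def)

lemma dmin_attained: "\<exists>m\<in>A. dmin a = pairing a m"
proof -
  have "Min (pairing a ` A) \<in> pairing a ` A" using finite_A A_nonempty by (intro Min_in) auto
  then show ?thesis by (auto simp: dmin_def)
qed

lemma support_fun_eq: "support_fun G (real_vec a) = of_int (dmin a)"
proof (rule antisym)
  obtain m where "m \<in> A" "dmin a = pairing a m" using dmin_attained by blast
  then show "support_fun G (real_vec a) \<le> of_int (dmin a)"
    using support_fun_hull_le[of "real_vec ` A" "real_vec m" "real_vec a"] finite_A
    by (simp add: inner_real_vec hull_inc)
  show "of_int (dmin a) \<le> support_fun G (real_vec a)"
    using A_nonempty dmin_le by (intro support_fun_hull_greatest) (auto simp: inner_real_vec)
qed

lemma dmin_linear:
  assumes "\<sigma> \<in> F"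
  obtains m where "m \<in> A" "\<And>a. real_vec a \<in> \<sigma> \<Longrightarrow> dmin a = pairing a m"
proof -
  have "convex \<sigma>" using spans_gens[OF assms] by (rule spans_cone_convex)
  moreover have "\<sigma> \<noteq> {}"
    using spans_gens[OF assms] convex_cone_hull_nonempty unfolding spans_cone_def by metis
  ultimately obtain x where x: "x \<in> real_vec ` A" "\<And>a. a \<in> \<sigma> \<Longrightarrow> support_fun G a = a \<bullet> x"
    using support_fun_linear_on_cone[of "real_vec ` A" F \<sigma>] finite_A A_nonempty subord assms by blast
  then obtain m where m: "m \<in> A" "x = real_vec m" by blast
  have "dmin a = pairing a m" if "real_vec a \<in> \<sigma>" for a
    using x(2)[OF that] m by (simp add: support_fun_eq inner_real_vec)
  then show ?thesis using m that by blast
qed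

lemma dmin_gens_nonzero: "\<sigma> \<in> full_cones \<Longrightarrow> a \<in> gens \<sigma> \<Longrightarrow> dmin a \<noteq> 0"
  using d_nonzero[of \<sigma> "gens \<sigma>" a] spans_gens by (auto simp: full_cones_def support_fun_eq)

text \<open>Negative exponents occur only in the coordinates of \<open>J\<close>, where
  \<open>a\<close> vanishes. For active generators the hypothesis \<open>d(a) \<noteq> 0\<close>
  then improves to \<open>d(a) > 0\<close>.\<close>

lemma dmin_nonneg:
  assumes "\<And>i. 0 \<le> a $ i" "\<And>i. i \<in> J \<Longrightarrow> a $ i = 0"
  shows "0 \<le> dmin a"
proof -
  obtain m where m: "m \<in> A" "dmin a = pairing a m" using dmin_attained by blast
  have "0 \<le> a $ i * m $ i" for i
    using assms A_nonneg[OF m(1)] by (cases "i \<in> J") auto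
  then show ?thesis unfolding m(2) pairing_def by (intro sum_nonneg) blast
qed

lemma dmin_active_pos: "\<sigma> \<in> full_cones \<Longrightarrow> a \<in> active \<sigma> \<Longrightarrow> 0 < dmin a"
  using dmin_gens_nonzero[of \<sigma> a] dmin_nonneg[of a] gens_nonneg[of \<sigma> a]
  by (auto simp: active_def full_cones_def less_le)

lemma dord_eq: "admissible k \<Longrightarrow> int (dord k) = dmin (int_of_nat_vec k)"
  using dmin_nonneg[of "int_of_nat_vec k"] by (simp add: dord_def admissible_def int_of_nat_vec_def)

lemma lattice_point_decomposition:
  obtains \<sigma> c where "\<sigma> \<in> full_cones" "int_of_nat_vec k = (\<Sum>a\<in>gens \<sigma>. int (c a) *s a)"
    "real_vec (int_of_nat_vec k) \<in> \<sigma>"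
proof -
  have "real_vec (int_of_nat_vec k) \<in> orthant"
    by (simp add: orthant_def real_vec_def int_of_nat_vec_def)
  then obtain \<sigma> where \<sigma>: "\<sigma> \<in> F" "aff_dim \<sigma> = int CARD('n)" "real_vec (int_of_nat_vec k) \<in> \<sigma>"
    using full_cones_cover[OF simple supp] by blast
  then obtain c where "int_of_nat_vec k = (\<Sum>a\<in>gens \<sigma>. int (c a) *s a)"
    using cone_lattice_point[OF spans_gens] by blast
  then show ?thesis using \<sigma> that by (auto simp: full_cones_def)
qed

text \<open>A \<open>J\<close>-coordinate of \<open>k\<close> is 0 and a sum of nonnegative terms,
  which excludes every generator that is nonzero there. The formula for \<open>dord\<close> is the
  linearity of \<open>dmin\<close> on the cone.\<close>

lemma admissible_decomposition:
  assumes k: "admissible k"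
  obtains \<sigma> c where "\<sigma> \<in> full_cones" "int_of_nat_vec k = (\<Sum>a\<in>active \<sigma>. int (c a) *s a)"
    "int (dord k) = (\<Sum>a\<in>active \<sigma>. int (c a) * dmin a)"
proof -
  obtain \<sigma> c where \<sigma>: "\<sigma> \<in> full_cones" "int_of_nat_vec k = (\<Sum>a\<in>gens \<sigma>. int (c a) *s a)"
    "real_vec (int_of_nat_vec k) \<in> \<sigma>" by (rule lattice_point_decomposition)
  have \<sigma>F: "\<sigma> \<in> F" using \<sigma> by (simp add: full_cones_def)
  have fin: "finite (gens \<sigma>)" using \<sigma>F by (rule finite_gens)
  have zero: "c a = 0" if a: "a \<in> gens \<sigma> - active \<sigma>" for a
  proof -
    obtain i where i: "i \<in> J" "a $ i \<noteq> 0" using a by (auto simp: active_def)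
    have "(\<Sum>a\<in>gens \<sigma>. int (c a) * a $ i) = int_of_nat_vec k $ i" by (simp add: \<sigma>(2))
    also have "\<dots> = 0" using i k by (simp add: int_of_nat_vec_def admissible_def)
    finally have "int (c a) * a $ i = 0"
      using fin a gens_nonneg[OF \<sigma>F] by (subst (asm) sum_nonneg_eq_0_iff) auto
    then show ?thesis using i by simp
  qed
  have eq: "int_of_nat_vec k = (\<Sum>a\<in>active \<sigma>. int (c a) *s a)"
    unfolding \<sigma>(2) using fin zero by (intro sum.mono_neutral_right) (auto simp: active_def)
  obtain m where m: "m \<in> A" "\<And>a. real_vec a \<in> \<sigma> \<Longrightarrow> dmin a = pairing a m"
    using dmin_linear[OF \<sigma>F] by blast
  have "int (dord k) = pairing (int_of_nat_vec k) m" using m(2)[OF \<sigma>(3)] dord_eq[OF k] by simp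
  also have "\<dots> = (\<Sum>a\<in>active \<sigma>. int (c a) * pairing a m)"
    unfolding eq by (rule pairing_sum_scale)
  also have "\<dots> = (\<Sum>a\<in>active \<sigma>. int (c a) * dmin a)"
    using m(2) spans_cone_mem[OF spans_gens[OF \<sigma>F]] by (intro sum.cong) (auto simp: active_def)
  finally show ?thesis using that \<sigma>(1) eq by blast
qed

lemma finite_ratios: "finite (fan_ratios F G)"
proof -
  have "fan_ratios F G \<subseteq> (\<lambda>a. of_int (weight a) / (- support_fun G (real_vec a))) ` fan_edges F"
    by (auto simp: fan_ratios_def)
  then show ?thesis using finite_fan_edges[OF finite_F] by (meson finite_imageI finite_subset)
qed

lemma weight_ge:
  assumes \<sigma>: "\<sigma> \<in> F" and a: "a \<in> gens \<sigma>" and d: "0 < dmin a"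
  shows "- fan_beta F G * of_int (dmin a) \<le> of_int (weight a)"
proof -
  have "a \<in> fan_edges F" using spans_gens[OF \<sigma>] \<sigma> a by (auto simp: fan_edges_def)
  then have "of_int (weight a) / (- of_int (dmin a)) \<in> fan_ratios F G"
    using d unfolding fan_ratios_def by (auto simp: support_fun_eq intro!: exI[of _ a])
  then have "of_int (weight a) / (- of_int (dmin a)) \<le> fan_beta F G"
    unfolding fan_beta_def using finite_ratios by (intro Max_ge) auto
  then show ?thesis using d by (simp add: field_simps)
qed

text \<open>Generators are nonzero vectors of the orthant and have positive weight. Negativity of
  \<open>\<beta>\<close> makes the series over the levels converge.\<close>

lemma beta_neg: "fan_beta F G < 0"
proof -
  have "x < 0" if "x \<in> fan_ratios F G" for x
  proof -
    obtain a where a: "x = of_int (weight a) / (- support_fun G (real_vec a))" "a \<in> fan_edges F"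
      "0 < support_fun G (real_vec a)" using \<open>x \<in> fan_ratios F G\<close> by (auto simp: fan_ratios_def)
    then obtain S \<sigma> where S: "\<sigma> \<in> F" "spans_cone S \<sigma>" "a \<in> S" by (auto simp: fan_edges_def)
    then have "real_vec a \<in> orthant" using spans_cone_mem supp by blast
    then have nn: "0 \<le> a $ i" for i by (simp add: orthant_def real_vec_def)
    have "a \<noteq> 0" using S spans_cone_nonzero by blast
    then obtain i where "a $ i \<noteq> 0" by (auto simp: vec_eq_iff)
    then have "0 < weight a" unfolding weight_def using nn
      by (intro sum_pos2[of UNIV i]) (auto simp: less_le)
    then show ?thesis using a by (simp add: divide_neg_pos)
  qed
  then show ?thesis unfolding fan_beta_def using finite_ratios by (subst Max_less_iff) auto
qed

text \<open>By the choice of \<open>\<beta>\<close> as a maximum,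
  \<open>\<parallel>a\<parallel> \<ge> -\<beta> d(a)\<close> for each active generator, and on a
  cone both sides are linear in the coefficients of \<open>k\<close>.\<close>

lemma weight_lower_bound:
  assumes k: "admissible k"
  shows "- fan_beta F G * real (dord k) \<le> real (\<Sum>i\<in>UNIV. k $ i)"
proof -
  obtain \<sigma> c where \<sigma>: "\<sigma> \<in> full_cones" "int_of_nat_vec k = (\<Sum>a\<in>active \<sigma>. int (c a) *s a)"
    "int (dord k) = (\<Sum>a\<in>active \<sigma>. int (c a) * dmin a)" using admissible_decomposition[OF k] .
  have \<sigma>F: "\<sigma> \<in> F" using \<sigma> by (simp add: full_cones_def)
  have "real (dord k) = of_int (\<Sum>a\<in>active \<sigma>. int (c a) * dmin a)" by (simp flip: \<sigma>(3))
  then have "- fan_beta F G * real (dord k) = (\<Sum>a\<in>active \<sigma>. real (c a) * (- fan_beta F G * of_int (dmin a)))"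
    by (simp add: sum_distrib_left mult_ac)
  also have "\<dots> \<le> (\<Sum>a\<in>active \<sigma>. real (c a) * of_int (weight a))"
    using weight_ge[OF \<sigma>F] dmin_active_pos[OF \<sigma>(1)]
    by (intro sum_mono mult_left_mono) (auto simp: active_def)
  also have "\<dots> = of_int (weight (int_of_nat_vec k))"
    unfolding \<sigma>(2) weight_sum_scale by simp
  also have "weight (int_of_nat_vec k) = int (\<Sum>i\<in>UNIV. k $ i)"
    by (simp add: weight_def int_of_nat_vec_def)
  finally show ?thesis by simp
qed

text \<open>Active generators lie in the hyperplane \<open>x_i = 0\<close> for any \<open>i\<close>
  in \<open>J\<close>, so adding the \<open>i\<close>-th axis vector keeps them independent. This is
  where the exponent \<open>n-1\<close> arises.\<close>

lemma card_active_less: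
  assumes \<sigma>: "\<sigma> \<in> full_cones"
  shows "finite (active \<sigma>)" "card (active \<sigma>) < CARD('n)"
proof -
  have \<sigma>F: "\<sigma> \<in> F" using \<sigma> by (simp add: full_cones_def)
  show fin: "finite (active \<sigma>)" using finite_gens[OF \<sigma>F] by (simp add: active_def)
  obtain i where i: "i \<in> J" using J_nonempty by blast
  have "independent (real_vec ` active \<sigma>)"
    by (rule independent_mono[OF spans_cone_independent[OF spans_gens[OF \<sigma>F]]]) (auto simp: active_def)
  moreover have "span (real_vec ` active \<sigma>) \<subseteq> {x. axis i 1 \<bullet> x = 0}"
    using i by (intro span_minimal subspace_hyperplane) (auto simp: active_def real_vec_def inner_axis')
  then have nsp: "(axis i 1 :: real ^ 'n) \<notin> span (real_vec ` active \<sigma>)"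
    by (auto simp: inner_axis_axis)
  ultimately have ind: "independent (insert (axis i 1) (real_vec ` active \<sigma>))"
    by (rule independent_insertI[rotated])
  have "(axis i 1 :: real ^ 'n) \<notin> real_vec ` active \<sigma>"
    by (rule contra_subsetD[OF span_superset nsp])
  then have "card (insert (axis i 1) (real_vec ` active \<sigma>)) = Suc (card (real_vec ` active \<sigma>))"
    using fin by simp
  also have "card (real_vec ` active \<sigma>) = card (active \<sigma>)"
    by (rule card_image) (rule inj_on_subset[OF inj_real_vec subset_UNIV])
  finally show "card (active \<sigma>) < CARD('n)" using independent_bound[OF ind] by simp
qed

text \<open>Since \<open>dmin a \<ge> 1\<close> on active generators, \<open>dord k = t\<close>
  forces every coefficient to be at most \<open>t\<close>; this leaves at most
  \<open>(t + 1) ^ (n - 1)\<close> coefficient tuples per cone.\<close>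

lemma card_level_set:
  shows "finite {k. admissible k \<and> dord k = t}"
    and "card {k. admissible k \<and> dord k = t} \<le> card F * (t + 1) ^ (CARD('n) - 1)"
proof -
  let ?L = "{k. admissible k \<and> dord k = t}"
  let ?P = "\<lambda>\<sigma>. (\<lambda>c. \<Sum>a\<in>active \<sigma>. int (c a) *s a) ` (PiE (active \<sigma>) (\<lambda>_. {0..t}))"
  have finP: "finite (?P \<sigma>)" if "\<sigma> \<in> full_cones" for \<sigma>
    using card_active_less[OF that] by (intro finite_imageI finite_PiE) auto
  have finC: "finite full_cones" using finite_F by (simp add: full_cones_def)
  have sub: "int_of_nat_vec ` ?L \<subseteq> (\<Union>\<sigma>\<in>full_cones. ?P \<sigma>)"
  proof
    fix v assume "v \<in> int_of_nat_vec ` ?L"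
    then obtain k where k: "admissible k" "dord k = t" "v = int_of_nat_vec k" by blast
    obtain \<sigma> c where \<sigma>: "\<sigma> \<in> full_cones" "int_of_nat_vec k = (\<Sum>a\<in>active \<sigma>. int (c a) *s a)"
      "int (dord k) = (\<Sum>a\<in>active \<sigma>. int (c a) * dmin a)" using admissible_decomposition[OF k(1)] .
    have "c a \<le> t" if a: "a \<in> active \<sigma>" for a
    proof -
      have pos: "0 < dmin b" if "b \<in> active \<sigma>" for b using dmin_active_pos[OF \<sigma>(1) that] .
      have "int (c a) * 1 \<le> int (c a) * dmin a" using pos[OF a] by (intro mult_left_mono) auto
      also have "\<dots> \<le> (\<Sum>a\<in>active \<sigma>. int (c a) * dmin a)"
        using a card_active_less(1)[OF \<sigma>(1)]
        by (intro member_le_sum) (simp_all add: pos less_imp_le)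
      finally show ?thesis using \<sigma>(3) k(2) by simp
    qed
    then have "restrict c (active \<sigma>) \<in> PiE (active \<sigma>) (\<lambda>_. {0..t})" by auto
    moreover have "v = (\<Sum>a\<in>active \<sigma>. int (restrict c (active \<sigma>) a) *s a)"
      using \<sigma>(2) k(3) by simp
    ultimately show "v \<in> (\<Union>\<sigma>\<in>full_cones. ?P \<sigma>)" using \<sigma>(1) by blast
  qed
  have finU: "finite (\<Union>\<sigma>\<in>full_cones. ?P \<sigma>)" using finC finP by blast
  have inj: "inj_on int_of_nat_vec ?L"
    by (rule inj_onI) (simp add: int_of_nat_vec_def vec_eq_iff)
  show "finite ?L" using finite_imageD[OF finite_subset[OF sub finU] inj] .
  have "card ?L = card (int_of_nat_vec ` ?L)" using inj by (simp add: card_image)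
  also have "\<dots> \<le> card (\<Union>\<sigma>\<in>full_cones. ?P \<sigma>)" using finU sub by (rule card_mono)
  also have "\<dots> \<le> (\<Sum>\<sigma>\<in>full_cones. card (?P \<sigma>))" using finC by (rule card_UN_le)
  also have "\<dots> \<le> (\<Sum>\<sigma>\<in>full_cones. (t + 1) ^ (CARD('n) - 1))"
  proof (rule sum_mono)
    fix \<sigma> assume \<sigma>: "\<sigma> \<in> full_cones"
    have "card (?P \<sigma>) \<le> card (PiE (active \<sigma>) (\<lambda>_. {0..t}))"
      using card_active_less[OF \<sigma>] by (intro card_image_le finite_PiE) auto
    also have "\<dots> = (t + 1) ^ card (active \<sigma>)" using card_active_less[OF \<sigma>] by (simp add: card_PiE)
    also have "\<dots> \<le> (t + 1) ^ (CARD('n) - 1)"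
      using card_active_less[OF \<sigma>] by (intro power_increasing) auto
    finally show "card (?P \<sigma>) \<le> (t + 1) ^ (CARD('n) - 1)" .
  qed
  also have "\<dots> = card full_cones * (t + 1) ^ (CARD('n) - 1)" by simp
  also have "\<dots> \<le> card F * (t + 1) ^ (CARD('n) - 1)"
    using finite_F by (intro mult_right_mono card_mono) (auto simp: full_cones_def)
  finally show "card ?L \<le> card F * (t + 1) ^ (CARD('n) - 1)" .
qed

end

section \<open>Laurent monomials and logarithmic derivatives\<close>

definition laurent_mon :: "'k::field ^ 'n::finite \<Rightarrow> int ^ 'n \<Rightarrow> 'k" where
  "laurent_mon x m = (\<Prod>i\<in>UNIV. (x $ i) powi (m $ i))"

text \<open>The Euler operator \<open>x_i \<partial>_i\<close>. It keeps the exponents, so under a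
  monomial substitution all components scale by the same power of \<open>\<pi>\<close>.\<close>

definition log_deriv :: "('k::field, 'n::finite) laurent \<Rightarrow> 'n \<Rightarrow> 'k ^ 'n \<Rightarrow> 'k" where
  "log_deriv f i x = (\<Sum>m\<in>Poly_Mapping.keys f. Poly_Mapping.lookup f m * of_int (m $ i) * laurent_mon x m)"

lemma laurent_eval_mon:
  "laurent_eval f x = (\<Sum>m\<in>Poly_Mapping.keys f. Poly_Mapping.lookup f m * laurent_mon x m)"
  by (simp add: laurent_eval_def laurent_mon_def)

lemma torus_iff: "x \<in> torus \<longleftrightarrow> (\<forall>i. x $ i \<noteq> 0)"
  by (simp add: torus_def)

lemma laurent_mon_add: "x \<in> torus \<Longrightarrow> laurent_mon x (m + m') = laurent_mon x m * laurent_mon x m'"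
  by (simp add: laurent_mon_def torus_iff power_int_add prod.distrib)

lemma laurent_mon_axis: "laurent_mon x (axis i 1) = x $ i"
proof -
  have "laurent_mon x (axis i 1) = (\<Prod>j\<in>UNIV. if j = i then x $ i else 1)"
    unfolding laurent_mon_def by (intro prod.cong) (auto simp: axis_def)
  then show ?thesis by simp
qed

lemma laurent_eval_superset:
  assumes "finite B" "Poly_Mapping.keys f \<subseteq> B"
  shows "laurent_eval f x = (\<Sum>m\<in>B. Poly_Mapping.lookup f m * laurent_mon x m)"
  unfolding laurent_eval_mon using assms
  by (intro sum.mono_neutral_left) (auto simp: in_keys_iff)

lemma laurent_eval_add: "laurent_eval (f + g) x = laurent_eval f x + laurent_eval g x"
proof -
  let ?B = "Poly_Mapping.keys f \<union> Poly_Mapping.keys g"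
  have "laurent_eval h x = (\<Sum>m\<in>?B. Poly_Mapping.lookup h m * laurent_mon x m)"
    if "h \<in> {f, g, f + g}" for h
    using that keys_add[of f g] by (intro laurent_eval_superset) auto
  then show ?thesis by (simp add: lookup_add distrib_right sum.distrib)
qed

lemma laurent_eval_single: "laurent_eval (Poly_Mapping.single m c) x = c * laurent_mon x m"
  by (simp add: laurent_eval_mon)

lemma laurent_eval_sum_single:
  assumes "finite A"
  shows "laurent_eval (\<Sum>m\<in>A. Poly_Mapping.single (g m) (c m)) x = (\<Sum>m\<in>A. c m * laurent_mon x (g m))"
  using assms
proof (induction A rule: finite_induct)
  case empty
  then show ?case by (simp add: laurent_eval_mon)
qed (simp add: laurent_eval_add laurent_eval_single)

lemma log_deriv_eq:
  assumes x: "x \<in> torus"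
  shows "log_deriv f i x = x $ i * laurent_eval (laurent_pderiv i f) x"
proof -
  have mon: "laurent_mon x m = x $ i * laurent_mon x (m - axis i 1)" for m
    using laurent_mon_add[OF x, of "axis i 1" "m - axis i 1"] by (simp add: laurent_mon_axis)
  have "log_deriv f i x = (\<Sum>m\<in>Poly_Mapping.keys f.
      x $ i * (of_int (m $ i) * Poly_Mapping.lookup f m * laurent_mon x (m - axis i 1)))"
    unfolding log_deriv_def
  proof (rule sum.cong[OF refl])
    fix m
    show "Poly_Mapping.lookup f m * of_int (m $ i) * laurent_mon x m =
        x $ i * (of_int (m $ i) * Poly_Mapping.lookup f m * laurent_mon x (m - axis i 1))"
      by (subst mon) (simp add: mult_ac)
  qed
  then show ?thesis
    by (simp add: laurent_pderiv_def laurent_eval_sum_single sum_distrib_left)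
qed

text \<open>If all exponents lie on one level of \<open>a\<close>, then \<open>f\<close> is
  quasi-homogeneous of degree \<open>d\<close> for the weights \<open>a\<close>.\<close>

lemma euler_identity:
  fixes f :: "('k::field, 'n::finite) laurent"
  assumes "\<And>m. m \<in> Poly_Mapping.keys f \<Longrightarrow> pairing a m = d"
  shows "(\<Sum>i\<in>UNIV. of_int (a $ i) * log_deriv f i x) = of_int d * laurent_eval f x"
proof -
  have "(\<Sum>i\<in>UNIV. of_int (a $ i) * log_deriv f i x) =
      (\<Sum>m\<in>Poly_Mapping.keys f. \<Sum>i\<in>UNIV. of_int (a $ i * m $ i) * (Poly_Mapping.lookup f m * laurent_mon x m))"
    unfolding log_deriv_def sum_distrib_left by (subst sum.swap) (simp add: mult_ac)
  also have "\<dots> = (\<Sum>m\<in>Poly_Mapping.keys f. of_int (pairing a m) * (Poly_Mapping.lookup f m * laurent_mon x m))"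
    by (simp only: pairing_def of_int_sum sum_distrib_right)
  also have "\<dots> = of_int d * laurent_eval f x"
    using assms by (simp add: laurent_eval_mon sum_distrib_left)
  finally show ?thesis .
qed

lemma lookup_face_function:
  "Poly_Mapping.lookup (face_function f a) m =
    (if m \<in> Poly_Mapping.keys f \<and> real_vec m \<in> first_meet (newton_polytope f) a
     then Poly_Mapping.lookup f m else 0)"
  by (simp add: face_function_def lookup_sum lookup_single when_def sum.delta)

lemma keys_face_function:
  "Poly_Mapping.keys (face_function f a) =
    {m \<in> Poly_Mapping.keys f. real_vec m \<in> first_meet (newton_polytope f) a}"
  by (auto simp: in_keys_iff lookup_face_function split: if_splits)

lemma power_int_sum:
  fixes x :: "'a::field"
  assumes "x \<noteq> 0" and n: "(\<Sum>a\<in>A. g a) = n"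
  shows "(\<Prod>a\<in>A. x powi g a) = x powi n"
  unfolding n[symmetric] using assms(1)
  by (induction A rule: infinite_finite_induct) (simp_all add: power_int_add)

lemma prod_power_int: "(\<Prod>a\<in>A. g a) powi n = (\<Prod>a\<in>A. g a powi n)"
  for g :: "'b \<Rightarrow> 'a::field"
  by (induction A rule: infinite_finite_induct) (simp_all add: power_int_mult_distrib)

text \<open>Tychonoff's theorem; it allows the parameters to be total functions, although the index
  type of \<open>t\<close> is infinite.\<close>

lemma compact_fun_box:
  fixes C :: "'b::topological_space set"
  assumes "compact C"
  shows "compact {g :: 'a \<Rightarrow> 'b. \<forall>a. g a \<in> C}"
proof -
  have "compactin (product_topology (\<lambda>_. euclidean) UNIV) (PiE (UNIV :: 'a set) (\<lambda>_. C))"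
    using assms by (simp add: compactin_PiE)
  moreover have "PiE (UNIV :: 'a set) (\<lambda>_. C) = {g. \<forall>a. g a \<in> C}" by (auto simp: PiE_def)
  ultimately show ?thesis by (simp add: euclidean_product_topology)
qed

section \<open>A lower bound for the logarithmic gradient\<close>

locale nondegenerate_sum =
  padic_uniformizer p \<iota> \<pi> + polytope_fan "Poly_Mapping.keys f" J F
  for p :: nat and \<iota> :: "'q::nonarch_field \<Rightarrow> 'k::nonarch_field" and \<pi> :: 'k
    and f :: "('k, 'n::finite) laurent" and J :: "'n set" and F :: "(real ^ 'n) set set" +
  assumes nondeg: "weakly_nondegenerate f"
    and crit: "{x \<in> torus. \<forall>i. laurent_eval (laurent_pderiv i f) x = 0} = {}"
begin

abbreviation "keysf \<equiv> Poly_Mapping.keys f"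
abbreviation "coef \<equiv> Poly_Mapping.lookup f"

text \<open>The \<open>G_i\<close> of the overview. In use, \<open>m0\<close> is an exponent that is
  minimal for all generators in \<open>S\<close> at once, so the differences under
  \<open>nat\<close> are nonnegative.\<close>

definition reduced_deriv :: "(int ^ 'n) set \<Rightarrow> int ^ 'n \<Rightarrow> 'n \<Rightarrow> (int ^ 'n \<Rightarrow> 'k) \<Rightarrow> ('n \<Rightarrow> 'k) \<Rightarrow> 'k" where
  "reduced_deriv S m0 i t y = (\<Sum>m\<in>keysf. coef m * of_int (m $ i) *
     (\<Prod>a\<in>S. t a ^ nat (pairing a m - pairing a m0)) * (\<Prod>j\<in>UNIV. y j powi (m $ j)))"

lemma reduced_deriv_nonzero:
  assumes \<sigma>: "\<sigma> \<in> full_cones" and m0: "m0 \<in> keysf" "\<And>a. a \<in> gens \<sigma> \<Longrightarrow> dmin a = pairing a m0"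
    and y: "\<And>j. y j \<noteq> 0"
  shows "\<exists>i. reduced_deriv (gens \<sigma>) m0 i t y \<noteq> 0"
proof -
  let ?S = "gens \<sigma>"
  have \<sigma>F: "\<sigma> \<in> F" using \<sigma> by (simp add: full_cones_def)
  have finS: "finite ?S" using \<sigma>F by (rule finite_gens)
  define Z where "Z = {a \<in> ?S. t a = 0}"
  have finZ: "finite Z" using finS by (simp add: Z_def)
  \<comment> \<open>Vanishing parameters are replaced by 1 to obtain a point \<open>x\<close> of the
    torus. Their vanishing is recorded by \<open>\<Phi>\<close> instead.\<close>
  define s where "s a = (if a \<in> Z then 1 else t a)" for a
  have s0: "s a \<noteq> 0" if "a \<in> ?S" for a using that by (auto simp: s_def Z_def)
  \<comment> \<open>The exponents whose terms survive \<open>t a = 0\<close> for all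
    \<open>a\<close> in \<open>Z\<close>: those minimal for each such \<open>a\<close>.\<close>
  define \<Phi> where "\<Phi> = {m \<in> keysf. \<forall>a\<in>Z. pairing a m = pairing a m0}"
  have ge: "pairing a m0 \<le> pairing a m" if "a \<in> ?S" "m \<in> keysf" for a m
    using dmin_le[OF that(2), of a] m0(2)[OF that(1)] by simp
  define x where "x = (\<chi> j. y j * (\<Prod>a\<in>?S. s a powi (a $ j)))"
  have x: "x \<in> torus" using y s0 finS by (auto simp: torus_iff x_def)
  \<comment> \<open>Undoes the normalisation by \<open>m0\<close>, so that surviving terms become
    values of monomials at \<open>x\<close>.\<close>
  define \<kappa> where "\<kappa> = (\<Prod>a\<in>?S. s a powi pairing a m0)"
  have \<kappa>: "\<kappa> \<noteq> 0" using s0 finS by (auto simp: \<kappa>_def)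
  have zero: "(\<Prod>a\<in>?S. t a ^ nat (pairing a m - pairing a m0)) = 0" if m: "m \<in> keysf" "m \<notin> \<Phi>" for m
  proof -
    obtain a where a: "a \<in> Z" "pairing a m \<noteq> pairing a m0" using m by (auto simp: \<Phi>_def)
    then have "a \<in> ?S" "t a = 0" by (auto simp: Z_def)
    moreover have "nat (pairing a m - pairing a m0) \<noteq> 0" using ge[OF \<open>a \<in> ?S\<close> m(1)] a by simp
    ultimately have "t a ^ nat (pairing a m - pairing a m0) = 0" by (simp add: power_0_left)
    then show ?thesis using finS \<open>a \<in> ?S\<close> by (meson prod_zero)
  qed
  have mon: "\<kappa> * ((\<Prod>a\<in>?S. t a ^ nat (pairing a m - pairing a m0)) * (\<Prod>j\<in>UNIV. y j powi (m $ j)))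
      = laurent_mon x m" if m: "m \<in> \<Phi>" for m
  proof -
    have "s a powi pairing a m0 * t a ^ nat (pairing a m - pairing a m0) = s a powi pairing a m" if a: "a \<in> ?S" for a
    proof (cases "a \<in> Z")
      case True
      then show ?thesis using m by (auto simp: \<Phi>_def s_def)
    next
      case False
      then have "t a ^ nat (pairing a m - pairing a m0) = s a powi (pairing a m - pairing a m0)"
        using ge[OF a] m by (simp add: s_def power_int_nonneg_exp \<Phi>_def)
      then show ?thesis using s0[OF a] by (simp flip: power_int_add)
    qed
    then have "\<kappa> * (\<Prod>a\<in>?S. t a ^ nat (pairing a m - pairing a m0)) = (\<Prod>a\<in>?S. s a powi pairing a m)"
      unfolding \<kappa>_def prod.distrib[symmetric] by (intro prod.cong) auto
    also have "\<dots> = (\<Prod>a\<in>?S. \<Prod>j\<in>UNIV. (s a powi (a $ j)) powi (m $ j))"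
    proof (rule prod.cong[OF refl])
      fix a assume a: "a \<in> ?S"
      show "s a powi pairing a m = (\<Prod>j\<in>UNIV. (s a powi (a $ j)) powi (m $ j))"
        unfolding power_int_mult[symmetric] by (rule power_int_sum[symmetric]) (use s0[OF a] in \<open>simp_all add: pairing_def\<close>)
    qed
    also have "\<dots> = (\<Prod>j\<in>UNIV. \<Prod>a\<in>?S. (s a powi (a $ j)) powi (m $ j))" by (rule prod.swap)
    finally show ?thesis
      by (simp add: laurent_mon_def x_def power_int_mult_distrib prod.distrib prod_power_int mult_ac)
  qed
  have red: "\<kappa> * reduced_deriv ?S m0 i t y = (\<Sum>m\<in>\<Phi>. coef m * of_int (m $ i) * laurent_mon x m)" for i
  proof -
    have "\<kappa> * reduced_deriv ?S m0 i t y = (\<Sum>m\<in>keysf. \<kappa> * (coef m * of_int (m $ i) *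
     (\<Prod>a\<in>?S. t a ^ nat (pairing a m - pairing a m0)) * (\<Prod>j\<in>UNIV. y j powi (m $ j))))"
      by (simp add: reduced_deriv_def sum_distrib_left)
    also have "\<dots> = (\<Sum>m\<in>\<Phi>. \<kappa> * (coef m * of_int (m $ i) *
     (\<Prod>a\<in>?S. t a ^ nat (pairing a m - pairing a m0)) * (\<Prod>j\<in>UNIV. y j powi (m $ j))))"
      using zero by (intro sum.mono_neutral_right) (auto simp: \<Phi>_def)
    also have "\<dots> = (\<Sum>m\<in>\<Phi>. coef m * of_int (m $ i) * laurent_mon x m)"
      by (rule sum.cong[OF refl]) (simp add: mon[symmetric] mult_ac)
    finally show ?thesis .
  qed
  have "\<exists>i. (\<Sum>m\<in>\<Phi>. coef m * of_int (m $ i) * laurent_mon x m) \<noteq> 0"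
  proof (cases "Z = {}")
    case True
    then have "\<Phi> = keysf" by (simp add: \<Phi>_def)
    moreover obtain i where "laurent_eval (laurent_pderiv i f) x \<noteq> 0" using crit x by blast
    then have "log_deriv f i x \<noteq> 0" using x by (simp add: log_deriv_eq torus_iff)
    ultimately show ?thesis by (auto simp: log_deriv_def)
  next
    case False
    then obtain a0 where a0: "a0 \<in> Z" by blast
    \<comment> \<open>The exponents minimal for the sum of the generators in \<open>Z\<close> are
      those minimal for each of them, so \<open>\<Phi>\<close> is the support of the face function
      of \<open>b\<close>.\<close>
    define b where "b = (\<Sum>a\<in>Z. 1 *s a)"
    let ?g = "face_function f (real_vec b)"
    have pb: "pairing b m = (\<Sum>a\<in>Z. pairing a m)" for m
      unfolding b_def pairing_sum_scale by simp
    have ZS: "a \<in> ?S" if "a \<in> Z" for a using that by (simp add: Z_def)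
    have "dmin b = pairing b m0"
    proof (rule antisym)
      show "dmin b \<le> pairing b m0" using m0(1) by (rule dmin_le)
      obtain m where "m \<in> keysf" "dmin b = pairing b m" using dmin_attained by blast
      then show "pairing b m0 \<le> dmin b" unfolding pb using ge ZS by (auto simp: pb intro!: sum_mono)
    qed
    then have "real_vec m \<in> first_meet (newton_polytope f) (real_vec b) \<longleftrightarrow> pairing b m = pairing b m0"
      if "m \<in> keysf" for m
      using that by (auto simp: first_meet_def newton_polytope_def support_fun_eq inner_real_vec hull_inc)
    moreover have "pairing b m = pairing b m0 \<longleftrightarrow> (\<forall>a\<in>Z. pairing a m = pairing a m0)" if "m \<in> keysf" for m
    proof -
      have "pairing b m = pairing b m0 \<longleftrightarrow> (\<Sum>a\<in>Z. pairing a m - pairing a m0) = 0"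
        by (simp add: pb sum_subtractf)
      also have "\<dots> \<longleftrightarrow> (\<forall>a\<in>Z. pairing a m - pairing a m0 = 0)"
        using finZ ge ZS that by (intro sum_nonneg_eq_0_iff) auto
      finally show ?thesis by simp
    qed
    ultimately have keys: "Poly_Mapping.keys ?g = \<Phi>"
      unfolding keys_face_function \<Phi>_def by blast
    have lk: "Poly_Mapping.lookup ?g m = coef m" if "m \<in> \<Phi>" for m
      using that unfolding keys[symmetric] keys_face_function lookup_face_function by simp
    have ld: "log_deriv ?g i x = (\<Sum>m\<in>\<Phi>. coef m * of_int (m $ i) * laurent_mon x m)" for i
      unfolding log_deriv_def keys using lk by (intro sum.cong) auto
    have "\<exists>i. log_deriv ?g i x \<noteq> 0"
    proof (rule ccontr)
      assume "\<not> ?thesis"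
      then have z: "log_deriv ?g i x = 0" for i by simp
      \<comment> \<open>Euler's identity is applied to \<open>a0\<close> rather than
        \<open>b\<close>: the numbers \<open>d(a)\<close> may have different signs and cancel in the
        sum, whereas \<open>d(a0)\<close> is nonzero.\<close>
      have "of_int (pairing a0 m0) * laurent_eval ?g x = 0"
        using euler_identity[of ?g a0 "pairing a0 m0" x] keys a0 z by (simp add: \<Phi>_def)
      moreover have "pairing a0 m0 \<noteq> 0"
        using dmin_gens_nonzero[OF \<sigma> ZS[OF a0]] m0(2)[OF ZS[OF a0]] by simp
      ultimately have "laurent_eval ?g x = 0" by simp
      moreover have "laurent_eval (laurent_pderiv i ?g) x = 0" for i
        using z[of i] x by (simp add: log_deriv_eq torus_iff)
      moreover have "0 \<le> b $ i" for i
        using gens_nonneg[OF \<sigma>F ZS] by (auto simp: b_def intro!: sum_nonneg)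
      then have "real_vec b \<in> orthant" by (simp add: orthant_def real_vec_def)
      ultimately show False using nondeg x unfolding weakly_nondegenerate_def by blast
    qed
    then show ?thesis by (simp add: ld)
  qed
  then obtain i where "\<kappa> * reduced_deriv ?S m0 i t y \<noteq> 0" unfolding red[symmetric] by blast
  then show ?thesis by (intro exI[of _ i]) auto
qed

text \<open>The sum of the absolute values over \<open>i\<close> is continuous and positive on a
  compact set, so it has a positive minimum; some summand is at least the \<open>n\<close>-th part
  of it.\<close>

lemma reduced_deriv_bound:
  assumes \<sigma>: "\<sigma> \<in> full_cones" and m0: "m0 \<in> keysf" "\<And>a. a \<in> gens \<sigma> \<Longrightarrow> dmin a = pairing a m0"
  obtains \<epsilon> where "0 < \<epsilon>"
    "\<And>t y. (\<And>a. absval (t a) \<le> 1) \<Longrightarrow> (\<And>j. absval (y j) = 1) \<Longrightarrow>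
      \<exists>i. \<epsilon> \<le> absval (reduced_deriv (gens \<sigma>) m0 i t y)"
proof -
  let ?S = "gens \<sigma>"
  define P where "P = {t :: int ^ 'n \<Rightarrow> 'k. \<forall>a. t a \<in> {z. absval z \<le> 1}} \<times>
    {y :: 'n \<Rightarrow> 'k. \<forall>j. y j \<in> {z. absval z \<le> 1} \<inter> {z. absval z = 1}}"
  define H where "H = (\<lambda>(t, y). \<Sum>i\<in>UNIV. absval (reduced_deriv ?S m0 i t y))"
  have "closed {z :: 'k. absval z = 1}" by (intro closed_Collect_eq continuous_intros)
  then have "compact ({z :: 'k. absval z \<le> 1} \<inter> {z. absval z = 1})"
    using compact_ext_ball by (intro compact_Int_closed)
  then have "compact P"
    unfolding P_def by (intro compact_Times compact_fun_box compact_ext_ball)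
  moreover have "((\<lambda>_. 0), (\<lambda>_. 1)) \<in> P" by (simp add: P_def)
  then have "P \<noteq> {}" by blast
  moreover have "continuous_on P H"
  proof -
    have f: "continuous_on P (\<lambda>z. fst z a)" for a
      by (rule continuous_on_product_then_coordinatewise) (intro continuous_intros)
    have g: "continuous_on P (\<lambda>z. snd z j)" for j
      by (rule continuous_on_product_then_coordinatewise) (intro continuous_intros)
    have g': "continuous_on P (\<lambda>z. snd z j powi n)" for j n
      using g by (rule continuous_on_unit_power_int) (auto simp: P_def)
    show ?thesis unfolding H_def case_prod_unfold reduced_deriv_def
      by (intro continuous_intros f g')
  qed
  ultimately obtain z where z: "z \<in> P" "\<And>w. w \<in> P \<Longrightarrow> H z \<le> H w"
    using continuous_attains_inf[of P H] by blast
  obtain t0 y0 where z0: "z = (t0, y0)" by (cases z)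
  have "y0 j \<noteq> 0" for j using z(1) z0 by (auto simp: P_def dest: spec[of _ j])
  then obtain i where "reduced_deriv ?S m0 i t0 y0 \<noteq> 0"
    using reduced_deriv_nonzero[OF \<sigma> m0] by blast
  then have pos: "0 < H z" unfolding z0 H_def prod.case
    by (intro sum_pos2[of UNIV i]) (auto simp: absval_pos absval_nonneg)
  have "\<exists>i. H z / real CARD('n) \<le> absval (reduced_deriv ?S m0 i t y)"
    if "\<And>a. absval (t a) \<le> 1" "\<And>j. absval (y j) = 1" for t y
  proof (rule ccontr)
    assume "\<not> ?thesis"
    then have "(\<Sum>i\<in>(UNIV :: 'n set). absval (reduced_deriv ?S m0 i t y)) < (\<Sum>i\<in>(UNIV :: 'n set). H z / real CARD('n))"
      by (intro sum_strict_mono) (auto simp: not_le)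
    then have "H (t, y) < H z" by (simp add: H_def)
    moreover have "(t, y) \<in> P" using that by (simp add: P_def)
    ultimately show False using z(2) by force
  qed
  then show ?thesis using pos by (intro that[of "H z / real CARD('n)"]) auto
qed

text \<open>The pairing with \<open>k\<close> is linear in the coefficients \<open>c a\<close>.
  Hence each monomial equals the common power of \<open>\<pi>\<close> belonging to
  \<open>m0\<close>, times powers of \<open>\<pi> ^ c a\<close> with nonnegative exponents, times a
  monomial in \<open>y\<close>.\<close>

lemma log_deriv_scaling:
  assumes k: "int_of_nat_vec k = (\<Sum>a\<in>S. int (c a) *s a)" and S: "finite S"
    and ge: "\<And>a m. a \<in> S \<Longrightarrow> m \<in> keysf \<Longrightarrow> pairing a m0 \<le> pairing a m"
    and x: "\<And>j. x $ j = \<pi> ^ (k $ j) * y j"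
  shows "log_deriv f i x = \<pi> powi (pairing (int_of_nat_vec k) m0) * reduced_deriv S m0 i (\<lambda>a. \<pi> ^ c a) y"
proof -
  have "laurent_mon x m = \<pi> powi (pairing (int_of_nat_vec k) m0) *
      ((\<Prod>a\<in>S. (\<pi> ^ c a) ^ nat (pairing a m - pairing a m0)) * (\<Prod>j\<in>UNIV. y j powi (m $ j)))"
    if m: "m \<in> keysf" for m
  proof -
    have "(\<Prod>j\<in>UNIV. \<pi> powi (int (k $ j) * m $ j)) = \<pi> powi pairing (int_of_nat_vec k) m"
      by (rule power_int_sum) (simp_all add: pairing_def int_of_nat_vec_def)
    then have "laurent_mon x m = \<pi> powi pairing (int_of_nat_vec k) m * (\<Prod>j\<in>UNIV. y j powi (m $ j))"
      by (simp add: laurent_mon_def x power_int_mult_distrib prod.distrib power_int_power)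
    moreover have "\<pi> powi pairing (int_of_nat_vec k) m = \<pi> powi pairing (int_of_nat_vec k) m0 *
        (\<Prod>a\<in>S. (\<pi> ^ c a) ^ nat (pairing a m - pairing a m0))"
    proof -
      have "(\<Prod>a\<in>S. (\<pi> ^ c a) ^ nat (pairing a m - pairing a m0))
          = (\<Prod>a\<in>S. \<pi> powi (int (c a) * (pairing a m - pairing a m0)))"
        using ge m by (intro prod.cong) (auto simp: power_int_nonneg_exp simp flip: power_int_power)
      also have "\<dots> = \<pi> powi (pairing (int_of_nat_vec k) m - pairing (int_of_nat_vec k) m0)"
        by (rule power_int_sum) (simp_all add: k pairing_sum_scale algebra_simps sum_subtractf)
      finally show ?thesis by (simp flip: power_int_add)
    qed
    ultimately show ?thesis by (simp add: mult_ac)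
  qed
  then show ?thesis
    unfolding log_deriv_def reduced_deriv_def sum_distrib_left by (intro sum.cong) (auto simp: mult_ac)
qed

text \<open>Every \<open>k\<close> lies in one of finitely many full cones, so the least of their
  constants works for all \<open>k\<close> simultaneously.\<close>

lemma gradient_lower_bound:
  obtains \<epsilon> where "0 < \<epsilon>"
    "\<And>k x. admissible k \<Longrightarrow> (\<And>j. absval (x $ j) = \<rho> ^ (k $ j)) \<Longrightarrow>
      \<exists>i. \<epsilon> * \<rho> ^ dord k \<le> absval (log_deriv f i x)"
proof -
  have "\<exists>m. m \<in> keysf \<and> (\<forall>a. real_vec a \<in> \<sigma> \<longrightarrow> dmin a = pairing a m)" if "\<sigma> \<in> full_cones" for \<sigma>
    using dmin_linear[of \<sigma>] that unfolding full_cones_def by blast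
  then obtain v where v: "\<And>\<sigma>. \<sigma> \<in> full_cones \<Longrightarrow> v \<sigma> \<in> keysf"
    "\<And>\<sigma> a. \<sigma> \<in> full_cones \<Longrightarrow> real_vec a \<in> \<sigma> \<Longrightarrow> dmin a = pairing a (v \<sigma>)" by metis
  have gv: "dmin a = pairing a (v \<sigma>)" if "\<sigma> \<in> full_cones" "a \<in> gens \<sigma>" for \<sigma> a
    using that v(2)[of \<sigma> a] spans_cone_mem[OF spans_gens] by (auto simp: full_cones_def)
  have "\<exists>\<epsilon>>0. \<forall>t y. (\<forall>a. absval (t a) \<le> 1) \<longrightarrow> (\<forall>j. absval (y j) = 1) \<longrightarrow>
      (\<exists>i. \<epsilon> \<le> absval (reduced_deriv (gens \<sigma>) (v \<sigma>) i t y))" if \<sigma>: "\<sigma> \<in> full_cones" for \<sigma>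
    using reduced_deriv_bound[OF \<sigma> v(1)[OF \<sigma>] gv[OF \<sigma>]] by metis
  then obtain e where e: "\<And>\<sigma>. \<sigma> \<in> full_cones \<Longrightarrow> 0 < e \<sigma>"
    "\<And>\<sigma> t y. \<sigma> \<in> full_cones \<Longrightarrow> (\<forall>a. absval (t a) \<le> 1) \<Longrightarrow> (\<forall>j. absval (y j) = 1) \<Longrightarrow>
      \<exists>i. e \<sigma> \<le> absval (reduced_deriv (gens \<sigma>) (v \<sigma>) i t y)" by metis
  \<comment> \<open>Inserting 1 guarantees a minimum over a nonempty set.\<close>
  define \<epsilon> where "\<epsilon> = Min (insert 1 (e ` full_cones))"
  have finC: "finite full_cones" using finite_F by (simp add: full_cones_def)
  have "0 < \<epsilon>" unfolding \<epsilon>_def using e(1) finC by (subst Min_gr_iff) auto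
  moreover have "\<exists>i. \<epsilon> * \<rho> ^ dord k \<le> absval (log_deriv f i x)"
    if k: "admissible k" and x: "\<And>j. absval (x $ j) = \<rho> ^ (k $ j)" for k x
  proof -
    obtain \<sigma> c where \<sigma>: "\<sigma> \<in> full_cones" "int_of_nat_vec k = (\<Sum>a\<in>gens \<sigma>. int (c a) *s a)"
      "real_vec (int_of_nat_vec k) \<in> \<sigma>" by (rule lattice_point_decomposition)
    have finS: "finite (gens \<sigma>)" using \<sigma>(1) finite_gens by (simp add: full_cones_def)
    define y where "y j = x $ j / \<pi> ^ (k $ j)" for j
    have "\<forall>j. absval (y j) = 1" using x rho_pos by (simp add: y_def absval_divide absval_power)
    moreover have "\<forall>a. absval (\<pi> ^ c a) \<le> 1"
      using rho_pos rho_less_1 by (simp add: absval_power power_le_one)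
    ultimately obtain i where i: "e \<sigma> \<le> absval (reduced_deriv (gens \<sigma>) (v \<sigma>) i (\<lambda>a. \<pi> ^ c a) y)"
      using e(2)[OF \<sigma>(1), of "\<lambda>a. \<pi> ^ c a" y] by blast
    have ge: "pairing a (v \<sigma>) \<le> pairing a m" if "a \<in> gens \<sigma>" "m \<in> keysf" for a m
      using dmin_le[OF that(2), of a] gv[OF \<sigma>(1) that(1)] by simp
    have xy: "x $ j = \<pi> ^ (k $ j) * y j" for j by (simp add: y_def)
    have "log_deriv f i x = \<pi> powi (pairing (int_of_nat_vec k) (v \<sigma>)) *
        reduced_deriv (gens \<sigma>) (v \<sigma>) i (\<lambda>a. \<pi> ^ c a) y"
      using \<sigma>(2) finS ge xy by (rule log_deriv_scaling)
    moreover have "pairing (int_of_nat_vec k) (v \<sigma>) = int (dord k)"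
      using v(2)[OF \<sigma>(1,3)] dord_eq[OF k] by simp
    ultimately have "absval (log_deriv f i x) = \<rho> ^ dord k *
        absval (reduced_deriv (gens \<sigma>) (v \<sigma>) i (\<lambda>a. \<pi> ^ c a) y)"
      by (simp add: absval_mult absval_power)
    moreover have "\<epsilon> \<le> e \<sigma>" unfolding \<epsilon>_def using finC \<sigma>(1) by (intro Min_le) auto
    ultimately have "\<epsilon> * \<rho> ^ dord k \<le> absval (log_deriv f i x)"
      using i rho_pos by (simp add: mult.commute mult_left_mono)
    then show ?thesis by blast
  qed
  ultimately show ?thesis by (rule that)
qed

end

section \<open>Perturbation estimates\<close>

text \<open>\<open>z\<close> agrees with \<open>1 + \<alpha>\<close> to second order in
  \<open>r\<close>. The bound on \<open>\<alpha>\<close> lets products of linear terms be absorbed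
  into the error.\<close>

definition first_order :: "real \<Rightarrow> 'a::nonarch_field \<Rightarrow> 'a \<Rightarrow> bool" where
  "first_order r z \<alpha> \<longleftrightarrow> absval (z - 1 - \<alpha>) \<le> r ^ 2 \<and> absval \<alpha> \<le> r"

context
  fixes r :: real
  assumes r: "0 \<le> r" "r \<le> 1"
begin

lemma first_order_one: "first_order r (1 :: 'a::nonarch_field) 0"
  using r by (simp add: first_order_def)

lemma first_order_mult:
  fixes z :: "'a::nonarch_field"
  assumes z: "first_order r z \<alpha>" and z': "first_order r z' \<alpha>'"
  shows "first_order r (z * z') (\<alpha> + \<alpha>')"
proof -
  have r2: "r ^ 2 \<le> 1" using r by (simp add: power_le_one)
  have \<alpha>: "absval \<alpha> \<le> 1" "absval \<alpha>' \<le> 1" using z z' r by (auto simp: first_order_def)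
  have "absval ((z' - 1 - \<alpha>') + (1 + \<alpha>')) \<le> 1"
    using z' r2 \<alpha> by (intro absval_add_le) (auto simp: first_order_def)
  then have "absval z' \<le> 1" by simp
  then have 1: "absval ((z - 1 - \<alpha>) * z') \<le> r ^ 2"
    using z mult_mono[of "absval (z - 1 - \<alpha>)" "r ^ 2" "absval z'" 1]
    by (simp add: first_order_def absval_mult absval_nonneg)
  have "absval (1 + \<alpha>) \<le> 1" using \<alpha> by (intro absval_add_le) auto
  then have 2: "absval ((1 + \<alpha>) * (z' - 1 - \<alpha>')) \<le> r ^ 2"
    using z' mult_mono[of "absval (1 + \<alpha>)" 1 "absval (z' - 1 - \<alpha>')" "r ^ 2"]
    by (simp add: first_order_def absval_mult absval_nonneg)
  have 3: "absval (\<alpha> * \<alpha>') \<le> r ^ 2"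
    using z z' r mult_mono[of "absval \<alpha>" r "absval \<alpha>'" r]
    by (simp add: first_order_def absval_mult absval_nonneg power2_eq_square)
  have "z * z' - 1 - (\<alpha> + \<alpha>') = (z - 1 - \<alpha>) * z' + (1 + \<alpha>) * (z' - 1 - \<alpha>') + \<alpha> * \<alpha>'"
    by (simp add: algebra_simps)
  then have "absval (z * z' - 1 - (\<alpha> + \<alpha>')) \<le> r ^ 2"
    using absval_add_le[OF absval_add_le[OF 1 2] 3] by simp
  moreover have "absval (\<alpha> + \<alpha>') \<le> r" using z z' by (intro absval_add_le) (auto simp: first_order_def)
  ultimately show ?thesis by (simp add: first_order_def)
qed

lemma first_order_power: "first_order r z \<alpha> \<Longrightarrow> first_order r (z ^ n) (of_nat n * \<alpha>)"
  for z :: "'a::nonarch_field"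
proof (induction n)
  case (Suc n)
  then show ?case using first_order_mult[of z \<alpha> "z ^ n" "of_nat n * \<alpha>"] by (simp add: algebra_simps)
qed (simp add: first_order_one)

text \<open>Negative exponents reduce to \<open>1/(1+e) = 1 - e + e^2/(1+e)\<close>, where
  \<open>1+e\<close> is a unit.\<close>

lemma first_order_power_int:
  fixes e :: "'a::nonarch_field"
  assumes e: "absval e \<le> r" "absval e < 1"
  shows "first_order r ((1 + e) powi n) (of_int n * e)"
proof (cases "n \<ge> 0")
  case True
  have "first_order r (1 + e) e" using e r by (simp add: first_order_def)
  then have "first_order r ((1 + e) ^ nat n) (of_nat (nat n) * e)" by (rule first_order_power)
  then show ?thesis using True by (simp add: power_int_nonneg_exp of_nat_nat)
next
  case False
  have u: "absval (1 + e) = 1" using absval_unit_perturb[of e 1] e by simp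
  then have "1 + e \<noteq> 0" using absval_zero by force
  then have "inverse (1 + e) - 1 - (- e) = e * e * inverse (1 + e)" by (simp add: field_simps)
  then have "absval (inverse (1 + e) - 1 - (- e)) \<le> r ^ 2"
    using e mult_mono[of "absval e" r "absval e" r] r
    by (simp add: absval_mult absval_inverse u power2_eq_square absval_nonneg)
  then have "first_order r (inverse (1 + e)) (- e)" using e by (simp add: first_order_def)
  then have "first_order r (inverse (1 + e) ^ nat (- n)) (of_nat (nat (- n)) * - e)" by (rule first_order_power)
  then show ?thesis using False by (simp add: power_int_def of_nat_nat)
qed

lemma first_order_prod:
  fixes z :: "'i \<Rightarrow> 'a::nonarch_field"
  assumes "\<And>i. i \<in> B \<Longrightarrow> first_order r (z i) (\<alpha> i)"
  shows "first_order r (\<Prod>i\<in>B. z i) (\<Sum>i\<in>B. \<alpha> i)"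
  using assms
  by (induction B rule: infinite_finite_induct) (simp_all add: first_order_one first_order_mult)

end

lemma absval_mult_diff_le:
  fixes z :: "'a::nonarch_field"
  assumes "absval (z - z') \<le> r" "absval (w - w') \<le> r" "absval z' \<le> 1" "absval w \<le> 1" "0 \<le> r"
  shows "absval (z * w - z' * w') \<le> r"
proof -
  have "z * w - z' * w' = (z - z') * w + z' * (w - w')" by (simp add: algebra_simps)
  moreover have "absval ((z - z') * w) \<le> r"
    using assms mult_mono[of "absval (z - z')" r "absval w" 1] by (simp add: absval_mult absval_nonneg)
  moreover have "absval (z' * (w - w')) \<le> r"
    using assms mult_mono[of "absval z'" 1 "absval (w - w')" r] by (simp add: absval_mult absval_nonneg)
  ultimately show ?thesis by (simp add: absval_add_le)
qed

lemma absval_prod_le_1: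
  fixes z :: "'i \<Rightarrow> 'a::nonarch_field"
  assumes "\<And>i. i \<in> B \<Longrightarrow> absval (z i) \<le> 1"
  shows "absval (\<Prod>i\<in>B. z i) \<le> 1"
  unfolding absval_prod using assms by (intro prod_le_1) (simp add: absval_nonneg)

lemma absval_prod_diff_le:
  fixes z z' :: "'i \<Rightarrow> 'a::nonarch_field"
  assumes "0 \<le> r" "\<And>i. i \<in> B \<Longrightarrow> absval (z i - z' i) \<le> r"
    "\<And>i. i \<in> B \<Longrightarrow> absval (z i) \<le> 1" "\<And>i. i \<in> B \<Longrightarrow> absval (z' i) \<le> 1"
  shows "absval ((\<Prod>i\<in>B. z i) - (\<Prod>i\<in>B. z' i)) \<le> r"
  using assms
proof (induction B rule: infinite_finite_induct)
  case (insert b B)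
  then have "absval (z b * prod z B - z' b * prod z' B) \<le> r"
    by (intro absval_mult_diff_le absval_prod_le_1) auto
  then show ?case using insert by simp
qed auto

lemma absval_power_diff_le:
  fixes z :: "'a::nonarch_field"
  assumes "absval (z - z') \<le> r" "absval z \<le> 1" "absval z' \<le> 1" "0 \<le> r"
  shows "absval (z ^ n - z' ^ n) \<le> r"
  using absval_prod_diff_le[of r "{..<n}" "\<lambda>_. z" "\<lambda>_. z'"] assms by simp

lemma absval_power_int_diff_le:
  fixes z :: "'a::nonarch_field"
  assumes "absval (z - z') \<le> r" "absval z = 1" "absval z' = 1" "0 \<le> r"
  shows "absval (z powi n - z' powi n) \<le> r"
proof (cases "n \<ge> 0")
  case True
  then show ?thesis using assms by (simp add: power_int_nonneg_exp absval_power_diff_le)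
next
  case False
  have "z \<noteq> 0" "z' \<noteq> 0" using assms absval_zero by force+
  then have "inverse z - inverse z' = inverse z * (z' - z) * inverse z'" by (simp add: field_simps)
  then have "absval (inverse z - inverse z') \<le> r"
    using assms by (simp add: absval_mult absval_inverse absval_minus_commute[of z'])
  then have "absval (inverse z ^ nat (- n) - inverse z' ^ nat (- n)) \<le> r"
    using assms by (intro absval_power_diff_le) (simp_all add: absval_inverse)
  then show ?thesis using False by (simp add: power_int_def)
qed

section \<open>Cancellation\<close>

context padic_uniformizer
begin

lemma vrep_ints_subset: "vrep M ` (ints :: ('k ^ 'n::finite) set) \<subseteq> ints"
proof -
  have "saturated M (ints :: ('k ^ 'n) set)"
    unfolding saturated_def
  proof (intro conjI ballI allI impI)
    fix x y :: "'k ^ 'n" assume x: "x \<in> ints" and xy: "vrep M x = vrep M y"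
    have "\<rho> ^ M \<le> 1" using rho_pos rho_less_1 by (simp add: power_le_one)
    then have d: "absval (x $ i - y $ i) \<le> 1" for i using xy by (auto simp: vrep_eq_iff intro: order_trans)
    have "absval (y $ i) \<le> 1" for i
      using absval_diff_le[OF _ d[of i], of "x $ i"] x by (simp add: ints_def)
    then show "y \<in> ints" by (simp add: ints_def)
  qed simp
  then show ?thesis using vrep_mem_saturated by blast
qed

lemma absval_vrep: "absval (x $ i - vrep M x $ i) \<le> \<rho> ^ M"
  by (simp add: vrep_def absval_rep)

text \<open>Orthogonality by translation. Representatives are not closed under addition, so the
  translation is followed by reduction modulo \<open>\<pi>^M\<close>; this permutes them, and
  \<open>\<theta>\<close> does not see the reduction.\<close>

lemma character_sum_zero:
  fixes \<theta> :: "'k ^ 'n::finite \<Rightarrow> complex"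
  assumes add: "\<And>a b. \<theta> (a + b) = \<theta> a * \<theta> b"
    and triv: "\<And>a. (\<And>i. absval (a $ i) \<le> \<rho> ^ M) \<Longrightarrow> \<theta> a = 1"
    and w0: "w0 \<in> ints" "\<theta> w0 \<noteq> 1"
  shows "(\<Sum>w\<in>vrep M ` ints. \<theta> w) = 0"
proof -
  let ?W = "vrep M ` (ints :: ('k ^ 'n) set)"
  let ?\<phi> = "\<lambda>w. vrep M (w + w0)"
  have fin: "finite ?W" by (rule finite_vrep_ints)
  have "?\<phi> ` ?W \<subseteq> ?W"
  proof
    fix v assume "v \<in> ?\<phi> ` ?W"
    then obtain w where w: "w \<in> ?W" "v = ?\<phi> w" by blast
    then have "w \<in> ints" using vrep_ints_subset by blast
    then have "w + w0 \<in> ints" using w0(1) by (auto simp: ints_def intro: absval_add_le)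
    then show "v \<in> ?W" using w by blast
  qed
  moreover have inj: "inj_on ?\<phi> ?W"
  proof (rule inj_onI)
    fix w w' assume "w \<in> ?W" "w' \<in> ?W" and eq: "?\<phi> w = ?\<phi> w'"
    then have "vrep M w = w" "vrep M w' = w'" by auto
    moreover have "vrep M w = vrep M w'" using eq by (simp add: vrep_eq_iff)
    ultimately show "w = w'" by metis
  qed
  ultimately have "?\<phi> ` ?W = ?W" using fin by (intro endo_inj_surj)
  then have "(\<Sum>w\<in>?W. \<theta> w) = (\<Sum>w\<in>?W. \<theta> (?\<phi> w))"
    using sum.reindex[OF inj, of \<theta>] by (simp add: o_def)
  also have "\<dots> = (\<Sum>w\<in>?W. \<theta> w0 * \<theta> w)"
  proof (rule sum.cong[OF refl])
    fix w
    have "\<theta> ((w + w0) - ?\<phi> w) = 1"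
      using absval_vrep[of "w + w0" _ M] by (intro triv) simp
    then have "\<theta> (w + w0) = \<theta> (?\<phi> w)" using add[of "(w + w0) - ?\<phi> w" "?\<phi> w"] by simp
    then show "\<theta> (?\<phi> w) = \<theta> w0 * \<theta> w" using add[of w w0] by (simp add: mult.commute)
  qed
  finally have "(\<Sum>w\<in>?W. \<theta> w) = \<theta> w0 * (\<Sum>w\<in>?W. \<theta> w)"
    unfolding sum_distrib_left[symmetric] .
  then have "(1 - \<theta> w0) * (\<Sum>w\<in>?W. \<theta> w) = 0" by (simp add: left_diff_distrib)
  then show ?thesis using w0 by simp
qed

lemma add_char_cong:
  assumes "\<And>z. absval z \<le> \<kappa> \<Longrightarrow> add_char p \<iota> z = 1" "absval (a - b) \<le> \<kappa>"
  shows "add_char p \<iota> a = add_char p \<iota> b"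
  using add_char_add[of "a - b" b] assms by simp

end

section \<open>The phase and its sums over points with given valuations\<close>

context nondegenerate_sum
begin

abbreviation "sdom \<equiv> (sum_domain J :: ('k ^ 'n) set)"

text \<open>A common bound for all coefficients; the summand 1 makes its positivity
  immediate.\<close>

definition coef_bound :: real where
  "coef_bound = 1 + (\<Sum>m\<in>keysf. absval (coef m))"

lemma coef_bound_pos: "0 < coef_bound"
  unfolding coef_bound_def using sum_nonneg[of keysf "\<lambda>m. absval (coef m)"] absval_nonneg
  by (smt (verit))

lemma absval_coef: "m \<in> keysf \<Longrightarrow> absval (coef m) \<le> coef_bound"
  unfolding coef_bound_def using member_le_sum[of m keysf "\<lambda>m. absval (coef m)"] by (simp add: absval_nonneg)

lemma absval_laurent_mon:
  assumes k: "admissible k" and x: "\<And>i. absval (x $ i) = \<rho> ^ (k $ i)" and m: "m \<in> keysf"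
  shows "absval (laurent_mon x m) \<le> \<rho> ^ dord k"
proof -
  have "absval (laurent_mon x m) = (\<Prod>i\<in>UNIV. \<rho> powi (int (k $ i) * m $ i))"
    by (simp add: laurent_mon_def absval_prod absval_power_int x power_int_power)
  also have "\<dots> = \<rho> powi pairing (int_of_nat_vec k) m"
    by (rule power_int_sum) (use rho_pos in \<open>simp_all add: pairing_def int_of_nat_vec_def\<close>)
  also have "\<dots> \<le> \<rho> powi int (dord k)"
    using dmin_le[OF m, of "int_of_nat_vec k"] dord_eq[OF k] rho_pos rho_less_1
    by (intro power_int_decreasing) auto
  finally show ?thesis by simp
qed

lemma absval_log_deriv_le:
  assumes k: "admissible k" and x: "\<And>i. absval (x $ i) = \<rho> ^ (k $ i)"
  shows "absval (log_deriv f i x) \<le> coef_bound * \<rho> ^ dord k"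
  unfolding log_deriv_def
proof (rule absval_sum_le)
  show "0 \<le> coef_bound * \<rho> ^ dord k" using coef_bound_pos rho_pos by simp
  fix m assume m: "m \<in> keysf"
  have "absval (coef m) * absval (of_int (m $ i) :: 'k) \<le> coef_bound * 1"
    using absval_coef[OF m] absval_of_int_le coef_bound_pos by (intro mult_mono) (auto simp: absval_nonneg)
  then have "absval (coef m) * absval (of_int (m $ i) :: 'k) * absval (laurent_mon x m) \<le> coef_bound * 1 * \<rho> ^ dord k"
    by (rule mult_mono) (use absval_laurent_mon[OF k x m] coef_bound_pos in \<open>simp_all add: absval_nonneg\<close>)
  then show "absval (coef m * of_int (m $ i) * laurent_mon x m) \<le> coef_bound * \<rho> ^ dord k"
    by (simp add: absval_mult)
qed

text \<open>A multiplicative perturbation multiplies each monomial by a factor of its own, so the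
  second-order error keeps the size \<open>\<rho> ^ dord k\<close> of the monomials. This is the
  reason for perturbing by \<open>1 + \<pi>^s w\<close> instead of adding
  \<open>\<pi>^s w\<close>.\<close>

lemma taylor:
  assumes k: "admissible k" and x: "\<And>i. absval (x $ i) = \<rho> ^ (k $ i)" and w: "w \<in> ints" and s: "1 \<le> s"
  shows "absval (laurent_eval f (\<chi> i. x $ i * (1 + \<pi> ^ s * w $ i)) - laurent_eval f x
    - \<pi> ^ s * (\<Sum>i\<in>UNIV. w $ i * log_deriv f i x)) \<le> coef_bound * \<rho> ^ (dord k + 2 * s)"
proof -
  define r where "r = \<rho> ^ s"
  have r: "0 \<le> r" "r \<le> 1" "r < 1"
    using rho_pos rho_less_1 s power_decreasing[of 1 s \<rho>] by (auto simp: r_def power_le_one)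
  define z where "z m = (\<Prod>i\<in>UNIV. (1 + \<pi> ^ s * w $ i) powi (m $ i))" for m :: "int ^ 'n"
  define \<alpha> where "\<alpha> m = (\<Sum>i\<in>UNIV. of_int (m $ i) * (\<pi> ^ s * w $ i))" for m :: "int ^ 'n"
  have "absval (\<pi> ^ s * w $ i) \<le> r" for i
    using w mult_left_mono[of "absval (w $ i)" 1 r] r by (simp add: ints_def absval_mult absval_power r_def)
  then have z: "first_order r (z m) (\<alpha> m)" for m
    unfolding z_def \<alpha>_def using r by (intro first_order_prod first_order_power_int) (auto intro: le_less_trans)
  have "laurent_eval f (\<chi> i. x $ i * (1 + \<pi> ^ s * w $ i)) = (\<Sum>m\<in>keysf. coef m * laurent_mon x m * z m)"
    by (simp add: laurent_eval_mon laurent_mon_def z_def power_int_mult_distrib prod.distrib mult.assoc)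
  moreover have "\<pi> ^ s * (\<Sum>i\<in>UNIV. w $ i * log_deriv f i x) = (\<Sum>m\<in>keysf. coef m * laurent_mon x m * \<alpha> m)"
    unfolding log_deriv_def \<alpha>_def sum_distrib_left by (subst sum.swap) (simp add: mult_ac)
  ultimately have "laurent_eval f (\<chi> i. x $ i * (1 + \<pi> ^ s * w $ i)) - laurent_eval f x
    - \<pi> ^ s * (\<Sum>i\<in>UNIV. w $ i * log_deriv f i x) = (\<Sum>m\<in>keysf. coef m * laurent_mon x m * (z m - 1 - \<alpha> m))"
    by (simp add: laurent_eval_mon sum_subtractf sum.distrib algebra_simps)
  also have "absval \<dots> \<le> coef_bound * \<rho> ^ (dord k + 2 * s)"
  proof (rule absval_sum_le)
    show "0 \<le> coef_bound * \<rho> ^ (dord k + 2 * s)" using coef_bound_pos rho_pos by simp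
    fix m assume m: "m \<in> keysf"
    have "absval (coef m) * absval (laurent_mon x m) * absval (z m - 1 - \<alpha> m) \<le> coef_bound * \<rho> ^ dord k * r ^ 2"
      using absval_coef[OF m] absval_laurent_mon[OF k x m] z[of m] coef_bound_pos rho_pos
      by (intro mult_mono) (auto simp: absval_nonneg first_order_def)
    moreover have "coef_bound * \<rho> ^ dord k * r ^ 2 = coef_bound * \<rho> ^ (dord k + 2 * s)"
      unfolding r_def power_mult[symmetric] power_add by (simp add: mult_ac)
    ultimately show "absval (coef m * laurent_mon x m * (z m - 1 - \<alpha> m)) \<le> coef_bound * \<rho> ^ (dord k + 2 * s)"
      by (simp add: absval_mult)
  qed
  finally show ?thesis .
qed

text \<open>Lipschitz continuity: on \<open>J\<close> powers of units of either sign do not increase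
  distances, and off \<open>J\<close> only nonnegative exponents occur.\<close>

lemma laurent_eval_diff_le:
  assumes x: "x \<in> sdom" and y: "y \<in> sdom" and xy: "vrep M x = vrep M y"
  shows "absval (laurent_eval f x - laurent_eval f y) \<le> coef_bound * \<rho> ^ M"
proof -
  have d: "absval (x $ i - y $ i) \<le> \<rho> ^ M" for i using xy by (simp add: vrep_eq_iff)
  have r: "0 \<le> \<rho> ^ M" using rho_pos by simp
  have "absval (laurent_mon x m - laurent_mon y m) \<le> \<rho> ^ M" if m: "m \<in> keysf" for m
    unfolding laurent_mon_def
  proof (rule absval_prod_diff_le[OF r])
    fix i :: 'n
    have "absval (x $ i powi m $ i - y $ i powi m $ i) \<le> \<rho> ^ M \<and> absval (x $ i powi m $ i) \<le> 1 \<and> absval (y $ i powi m $ i) \<le> 1"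
    proof (cases "i \<in> J")
      case True
      then have "absval (x $ i) = 1" "absval (y $ i) = 1" using x y by (auto simp: sum_domain_def unit_group_def)
      then show ?thesis using d r by (simp add: absval_power_int_diff_le absval_power_int)
    next
      case False
      then have "absval (x $ i) \<le> 1" "absval (y $ i) \<le> 1" "0 \<le> m $ i"
        using x y A_nonneg[OF m] by (auto simp: sum_domain_def valuation_ring_def)
      then show ?thesis
        using d r by (simp add: power_int_nonneg_exp absval_power_diff_le absval_power absval_nonneg power_le_one)
    qed
    then show "absval (x $ i powi m $ i - y $ i powi m $ i) \<le> \<rho> ^ M" "absval (x $ i powi m $ i) \<le> 1"
      "absval (y $ i powi m $ i) \<le> 1" by auto
  qed
  then have "absval (coef m * (laurent_mon x m - laurent_mon y m)) \<le> coef_bound * \<rho> ^ M" if "m \<in> keysf" for m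
    unfolding absval_mult using that absval_coef coef_bound_pos by (intro mult_mono) (auto simp: absval_nonneg)
  then have "absval (\<Sum>m\<in>keysf. coef m * (laurent_mon x m - laurent_mon y m)) \<le> coef_bound * \<rho> ^ M"
    using coef_bound_pos r by (intro absval_sum_le) auto
  then show ?thesis by (simp add: laurent_eval_mon sum_subtractf right_diff_distrib)
qed

definition phase :: "nat \<Rightarrow> 'k \<Rightarrow> 'k ^ 'n \<Rightarrow> complex" where
  "phase m u x = add_char p \<iota> (u / \<pi> ^ m * laurent_eval f x)"

text \<open>Consists of representatives, hence finite. For \<open>k $ i < M\<close> the valuations
  are the same for all points of a class.\<close>

definition level_set :: "nat \<Rightarrow> nat ^ 'n \<Rightarrow> ('k ^ 'n) set" where
  "level_set M k = {x \<in> vrep M ` sdom. \<forall>i. absval (x $ i) = \<rho> ^ (k $ i)}"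

text \<open>The condition on \<open>M\<close> may require \<open>M > m\<close>, since the
  coefficients may have denominators and \<open>\<kappa>\<close> may be small.\<close>

lemma phase_periodic:
  assumes \<kappa>: "\<And>z. absval z \<le> \<kappa> \<Longrightarrow> add_char p \<iota> z = 1"
    and u: "absval u = 1" and M: "coef_bound * \<rho> ^ M \<le> \<kappa> * \<rho> ^ m"
  shows "periodic_on sdom M (phase m u)"
  unfolding periodic_on_def phase_def
proof (intro ballI impI)
  fix x y assume xy: "x \<in> sdom" "y \<in> sdom" "vrep M x = vrep M y"
  have "absval (u / \<pi> ^ m * (laurent_eval f x - laurent_eval f y)) \<le> \<kappa>"
    using order_trans[OF laurent_eval_diff_le[OF xy] M] u rho_pos
    by (simp add: absval_mult absval_divide absval_power pos_divide_le_eq)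
  then show "add_char p \<iota> (u / \<pi> ^ m * laurent_eval f x) = add_char p \<iota> (u / \<pi> ^ m * laurent_eval f y)"
    by (intro add_char_cong[OF \<kappa>]) (simp_all add: right_diff_distrib)
qed

text \<open>Multiplication by the units \<open>1 + \<pi>^s w_i\<close> preserves valuations and
  distances, so followed by reduction modulo \<open>\<pi>^M\<close> it permutes the level set;
  periodicity hides the reduction.\<close>

lemma rescale_sum:
  assumes k: "admissible k" "\<And>i. k $ i < M" and w: "w \<in> ints" and s: "1 \<le> s"
    and per: "periodic_on sdom M h"
  shows "(\<Sum>x\<in>level_set M k. h (\<chi> i. x $ i * (1 + \<pi> ^ s * w $ i))) = (\<Sum>x\<in>level_set M k. h x)"
proof -
  let ?A = "level_set M k"
  let ?T = "\<lambda>x. (\<chi> i. x $ i * (1 + \<pi> ^ s * w $ i)) :: 'k ^ 'n"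
  have "absval (\<pi> ^ s * w $ i) < 1" for i
  proof -
    have "absval (\<pi> ^ s * w $ i) \<le> \<rho> ^ s"
      using w mult_left_mono[of "absval (w $ i)" 1 "\<rho> ^ s"] rho_pos by (simp add: ints_def absval_mult absval_power)
    also have "\<dots> \<le> \<rho>" using power_decreasing[of 1 s \<rho>] s rho_pos rho_less_1 by simp
    finally show ?thesis using rho_less_1 by simp
  qed
  then have unit: "absval (1 + \<pi> ^ s * w $ i) = 1" for i
    using absval_unit_perturb[of "\<pi> ^ s * w $ i" 1] by simp
  have mem: "y \<in> sdom" if "\<And>i. absval (y $ i) = \<rho> ^ (k $ i)" for y :: "'k ^ 'n"
    using that k(1) rho_pos rho_less_1
    by (auto simp: sum_domain_def unit_group_def valuation_ring_def admissible_def power_le_one)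
  have Tabs: "absval (?T x $ i) = \<rho> ^ (k $ i)" if "x \<in> ?A" for x i
    using that unit by (simp add: level_set_def absval_mult)
  have Tdom: "?T x \<in> sdom" if "x \<in> ?A" for x using mem Tabs[OF that] by blast
  have rT: "vrep M (?T x) \<in> ?A" if x: "x \<in> ?A" for x
  proof -
    have "absval (vrep M (?T x) $ i) = \<rho> ^ (k $ i)" for i
    proof -
      \<comment> \<open>Because \<open>k $ i < M\<close>, the reduction error is strictly smaller
        than the coordinate and leaves its absolute value unchanged.\<close>
      have "\<rho> ^ M < \<rho> ^ (k $ i)" using k(2)[of i] rho_pos rho_less_1 by (intro power_strict_decreasing)
      moreover have "absval (vrep M (?T x) $ i - ?T x $ i) \<le> \<rho> ^ M"
        using absval_vrep[of "?T x" i M] by (simp add: absval_minus_commute)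
      ultimately have "absval (?T x $ i + (vrep M (?T x) $ i - ?T x $ i)) = absval (?T x $ i)"
        using Tabs[OF x, of i] by (intro absval_unit_perturb) simp
      then show ?thesis using Tabs[OF x, of i] by simp
    qed
    then show ?thesis using Tdom[OF x] by (auto simp: level_set_def)
  qed
  have fin: "finite ?A"
    using finite_vrep_saturated[OF saturated_sum_domain[of 1 J], of M] by (simp add: level_set_def)
  have inj: "inj_on (\<lambda>x. vrep M (?T x)) ?A"
  proof (rule inj_onI)
    fix x x' assume x: "x \<in> ?A" "x' \<in> ?A" and eq: "vrep M (?T x) = vrep M (?T x')"
    have "absval (x $ i - x' $ i) \<le> \<rho> ^ M" for i
    proof -
      have "absval ((x $ i - x' $ i) * (1 + \<pi> ^ s * w $ i)) \<le> \<rho> ^ M"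
        using eq by (simp add: vrep_eq_iff left_diff_distrib)
      then show ?thesis by (simp add: absval_mult unit)
    qed
    then have "vrep M x = vrep M x'" by (simp add: vrep_eq_iff)
    moreover have "vrep M x = x" "vrep M x' = x'" using x by (auto simp: level_set_def)
    ultimately show "x = x'" by metis
  qed
  have img: "(\<lambda>x. vrep M (?T x)) ` ?A = ?A"
    using rT inj fin by (intro endo_inj_surj) auto
  have "(\<Sum>x\<in>?A. h x) = (\<Sum>x\<in>?A. h (vrep M (?T x)))"
    using sum.reindex[OF inj, of h] img by (simp add: o_def)
  also have "\<dots> = (\<Sum>x\<in>?A. h (?T x))"
  proof (rule sum.cong[OF refl])
    fix x assume x: "x \<in> ?A"
    have "vrep M (?T x) \<in> sdom" using rT[OF x] by (intro mem) (simp add: level_set_def)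
    then show "h (vrep M (?T x)) = h (?T x)"
      using per Tdom[OF x] vrep_vrep[of M "?T x"] unfolding periodic_on_def by blast
  qed
  finally show ?thesis by simp
qed

lemma level_sum_vanishes:
  obtains M0 \<kappa> where "0 < \<kappa>" "\<And>z. absval z \<le> \<kappa> \<Longrightarrow> add_char p \<iota> z = 1"
    "\<And>k m M u. \<lbrakk>admissible k; \<And>i. k $ i < M; dord k + M0 \<le> m; absval u = 1;
      coef_bound * \<rho> ^ M \<le> \<kappa> * \<rho> ^ m\<rbrakk> \<Longrightarrow> (\<Sum>x\<in>level_set M k. phase m u x) = 0"
proof -
  obtain \<kappa> where \<kappa>: "0 < \<kappa>" "\<And>z. absval z \<le> \<kappa> \<Longrightarrow> add_char p \<iota> z = 1"
    using add_char_trivial_ball by blast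
  obtain z0 where z0: "add_char p \<iota> z0 \<noteq> 1" using add_char_nontrivial by blast
  obtain \<epsilon> where \<epsilon>: "0 < \<epsilon>" "\<And>k x. admissible k \<Longrightarrow> (\<And>j. absval (x $ j) = \<rho> ^ (k $ j)) \<Longrightarrow>
      \<exists>i. \<epsilon> * \<rho> ^ dord k \<le> absval (log_deriv f i x)" using gradient_lower_bound by blast
  have small: "\<exists>c. B * \<rho> ^ c \<le> e" if "0 < e" "0 \<le> B" for B e :: real
  proof -
    have "0 < e / (B + 1)" using that by simp
    then obtain c where "\<rho> ^ c < e / (B + 1)" using real_arch_pow_inv[OF _ rho_less_1] by blast
    then have "(B + 1) * \<rho> ^ c < e" using that by (simp add: pos_less_divide_eq mult.commute)
    moreover have "0 \<le> \<rho> ^ c" using rho_pos by simp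
    ultimately show ?thesis by (intro exI[of _ c]) (simp add: distrib_right)
  qed
  \<comment> \<open>\<open>c1\<close> will make the Taylor error invisible to the character;
    \<open>c2\<close> will make the linear term large enough to reach \<open>z0\<close>, where the
    character is nontrivial.\<close>
  obtain c1 where c1: "coef_bound * \<rho> ^ c1 \<le> \<kappa>" using small[OF \<kappa>(1)] coef_bound_pos by (metis less_imp_le)
  obtain c2 where c2: "absval z0 * \<rho> ^ c2 \<le> \<epsilon>" using small[OF \<epsilon>(1)] absval_nonneg by metis
  have "(\<Sum>x\<in>level_set M k. phase m u x) = 0"
    if k: "admissible k" "\<And>i. k $ i < M" and m: "dord k + (c1 + 2 * c2 + 1) \<le> m"
      and u: "absval u = 1" and M: "coef_bound * \<rho> ^ M \<le> \<kappa> * \<rho> ^ m" for k m M u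
  proof -
    let ?A = "level_set M k" and ?W = "vrep M ` (ints :: ('k ^ 'n) set)"
    \<comment> \<open>Relative to \<open>\<rho> ^ m\<close>, the linear term can now reach size
      \<open>\<epsilon> * \<rho> ^ (dord k + s - m) = \<epsilon> / \<rho> ^ c2\<close>, at least
      \<open>absval z0\<close>. The quadratic error has relative order
      \<open>dord k + 2 * s - m \<ge> c1\<close>, and the extra 1 in the bound on \<open>m\<close>
      gives \<open>s \<ge> 1\<close>.\<close>
    define s where "s = m - dord k - c2"
    have s: "1 \<le> s" "dord k + s + c2 = m" "m + c1 \<le> dord k + 2 * s" using m by (auto simp: s_def)
    have \<rho>m: "0 < \<rho> ^ m" using rho_pos by simp
    define g where "g x i = u / \<pi> ^ m * \<pi> ^ s * log_deriv f i x" for x i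
    define \<theta> where "\<theta> x w = add_char p \<iota> (\<Sum>i\<in>UNIV. g x i * w $ i)" for x w
    have phase: "phase m u (\<chi> i. x $ i * (1 + \<pi> ^ s * w $ i)) = phase m u x * \<theta> x w"
      if x: "x \<in> ?A" and w: "w \<in> ints" for x w
    proof -
      have xk: "absval (x $ i) = \<rho> ^ (k $ i)" for i using x by (simp add: level_set_def)
      have "coef_bound * \<rho> ^ (dord k + 2 * s) \<le> coef_bound * \<rho> ^ (m + c1)"
        using coef_bound_pos rho_pos rho_less_1 s(3) by (intro mult_left_mono power_decreasing) auto
      also have "\<dots> \<le> \<kappa> * \<rho> ^ m" using mult_right_mono[OF c1, of "\<rho> ^ m"] \<rho>m by (simp add: power_add mult_ac)
      finally have "coef_bound * \<rho> ^ (dord k + 2 * s) \<le> \<kappa> * \<rho> ^ m" .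
      then have "absval (laurent_eval f (\<chi> i. x $ i * (1 + \<pi> ^ s * w $ i)) - laurent_eval f x
          - \<pi> ^ s * (\<Sum>i\<in>UNIV. w $ i * log_deriv f i x)) \<le> \<kappa> * \<rho> ^ m"
        using taylor[OF k(1) xk w s(1)] by linarith
      then have "absval (u / \<pi> ^ m * (laurent_eval f (\<chi> i. x $ i * (1 + \<pi> ^ s * w $ i)) - laurent_eval f x
          - \<pi> ^ s * (\<Sum>i\<in>UNIV. w $ i * log_deriv f i x))) \<le> \<kappa>"
        using u \<rho>m by (simp add: absval_mult absval_divide absval_power pos_divide_le_eq)
      moreover have "u / \<pi> ^ m * (laurent_eval f (\<chi> i. x $ i * (1 + \<pi> ^ s * w $ i)) - laurent_eval f x
          - \<pi> ^ s * (\<Sum>i\<in>UNIV. w $ i * log_deriv f i x)) =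
          u / \<pi> ^ m * laurent_eval f (\<chi> i. x $ i * (1 + \<pi> ^ s * w $ i)) -
          (u / \<pi> ^ m * laurent_eval f x + (\<Sum>i\<in>UNIV. g x i * w $ i))"
        by (simp add: g_def right_diff_distrib sum_distrib_left mult_ac)
      ultimately have "phase m u (\<chi> i. x $ i * (1 + \<pi> ^ s * w $ i)) =
          add_char p \<iota> (u / \<pi> ^ m * laurent_eval f x + (\<Sum>i\<in>UNIV. g x i * w $ i))"
        unfolding phase_def by (intro add_char_cong[OF \<kappa>(2)]) simp_all
      then show ?thesis by (simp add: add_char_add phase_def \<theta>_def)
    qed
    have zero: "(\<Sum>w\<in>?W. \<theta> x w) = 0" if x: "x \<in> ?A" for x
    proof -
      have xk: "absval (x $ i) = \<rho> ^ (k $ i)" for i using x by (simp add: level_set_def)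
      have g: "absval (g x i) * \<rho> ^ m = \<rho> ^ s * absval (log_deriv f i x)" for i
        using rho_pos u by (simp add: g_def absval_mult absval_divide absval_power)
      obtain i where i: "\<epsilon> * \<rho> ^ dord k \<le> absval (log_deriv f i x)" using \<epsilon>(2)[OF k(1) xk] by blast
      have "absval z0 * \<rho> ^ c2 * (\<rho> ^ dord k * \<rho> ^ s) \<le> \<epsilon> * (\<rho> ^ dord k * \<rho> ^ s)"
        using c2 rho_pos by (intro mult_right_mono) auto
      also have "\<dots> \<le> absval (g x i) * \<rho> ^ m"
        unfolding g using mult_left_mono[OF i, of "\<rho> ^ s"] rho_pos by (simp add: mult_ac)
      also have "absval z0 * \<rho> ^ c2 * (\<rho> ^ dord k * \<rho> ^ s) = absval z0 * \<rho> ^ m"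
        unfolding s(2)[symmetric] by (simp add: power_add mult_ac)
      finally have gi: "absval z0 \<le> absval (g x i)" using \<rho>m by simp
      have z0n: "z0 \<noteq> 0"
      proof
        assume "z0 = 0"
        then have "add_char p \<iota> z0 = 1" using \<kappa> by simp
        then show False using z0 by simp
      qed
      then have g0: "g x i \<noteq> 0" using gi absval_pos[OF z0n] by auto
      \<comment> \<open>Moves only a coordinate with large logarithmic derivative, by the amount
        that makes the linear form equal to \<open>z0\<close>; integral because
        \<open>absval z0 \<le> absval (g x i)\<close>.\<close>
      define w0 :: "'k ^ 'n" where "w0 = axis i (z0 / g x i)"
      have "(\<Sum>j\<in>UNIV. g x j * w0 $ j) = (\<Sum>j\<in>UNIV. if j = i then z0 else 0)"
        using g0 by (intro sum.cong) (auto simp: w0_def axis_def)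
      then have "\<theta> x w0 = add_char p \<iota> z0" by (simp add: \<theta>_def)
      then have w0: "\<theta> x w0 \<noteq> 1" using z0 by simp
      have w0': "w0 \<in> ints"
        using gi absval_pos[OF g0] by (simp add: ints_def w0_def axis_def absval_divide)
      show ?thesis
      proof (rule character_sum_zero[where \<theta> = "\<theta> x", OF _ _ w0' w0])
        show "\<theta> x (a + b) = \<theta> x a * \<theta> x b" for a b
          by (simp add: \<theta>_def distrib_left sum.distrib add_char_add)
        show "\<theta> x a = 1" if a: "\<And>i. absval (a $ i) \<le> \<rho> ^ M" for a
          unfolding \<theta>_def
        proof (intro \<kappa>(2) absval_sum_le)
          show "0 \<le> \<kappa>" using \<kappa>(1) by simp
          fix j :: 'n
          have \<rho>1: "\<rho> ^ l \<le> 1" for l using rho_pos rho_less_1 by (simp add: power_le_one)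
          have "absval (log_deriv f j x) \<le> coef_bound * \<rho> ^ dord k" using k(1) xk by (rule absval_log_deriv_le)
          also have "\<dots> \<le> coef_bound * 1" using \<rho>1 coef_bound_pos by (intro mult_left_mono) auto
          finally have "\<rho> ^ s * absval (log_deriv f j x) \<le> 1 * coef_bound"
            using \<rho>1 by (intro mult_mono) (auto simp: absval_nonneg)
          then have "absval (g x j) * \<rho> ^ m \<le> coef_bound" unfolding g by simp
          then have "absval (g x j) * \<rho> ^ m * absval (a $ j) \<le> coef_bound * \<rho> ^ M"
            using a[of j] coef_bound_pos by (intro mult_mono) (auto simp: absval_nonneg)
          then have "absval (g x j * a $ j) * \<rho> ^ m \<le> \<kappa> * \<rho> ^ m" using M by (simp add: absval_mult mult_ac)
          then show "absval (g x j * a $ j) \<le> \<kappa>" using \<rho>m by simp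
        qed
      qed
    qed
    have per: "periodic_on sdom M (phase m u)" using phase_periodic[OF \<kappa>(2) u M] by blast
    \<comment> \<open>Averaging: each \<open>w\<close> reproduces the same sum, and after
      interchanging the order the inner sum over \<open>w\<close> is a vanishing character sum for
      every \<open>x\<close>.\<close>
    have "of_nat (card ?W) * (\<Sum>x\<in>?A. phase m u x) = (\<Sum>w\<in>?W. \<Sum>x\<in>?A. phase m u x)" by simp
    also have "\<dots> = (\<Sum>w\<in>?W. \<Sum>x\<in>?A. phase m u x * \<theta> x w)"
    proof (rule sum.cong[OF refl])
      fix w assume "w \<in> ?W"
      then have w: "w \<in> ints" using vrep_ints_subset by blast
      show "(\<Sum>x\<in>?A. phase m u x) = (\<Sum>x\<in>?A. phase m u x * \<theta> x w)"
        unfolding rescale_sum[OF k w s(1) per, symmetric] using phase w by (intro sum.cong) auto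
    qed
    also have "\<dots> = (\<Sum>x\<in>?A. phase m u x * (\<Sum>w\<in>?W. \<theta> x w))"
      by (subst sum.swap) (simp add: sum_distrib_left)
    also have "\<dots> = 0" using zero by simp
    finally have "of_nat (card ?W) * (\<Sum>x\<in>?A. phase m u x) = 0" .
    moreover have "0 \<in> (ints :: ('k ^ 'n) set)" by (simp add: ints_def)
    then have "card ?W \<noteq> 0" using finite_vrep_ints[of M, where 'n = 'n] by auto
    ultimately show ?thesis by simp
  qed
  then show ?thesis using that[OF \<kappa>] by blast
qed

end

section \<open>Summation over the level sets\<close>

text \<open>With \<open>t = y^(e+1)\<close>, one factor \<open>y^s\<close> is paired with each of
  the \<open>e\<close> factors \<open>s + 2\<close>, giving bounded products, and the remaining
  \<open>y^s\<close> is a geometric series.\<close>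

lemma summable_poly_geometric:
  fixes t :: real
  assumes t: "0 < t" "t < 1"
  shows "summable (\<lambda>s. (real s + 2) ^ e * t ^ s)"
proof -
  define y where "y = t powr (1 / real (Suc e))"
  have y: "0 < y" "y < 1" using t powr_less_mono2[of "1 / real (Suc e)" t 1] by (auto simp: y_def)
  have yt: "y ^ Suc e = t" unfolding y_def using t by (subst powr_power) auto
  have "(\<lambda>s. real s * y ^ s) \<longlonglongrightarrow> 0" using y by (intro powser_times_n_limit_0) auto
  then have "Bseq (\<lambda>s. real s * y ^ s)" using convergentI convergent_imp_Bseq by blast
  then obtain B where B: "0 < B" "\<And>s. norm (real s * y ^ s) \<le> B" by (auto simp: Bseq_def)
  have b: "(real s + 2) * y ^ s \<le> B + 2" for s
    using B(2)[of s] y power_le_one[of y s] by (simp add: distrib_right)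
  have "(real s + 2) ^ e * t ^ s \<le> (B + 2) ^ e * y ^ s" for s
  proof -
    have "(real s + 2) ^ e * t ^ s = ((real s + 2) * y ^ s) ^ e * y ^ s"
      unfolding yt[symmetric] by (simp add: power_mult_distrib mult_ac flip: power_mult)
    also have "\<dots> \<le> (B + 2) ^ e * y ^ s"
      using b y by (intro mult_right_mono power_mono) auto
    finally show ?thesis .
  qed
  then have "norm ((real s + 2) ^ e * t ^ s) \<le> (B + 2) ^ e * y ^ s" for s using t by simp
  moreover have "summable (\<lambda>s. (B + 2) ^ e * y ^ s)" using y by (intro summable_mult summable_geometric) auto
  ultimately show ?thesis by (rule summable_comparison_test'[rotated])
qed

section \<open>Counting the remaining points and passing to the limit\<close>

context nondegenerate_sum
begin

lemma rho_power_le_1: "\<rho> ^ l \<le> 1"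
  using rho_pos rho_less_1 by (simp add: power_le_one)

lemma finite_vrep_sdom: "finite (vrep M ` sdom)"
  using finite_vrep_saturated[OF saturated_sum_domain[of 1 J], of M] by simp

lemma card_level_set_le:
  assumes "\<And>i. k $ i \<le> M"
  shows "card (level_set M k) \<le> q ^ (\<Sum>i\<in>UNIV. M - k $ i)"
proof -
  let ?B = "vrep M ` {x :: 'k ^ 'n. \<forall>i. absval (x $ i - 0 $ i) \<le> \<rho> ^ (k $ i)}"
  have "?B \<subseteq> vrep M ` ints"
    by (intro image_mono) (auto simp: ints_def intro: order_trans[OF _ rho_power_le_1])
  then have "finite ?B" using finite_vrep_ints finite_subset by blast
  moreover have "level_set M k \<subseteq> ?B"
  proof
    fix x assume x: "x \<in> level_set M k"
    then have "x = vrep M x" by (auto simp: level_set_def)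
    then show "x \<in> ?B" using x by (intro image_eqI[of _ _ x]) (auto simp: level_set_def)
  qed
  ultimately have "card (level_set M k) \<le> card ?B" by (rule card_mono)
  then show ?thesis using card_vrep_ball[of "\<lambda>i. k $ i" M 0] assms by simp
qed

text \<open>Coordinate \<open>i\<close> has a single class modulo \<open>\<pi>^M\<close>, which
  leaves \<open>n - 1\<close> free coordinates.\<close>

lemma card_near_zero:
  "card {x \<in> vrep M ` sdom. absval (x $ i) \<le> \<rho> ^ M} \<le> q ^ (M * (CARD('n) - 1))"
proof -
  let ?k = "\<lambda>j. if j = i then M else 0"
  let ?B = "vrep M ` {x :: 'k ^ 'n. \<forall>j. absval (x $ j - 0 $ j) \<le> \<rho> ^ ?k j}"
  have "?B \<subseteq> vrep M ` ints"
    unfolding ints_def by (intro image_mono Collect_mono impI allI order_trans[OF _ rho_power_le_1]) (drule spec, simp)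
  then have fin: "finite ?B" using finite_vrep_ints finite_subset by blast
  have "{x \<in> vrep M ` sdom. absval (x $ i) \<le> \<rho> ^ M} \<subseteq> ?B"
  proof
    fix x assume x: "x \<in> {x \<in> vrep M ` sdom. absval (x $ i) \<le> \<rho> ^ M}"
    then have "x = vrep M x" "x \<in> vrep M ` ints"
      using saturated_sum_domain[of 1 J] by (auto simp: saturated_def)
    then have "x \<in> ints" using vrep_ints_subset by blast
    then show "x \<in> ?B" using x \<open>x = vrep M x\<close> by (intro image_eqI[of _ _ x]) (auto simp: ints_def)
  qed
  then have "card {x \<in> vrep M ` sdom. absval (x $ i) \<le> \<rho> ^ M} \<le> card ?B" using fin by (intro card_mono)
  also have "\<dots> = q ^ (\<Sum>j\<in>UNIV. M - ?k j)" by (rule card_vrep_ball) simp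
  also have "(\<Sum>j\<in>UNIV. M - ?k j) = (\<Sum>j\<in>UNIV - {i}. M)"
    by (rule sum.mono_neutral_cong_right) auto
  also have "\<dots> = M * (CARD('n) - 1)" by (simp add: card_Diff_singleton)
  finally show ?thesis .
qed

lemma finite_exponents: "finite {k :: nat ^ 'n. \<forall>i. k $ i < M}"
  using finite_vec_box[of "\<lambda>_. {..<M}"] by simp

text \<open>Off the first set every coordinate has a valuation below \<open>M\<close>, and the unit
  condition on \<open>J\<close> makes the valuation vector admissible.\<close>

lemma vrep_sdom_decomposition:
  "vrep M ` sdom = {x \<in> vrep M ` sdom. \<exists>i. absval (x $ i) \<le> \<rho> ^ M} \<union>
    (\<Union>k\<in>{k. admissible k \<and> (\<forall>i. k $ i < M)}. level_set M k)" if M: "1 \<le> M"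
proof (intro equalityI subsetI)
  fix x assume x: "x \<in> vrep M ` sdom"
  show "x \<in> {x \<in> vrep M ` sdom. \<exists>i. absval (x $ i) \<le> \<rho> ^ M} \<union>
    (\<Union>k\<in>{k. admissible k \<and> (\<forall>i. k $ i < M)}. level_set M k)"
  proof (cases "\<exists>i. absval (x $ i) \<le> \<rho> ^ M")
    case False
    have xd: "x \<in> sdom" using x vrep_mem_saturated[OF saturated_sum_domain[OF M]] by blast
    have "\<exists>l. absval (x $ i) = \<rho> ^ l" for i
    proof (rule absval_integral)
      show "x $ i \<noteq> 0" using False rho_pos by (auto simp: not_le dest: spec[of _ i])
      show "absval (x $ i) \<le> 1" using xd by (cases "i \<in> J") (auto simp: sum_domain_def unit_group_def valuation_ring_def)
    qed blast
    then obtain l where l: "\<And>i. absval (x $ i) = \<rho> ^ l i" by metis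
    have lM: "l i < M" for i
    proof (rule ccontr)
      assume "\<not> l i < M"
      then have "\<rho> ^ l i \<le> \<rho> ^ M" using rho_pos rho_less_1 by (intro power_decreasing) auto
      moreover have "\<not> absval (x $ i) \<le> \<rho> ^ M" using False by blast
      ultimately show False using l[of i] by simp
    qed
    have "l i = 0" if "i \<in> J" for i
    proof (rule ccontr)
      assume "l i \<noteq> 0"
      then have "\<rho> ^ l i < 1" using rho_pos rho_less_1 by (simp add: power_less_one_iff)
      then show False using l[of i] xd that by (auto simp: sum_domain_def unit_group_def)
    qed
    then have "admissible (\<chi> i. l i)" by (simp add: admissible_def)
    moreover have "x \<in> level_set M (\<chi> i. l i)" using x l by (simp add: level_set_def)
    ultimately show ?thesis using lM by (intro UnI2 UN_I[of "\<chi> i. l i"]) auto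
  qed (use x in blast)
qed (auto simp: level_set_def)

text \<open>All phases have norm 1, so whatever does not cancel is bounded by the number of its
  points.\<close>

lemma norm_phase_sum_le:
  assumes M: "1 \<le> M"
    and van: "\<And>k. \<lbrakk>admissible k; \<And>i. k $ i < M; dord k + M0 \<le> m\<rbrakk> \<Longrightarrow> (\<Sum>x\<in>level_set M k. phase m u x) = 0"
  shows "norm (\<Sum>x\<in>vrep M ` sdom. phase m u x) \<le> real (CARD('n) * q ^ (M * (CARD('n) - 1))) +
    (\<Sum>k\<in>{k. admissible k \<and> (\<forall>i. k $ i < M) \<and> m < dord k + M0}. real (q ^ (\<Sum>i\<in>UNIV. M - k $ i)))"
proof -
  let ?V = "vrep M ` sdom"
  let ?Z = "{x \<in> ?V. \<exists>i. absval (x $ i) \<le> \<rho> ^ M}"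
  let ?K = "{k. admissible k \<and> (\<forall>i. k $ i < M)}"
  let ?K' = "{k. admissible k \<and> (\<forall>i. k $ i < M) \<and> m < dord k + M0}"
  have finV: "finite ?V" by (rule finite_vrep_sdom)
  have finK: "finite ?K" using finite_exponents by (rule finite_subset[rotated]) auto
  have finL: "finite (level_set M k)" for k using finV by (simp add: level_set_def)
  have disj: "?Z \<inter> (\<Union>k\<in>?K. level_set M k) = {}"
  proof -
    have "\<rho> ^ M < \<rho> ^ l" if "l < M" for l using that rho_pos rho_less_1 by (intro power_strict_decreasing)
    then have "\<not> absval (x $ i) \<le> \<rho> ^ M" if "x \<in> level_set M k" "k $ i < M" for x k i
      using that by (simp add: level_set_def not_le)
    then show ?thesis by blast
  qed
  have norm1: "norm (phase m u x) = 1" for x by (simp add: phase_def)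
  have "(\<Sum>x\<in>?V. phase m u x) = (\<Sum>x\<in>?Z. phase m u x) + (\<Sum>x\<in>(\<Union>k\<in>?K. level_set M k). phase m u x)"
    using finV finK finL disj by (subst vrep_sdom_decomposition[OF M]) (intro sum.union_disjoint, auto)
  also have "(\<Sum>x\<in>(\<Union>k\<in>?K. level_set M k). phase m u x) = (\<Sum>k\<in>?K. \<Sum>x\<in>level_set M k. phase m u x)"
  proof (rule sum.UNION_disjoint)
    have "k = l" if "x \<in> level_set M k" "x \<in> level_set M l" for x k l
    proof -
      have "\<rho> ^ (k $ i) = \<rho> ^ (l $ i)" for i using that by (simp add: level_set_def)
      then have "k $ i = l $ i" for i
        using power_strict_decreasing_iff[OF rho_pos rho_less_1] by (metis nat_neq_iff less_irrefl)
      then show ?thesis by (simp add: vec_eq_iff)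
    qed
    then show "\<forall>i\<in>?K. \<forall>j\<in>?K. i \<noteq> j \<longrightarrow> level_set M i \<inter> level_set M j = {}" by blast
  qed (use finK finL in auto)
  also have "\<dots> = (\<Sum>k\<in>?K'. \<Sum>x\<in>level_set M k. phase m u x)"
  proof (intro sum.mono_neutral_right finK ballI)
    fix k assume "k \<in> ?K - ?K'"
    then have "admissible k" "\<forall>i. k $ i < M" "\<not> m < dord k + M0" by blast+
    then show "(\<Sum>x\<in>level_set M k. phase m u x) = 0" by (simp add: van not_less)
  qed auto
  finally have eq: "(\<Sum>x\<in>?V. phase m u x) = (\<Sum>x\<in>?Z. phase m u x) + (\<Sum>k\<in>?K'. \<Sum>x\<in>level_set M k. phase m u x)" .
  have "norm (\<Sum>x\<in>?Z. phase m u x) \<le> real (card ?Z)"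
    using norm_sum[of "phase m u" ?Z] by (simp add: norm1)
  also have "\<dots> \<le> real (CARD('n) * q ^ (M * (CARD('n) - 1)))"
  proof -
    have "?Z = (\<Union>i. {x \<in> ?V. absval (x $ i) \<le> \<rho> ^ M})" by auto
    then have "card ?Z \<le> (\<Sum>i\<in>UNIV. card {x \<in> ?V. absval (x $ i) \<le> \<rho> ^ M})"
      using card_UN_le[of UNIV "\<lambda>i. {x \<in> ?V. absval (x $ i) \<le> \<rho> ^ M}"] by simp
    also have "\<dots> \<le> (\<Sum>i\<in>(UNIV :: 'n set). q ^ (M * (CARD('n) - 1)))" by (intro sum_mono card_near_zero)
    finally have "card ?Z \<le> CARD('n) * q ^ (M * (CARD('n) - 1))" by simp
    then show ?thesis by (rule of_nat_mono)
  qed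
  finally have 1: "norm (\<Sum>x\<in>?Z. phase m u x) \<le> real (CARD('n) * q ^ (M * (CARD('n) - 1)))" .
  have "norm (\<Sum>k\<in>?K'. \<Sum>x\<in>level_set M k. phase m u x) \<le> (\<Sum>k\<in>?K'. real (q ^ (\<Sum>i\<in>UNIV. M - k $ i)))"
  proof (rule sum_norm_le)
    fix k assume k: "k \<in> ?K'"
    have "norm (\<Sum>x\<in>level_set M k. phase m u x) \<le> real (card (level_set M k))"
      using norm_sum[of "phase m u" "level_set M k"] by (simp add: norm1)
    also have "\<dots> \<le> real (q ^ (\<Sum>i\<in>UNIV. M - k $ i))"
      using k card_level_set_le[of k M] by (simp add: less_imp_le del: of_nat_power)
    finally show "norm (\<Sum>x\<in>level_set M k. phase m u x) \<le> real (q ^ (\<Sum>i\<in>UNIV. M - k $ i))" .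
  qed
  with 1 show ?thesis unfolding eq by (rule norm_triangle_mono)
qed

definition decay :: real where
  "decay = real q powr fan_beta F G"

lemma decay: "0 < decay" "decay < 1"
  using q_gt_1 beta_neg by (simp_all add: decay_def powr_less_one)

lemma inverse_power_weight_le:
  assumes k: "admissible k"
  shows "1 / real q ^ (\<Sum>i\<in>UNIV. k $ i) \<le> decay ^ dord k"
proof -
  have "1 / real q ^ (\<Sum>i\<in>UNIV. k $ i) = real q powr (- real (\<Sum>i\<in>UNIV. k $ i))"
    using q_gt_1 by (simp add: powr_minus powr_realpow inverse_eq_divide del: of_nat_sum)
  also have "\<dots> \<le> real q powr (fan_beta F G * real (dord k))"
    using weight_lower_bound[OF k] q_gt_1 by (intro powr_mono) auto
  also have "\<dots> = decay ^ dord k" using q_gt_1 by (simp add: decay_def powr_power mult.commute)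
  finally show ?thesis .
qed

text \<open>Grouping by the value of \<open>dord\<close> gives a polynomial times geometric tail
  starting at \<open>m - M0\<close>. The constant does not depend on \<open>K\<close>, which later
  grows with \<open>M\<close>.\<close>

lemma decay_sum_bound:
  obtains C where "0 < C" "\<And>K m. \<lbrakk>finite K; \<And>k. k \<in> K \<Longrightarrow> admissible k \<and> m < dord k + M0; 1 \<le> m; M0 \<le> m\<rbrakk> \<Longrightarrow>
    (\<Sum>k\<in>K. decay ^ dord k) \<le> C * real m ^ (CARD('n) - 1) * decay ^ m"
proof -
  let ?e = "CARD('n) - 1"
  define g where "g s = (real s + 2) ^ ?e * decay ^ s" for s :: nat
  have g0: "0 \<le> g s" for s using decay by (simp add: g_def)
  have sg: "summable g" unfolding g_def using decay by (rule summable_poly_geometric)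
  \<comment> \<open>The denominator converts \<open>decay ^ (m - M0)\<close> into
    \<open>decay ^ m\<close>; the summand 1 ensures positivity.\<close>
  define C where "C = (real (card F) * suminf g + 1) / decay ^ M0"
  have "0 \<le> suminf g" using sg g0 by (rule suminf_nonneg)
  then have "0 \<le> real (card F) * suminf g" by simp
  then have C: "0 < C" using decay by (simp add: C_def)
  have "(\<Sum>k\<in>K. decay ^ dord k) \<le> C * real m ^ ?e * decay ^ m"
    if fin: "finite K" and K: "\<And>k. k \<in> K \<Longrightarrow> admissible k \<and> m < dord k + M0" and m: "1 \<le> m" "M0 \<le> m" for K m
  proof -
    define a where "a = m - M0"
    have ge: "a \<le> t" if "t \<in> dord ` K" for t using that K unfolding a_def by fastforce
    have "(\<Sum>k\<in>K. decay ^ dord k) = (\<Sum>t\<in>dord ` K. \<Sum>k\<in>{k \<in> K. dord k = t}. decay ^ dord k)"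
      by (rule sum.image_gen[OF fin])
    also have "\<dots> = (\<Sum>t\<in>dord ` K. real (card {k \<in> K. dord k = t}) * decay ^ t)"
      by (intro sum.cong) auto
    also have "\<dots> \<le> (\<Sum>t\<in>dord ` K. real (card F) * real m ^ ?e * decay ^ a * g (t - a))"
    proof (rule sum_mono)
      fix t assume t: "t \<in> dord ` K"
      have at: "t = a + (t - a)" using ge[OF t] by simp
      have "card {k \<in> K. dord k = t} \<le> card {k. admissible k \<and> dord k = t}"
        using K by (intro card_mono card_level_set(1)) auto
      also have "\<dots> \<le> card F * (t + 1) ^ ?e" by (rule card_level_set(2))
      finally have "real (card {k \<in> K. dord k = t}) \<le> real (card F * (t + 1) ^ ?e)"
        by (rule of_nat_mono)
      also have "\<dots> = real (card F) * real (t + 1) ^ ?e" by simp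
      also have "\<dots> \<le> real (card F) * (real m * (real (t - a) + 2)) ^ ?e"
      proof (intro mult_left_mono power_mono)
        \<comment> \<open>With \<open>s = t - a\<close>, the bound
          \<open>t + 1 \<le> m * (s + 2)\<close> separates \<open>m\<close> from the summation
          variable; its power is the source of the factor \<open>m ^ (n - 1)\<close>.\<close>
        have "t + 1 \<le> m + (t - a) + 1" using at a_def by simp
        also have "\<dots> \<le> m * ((t - a) + 2)"
        proof -
          have "(t - a) \<le> m * (t - a)" using m by simp
          then show ?thesis using m by (simp add: algebra_simps)
        qed
        finally have "t + 1 \<le> m * ((t - a) + 2)" .
        then have "real (t + 1) \<le> real (m * ((t - a) + 2))" by (rule of_nat_mono)
        then show "real (t + 1) \<le> real m * (real (t - a) + 2)"
          by (simp only: of_nat_add of_nat_mult of_nat_numeral)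
      qed auto
      finally have "real (card {k \<in> K. dord k = t}) * decay ^ t \<le>
          real (card F) * (real m * (real (t - a) + 2)) ^ ?e * decay ^ t"
        using decay by (intro mult_right_mono) auto
      also have "\<dots> = real (card F) * real m ^ ?e * decay ^ a * g (t - a)"
      proof -
        have "decay ^ t = decay ^ a * decay ^ (t - a)"
          unfolding power_add[symmetric] using ge[OF t] by simp
        then show ?thesis by (simp add: g_def power_mult_distrib mult_ac)
      qed
      finally show "real (card {k \<in> K. dord k = t}) * decay ^ t \<le> real (card F) * real m ^ ?e * decay ^ a * g (t - a)" .
    qed
    also have "\<dots> = real (card F) * real m ^ ?e * decay ^ a * (\<Sum>t\<in>dord ` K. g (t - a))"
      by (simp add: sum_distrib_left)
    also have "(\<Sum>t\<in>dord ` K. g (t - a)) = (\<Sum>s\<in>(\<lambda>t. t - a) ` dord ` K. g s)"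
    proof -
      have "inj_on (\<lambda>t. t - a) (dord ` K)" by (rule inj_onI) (metis ge eq_diff_iff)
      then show ?thesis by (simp add: sum.reindex)
    qed
    also have "\<dots> \<le> suminf g" using sg g0 fin by (intro sum_le_suminf) auto
    finally have "(\<Sum>k\<in>K. decay ^ dord k) \<le> real (card F) * real m ^ ?e * decay ^ a * suminf g"
      using decay by (simp add: mult_left_mono)
    also have "\<dots> = (real (card F) * suminf g) / decay ^ M0 * real m ^ ?e * decay ^ m"
    proof -
      have "decay ^ m = decay ^ a * decay ^ M0" using m(2) by (simp add: a_def flip: power_add)
      then show ?thesis using decay by simp
    qed
    also have "\<dots> \<le> C * real m ^ ?e * decay ^ m"
      unfolding C_def using decay by (intro mult_right_mono divide_right_mono) auto
    finally show ?thesis .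
  qed
  then show ?thesis using that[OF C] by blast
qed

theorem exp_sum_bound:
  "\<exists>C>0. \<forall>\<^sub>F m in sequentially. \<forall>u\<in>unit_group.
    norm (exp_sum p \<iota> \<pi> J f m u) \<le> C * real m ^ (CARD('n) - 1) * real q powr (real m * fan_beta F G)"
proof -
  obtain M0 \<kappa> where \<kappa>: "0 < \<kappa>" "\<And>z. absval z \<le> \<kappa> \<Longrightarrow> add_char p \<iota> z = 1"
    and van: "\<And>k m M u. \<lbrakk>admissible k; \<And>i. k $ i < M; dord k + M0 \<le> m; absval u = 1;
      coef_bound * \<rho> ^ M \<le> \<kappa> * \<rho> ^ m\<rbrakk> \<Longrightarrow> (\<Sum>x\<in>level_set M k. phase m u x) = 0"
    using level_sum_vanishes by metis
  obtain C where C: "0 < C" "\<And>K m. \<lbrakk>finite K; \<And>k. k \<in> K \<Longrightarrow> admissible k \<and> m < dord k + M0; 1 \<le> m; M0 \<le> m\<rbrakk> \<Longrightarrow>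
    (\<Sum>k\<in>K. decay ^ dord k) \<le> C * real m ^ (CARD('n) - 1) * decay ^ m"
    using decay_sum_bound by metis
  have q0: "0 < real q" using q_gt_1 by simp
  have "norm (exp_sum p \<iota> \<pi> J f m u) \<le> C * real m ^ (CARD('n) - 1) * decay ^ m"
    if m: "1 \<le> m" "M0 \<le> m" and u: "u \<in> unit_group" for m u
  proof -
    have u1: "absval u = 1" using u by (simp add: unit_group_def)
    \<comment> \<open>The exponential sum on the left does not involve \<open>M\<close>; only the
      first term on the right does.\<close>
    have bound: "norm (exp_sum p \<iota> \<pi> J f m u) \<le> real CARD('n) * (1 / real q) ^ M + C * real m ^ (CARD('n) - 1) * decay ^ m"
      if mM: "m \<le> M" and M: "coef_bound * \<rho> ^ M \<le> \<kappa> * \<rho> ^ m" for M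
    proof -
      let ?K = "{k. admissible k \<and> (\<forall>i. k $ i < M) \<and> m < dord k + M0}"
      let ?Q = "real q ^ (M * CARD('n))"
      have per: "periodic_on sdom M (phase m u)" using \<kappa>(2) u1 M by (rule phase_periodic)
      have "exp_sum p \<iota> \<pi> J f m u = (\<Sum>x\<in>vrep M ` sdom. phase m u x) / of_nat (q ^ (M * CARD('n)))"
        using exp_sum_eq[OF m(1) mM per[unfolded phase_def]] unfolding phase_def .
      then have "norm (exp_sum p \<iota> \<pi> J f m u) = norm (\<Sum>x\<in>vrep M ` sdom. phase m u x) / ?Q"
        by (simp add: norm_divide norm_power)
      also have "\<dots> \<le> (real (CARD('n) * q ^ (M * (CARD('n) - 1))) + (\<Sum>k\<in>?K. real (q ^ (\<Sum>i\<in>UNIV. M - k $ i)))) / ?Q"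
        using van[OF _ _ _ u1 M] m mM q0 by (intro divide_right_mono norm_phase_sum_le) auto
      also have "\<dots> = real CARD('n) * (1 / real q) ^ M + (\<Sum>k\<in>?K. 1 / real q ^ (\<Sum>i\<in>UNIV. k $ i))"
      proof -
        have "real (CARD('n) * q ^ (M * (CARD('n) - 1))) / ?Q = real CARD('n) * (1 / real q) ^ M"
        proof -
          have "0 < CARD('n)" by simp
          then have "M * CARD('n) = M * (CARD('n) - 1) + M" by (cases "CARD('n)") auto
          then have "?Q = real q ^ (M * (CARD('n) - 1)) * real q ^ M" by (simp only: power_add)
          then show ?thesis using q0 by (simp add: power_divide)
        qed
        moreover have "real (q ^ (\<Sum>i\<in>UNIV. M - k $ i)) / ?Q = 1 / real q ^ (\<Sum>i\<in>UNIV. k $ i)" if k: "k \<in> ?K" for k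
        proof -
          have "(\<Sum>i\<in>(UNIV :: 'n set). M - k $ i) + (\<Sum>i\<in>UNIV. k $ i) = (\<Sum>i\<in>(UNIV :: 'n set). M)"
            unfolding sum.distrib[symmetric] using k by (intro sum.cong) (auto simp: less_imp_le)
          then have "M * CARD('n) = (\<Sum>i\<in>(UNIV :: 'n set). M - k $ i) + (\<Sum>i\<in>UNIV. k $ i)"
            by (simp add: mult.commute)
          then have "?Q = real q ^ (\<Sum>i\<in>UNIV. M - k $ i) * real q ^ (\<Sum>i\<in>UNIV. k $ i)" by (simp only: power_add)
          then show ?thesis using q0 by simp
        qed
        ultimately show ?thesis by (simp add: add_divide_distrib sum_divide_distrib)
      qed
      also have "\<dots> \<le> real CARD('n) * (1 / real q) ^ M + (\<Sum>k\<in>?K. decay ^ dord k)"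
        by (intro add_left_mono sum_mono inverse_power_weight_le) auto
      also have "(\<Sum>k\<in>?K. decay ^ dord k) \<le> C * real m ^ (CARD('n) - 1) * decay ^ m"
        using m finite_exponents[of M] by (intro C(2)) (auto intro: finite_subset[rotated])
      finally show ?thesis by simp
    qed
    \<comment> \<open>All large \<open>M\<close> satisfy the requirement of \<open>bound\<close>, so
      the limit in \<open>M\<close> may be taken with \<open>m\<close> fixed, and the term for
      points near the coordinate hyperplanes disappears.\<close>
    have "(\<lambda>M. coef_bound * \<rho> ^ M) \<longlonglongrightarrow> coef_bound * 0"
      using rho_pos rho_less_1 by (intro tendsto_mult_left LIMSEQ_power_zero) auto
    moreover have "coef_bound * 0 < \<kappa> * \<rho> ^ m" using \<kappa>(1) rho_pos by simp
    ultimately have "\<forall>\<^sub>F M in sequentially. coef_bound * \<rho> ^ M < \<kappa> * \<rho> ^ m" by (rule order_tendstoD)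
    then have "\<forall>\<^sub>F M in sequentially. norm (exp_sum p \<iota> \<pi> J f m u) \<le>
        real CARD('n) * (1 / real q) ^ M + C * real m ^ (CARD('n) - 1) * decay ^ m"
      using eventually_ge_at_top[of m] by eventually_elim (rule bound, auto)
    moreover have "(\<lambda>M. real CARD('n) * (1 / real q) ^ M + C * real m ^ (CARD('n) - 1) * decay ^ m)
        \<longlonglongrightarrow> real CARD('n) * 0 + C * real m ^ (CARD('n) - 1) * decay ^ m"
      using q_gt_1 by (intro tendsto_intros LIMSEQ_power_zero) auto
    ultimately have "norm (exp_sum p \<iota> \<pi> J f m u) \<le> real CARD('n) * 0 + C * real m ^ (CARD('n) - 1) * decay ^ m"
      by (intro tendsto_lowerbound[OF _ _ sequentially_bot])
    then show ?thesis by simp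
  qed
  moreover have "decay ^ m = real q powr (real m * fan_beta F G)" for m
    using q0 by (simp add: decay_def powr_power mult.commute)
  ultimately show ?thesis
    using C(1) unfolding eventually_sequentially by (intro exI[of _ C] conjI exI[of _ "max 1 M0"]) auto
qed

end

lemma keys_laurent_frac_nonneg:
  assumes "m \<in> Poly_Mapping.keys (laurent_frac g J d)" "i \<notin> J"
  shows "0 \<le> m $ i"
proof -
  have "m \<in> (\<Union>k\<in>Poly_Mapping.keys g. Poly_Mapping.keys (Poly_Mapping.single
      (\<chi> i. int (k $ i) - (if i \<in> J then int (d i) else 0)) (Poly_Mapping.lookup g k)))"
    by (rule subsetD[OF keys_sum assms(1)[unfolded laurent_frac_def]])
  then show ?thesis using assms(2) by (auto split: if_splits)
qed

theorem corollary4p3: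
  fixes p :: nat
    and \<iota> :: "'q::nonarch_field \<Rightarrow> 'k::nonarch_field"
    and \<pi> :: 'k
    and I :: "'n::finite set"
    and r :: nat
    and d :: "'n \<Rightarrow> nat"
    and fhat :: "nat ^ 'n \<Rightarrow>\<^sub>0 'k"
    and f :: "('k, 'n) laurent"
    and F :: "(real ^ 'n) set set"
  assumes K: "padic_field p \<iota>"
    and unif: "uniformizer \<pi>"
    and r: "1 \<le> r" "r \<le> CARD('n) - 1" "card I = r"
    and f: "f = laurent_frac fhat I d"
    and nonconst: "\<nexists>c. f = Poly_Mapping.single 0 c"
    and dim: "aff_dim (newton_polytope f) = int CARD('n)"
    and nondeg: "weakly_nondegenerate f"
    and simple: "simple_fan F"
    and nontrivial: "F \<noteq> trivial_fan"
    and subord: "subordinated F (newton_polytope f)"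
    and supp: "\<Union> F = orthant"
    and crit: "{x \<in> torus. \<forall>i. laurent_eval (laurent_pderiv i f) x = 0} = {}"
    and d_nonzero: "\<And>\<sigma> S a. \<lbrakk>\<sigma> \<in> F; aff_dim \<sigma> = int CARD('n); spans_cone S \<sigma>; a \<in> S\<rbrakk>
      \<Longrightarrow> support_fun (newton_polytope f) (real_vec a) \<noteq> 0"
  shows "\<exists>C>0. \<forall>\<^sub>F m in sequentially. \<forall>u\<in>unit_group.
    norm (exp_sum p \<iota> \<pi> I f m u) \<le>
      C * real m ^ (CARD('n) - 1)
        * real (residue_card TYPE('k)) powr (real m * fan_beta F (newton_polytope f))"
proof -
  interpret padic_field p \<iota> by (rule K)
  interpret padic_uniformizer p \<iota> \<pi> by unfold_locales (rule unif)
  interpret nondegenerate_sum p \<iota> \<pi> f I F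
  proof unfold_locales
    \<comment> \<open>The zero Laurent polynomial is constant.\<close>
    show "Poly_Mapping.keys f \<noteq> {}"
    proof
      assume "Poly_Mapping.keys f = {}"
      then have "f = Poly_Mapping.single 0 0" by simp
      then show False using nonconst by blast
    qed
    show "I \<noteq> {}" using r by auto
    show "0 \<le> m $ i" if "m \<in> Poly_Mapping.keys f" "i \<notin> I" for m i
      using that keys_laurent_frac_nonneg unfolding f by blast
    show "subordinated F (convex hull real_vec ` Poly_Mapping.keys f)"
      using subord by (simp add: newton_polytope_def)
    show "support_fun (convex hull real_vec ` Poly_Mapping.keys f) (real_vec a) \<noteq> 0"
      if "\<sigma> \<in> F" "aff_dim \<sigma> = int CARD('n)" "spans_cone S \<sigma>" "a \<in> S" for \<sigma> S a
      using d_nonzero[OF that] by (simp add: newton_polytope_def)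
  qed (use simple supp nondeg crit in auto)
  show ?thesis
    using exp_sum_bound unfolding newton_polytope_def q_def .
qed

end
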